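(* Let $\beta_c$ be the critical inverse temperature of the three-dimensional nearest-neighbour XY model, and for $n\ge 1$ let $B_n=\{z\in\mathbb{Z}^3:\ |z_k|\le n,\ k=1,2,3\}$. Then $$\lim_{n\to\infty}\frac{1}{|B_n|^2}\sum_{x,y\in B_n}\langle S_x\cdot S_y\rangle_{\beta_c,0}=0 .$$
   Context: Model. For an integer $L\ge1$ let $\Lambda_L=[-L,L]^3\cap\mathbb{Z}^3$, with boundary $\partial\Lambda_L=\{z\in\Lambda_L:\max(|z_1|,|z_2|,|z_3|)=L\}$ and interior $\Lambda_L^o=\Lambda_L\setminus\partial\Lambda_L$. To each $k\in\Lambda_L^o$ is attached a spin $S_k=(\cos\theta_k,\sin\theta_k)\in\mathbb{S}^1$. The coupling is $J_{k,l}=1/6$ if $|k-l|=1$ and $J_{k,l}=0$ otherwise. The Hamiltonian is $H_{L,\nu}=-\sum_{k,l\in\Lambda_L}J_{k,l}\,S_k\cdot S_l$, where the boundary spins are fixed: for the free boundary condition $\nu=0$, $S_k=0$ for $k\in\partial\Lambda_L$; for the plus boundary condition $\nu=+$, $S_k=(1,0)$ for $k\in\partial\Lambda_L$. For a local function $F$ of the spins set $\langle F\rangle_{\beta,\nu,L}=\int\prod_{k\in\Lambda_L^o}d\theta_k\,e^{-\beta H_{L,\nu}}F$, $Z_{\beta,\nu,L}=\langle 1\rangle_{\beta,\nu,L}$, and $\langle F\rangle_{\beta,\nu}=\lim_{L\to\infty}\langle F\rangle_{\beta,\nu,L}/Z_{\beta,\nu,L}$. The magnetization is $m^*(\beta)=\langle\cos\theta_0\rangle_{\beta,+}$,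 and $\beta_c>0$ is the critical inverse temperature: $m^*(\beta)=0$ for $\beta<\beta_c$ and $m^*(\beta)>0$ for $\beta>\beta_c$. *)

theory Defs
  imports "HOL-Analysis.Analysis"
begin

type_synonym site = "int \<times> int \<times> int"

definition supnorm :: "site \<Rightarrow> int" where
  "supnorm z = (case z of (a, b, c) \<Rightarrow> max \<bar>a\<bar> (max \<bar>b\<bar> \<bar>c\<bar>))"

definition box :: "nat \<Rightarrow> site set" where
  "box L = {z. supnorm z \<le> int L}"

definition bdry :: "nat \<Rightarrow> site set" where
  "bdry L = {z. supnorm z = int L}"

definition intr :: "nat \<Rightarrow> site set" where
  "intr L = box L - bdry L"

definition coupling :: "site \<Rightarrow> site \<Rightarrow> real" where
  "coupling k l = (case k of (k1, k2, k3) \<Rightarrow> case l of (l1, l2, l3) \<Rightarrow>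
      if (k1 - l1)^2 + (k2 - l2)^2 + (k3 - l3)^2 = 1 then 1/6 else 0)"

datatype bc = Free | Plus

definition spin :: "bc \<Rightarrow> nat \<Rightarrow> (site \<Rightarrow> real) \<Rightarrow> site \<Rightarrow> real \<times> real" where
  "spin \<nu> L \<theta> k =
     (if k \<in> intr L then (cos (\<theta> k), sin (\<theta> k))
      else if k \<in> bdry L \<and> \<nu> = Plus then (1, 0) else (0, 0))"

definition sdot :: "real \<times> real \<Rightarrow> real \<times> real \<Rightarrow> real" where
  "sdot s t = fst s * fst t + snd s * snd t"

definition hamiltonian :: "bc \<Rightarrow> nat \<Rightarrow> (site \<Rightarrow> real) \<Rightarrow> real" where
  "hamiltonian \<nu> L \<theta> =
     - (\<Sum>k\<in>box L. \<Sum>l\<in>box L. coupling k l * sdot (spin \<nu> L \<theta> k) (spin \<nu> L \<theta> l))"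

definition angle_measure :: "nat \<Rightarrow> (site \<Rightarrow> real) measure" where
  "angle_measure L = PiM (intr L) (\<lambda>_. restrict_space lborel {0..2*pi})"

definition fv_expect :: "real \<Rightarrow> bc \<Rightarrow> nat \<Rightarrow> ((site \<Rightarrow> real) \<Rightarrow> real) \<Rightarrow> real" where
  "fv_expect \<beta> \<nu> L F =
     integral\<^sup>L (angle_measure L) (\<lambda>\<theta>. exp (- \<beta> * hamiltonian \<nu> L \<theta>) * F \<theta>)"

definition partition_fn :: "real \<Rightarrow> bc \<Rightarrow> nat \<Rightarrow> real" where
  "partition_fn \<beta> \<nu> L = fv_expect \<beta> \<nu> L (\<lambda>_. 1)"

definition gibbs :: "real \<Rightarrow> bc \<Rightarrow> ((site \<Rightarrow> real) \<Rightarrow> real) \<Rightarrow> real" where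
  "gibbs \<beta> \<nu> F = lim (\<lambda>L. fv_expect \<beta> \<nu> L F / partition_fn \<beta> \<nu> L)"

definition spin_corr_obs :: "site \<Rightarrow> site \<Rightarrow> (site \<Rightarrow> real) \<Rightarrow> real" where
  "spin_corr_obs x y \<theta> = sdot (cos (\<theta> x), sin (\<theta> x)) (cos (\<theta> y), sin (\<theta> y))"

definition magnetization :: "real \<Rightarrow> real" where
  "magnetization \<beta> = gibbs \<beta> Plus (\<lambda>\<theta>. cos (\<theta> (0, 0, 0)))"

definition is_critical_beta :: "real \<Rightarrow> bool" where
  "is_critical_beta \<beta>c \<longleftrightarrow> \<beta>c > 0 \<and>
     (\<forall>\<beta>. 0 < \<beta> \<and> \<beta> < \<beta>c \<longrightarrow> magnetization \<beta> = 0) \<and>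
     (\<forall>\<beta>. \<beta> > \<beta>c \<longrightarrow> magnetization \<beta> > 0)"

end

theory Submission
  imports Defs "HOL-Number_Theory.Cong" "HOL-Real_Asymp.Real_Asymp"
begin

text \<open>
  Free-boundary correlations in a finite box are continuous in \<open>\<beta>\<close> and increase with the box (Ginibre),
  so it suffices to bound their average over \<open>B\<^sub>n\<close> by \<open>C / (\<beta> n)\<close> for every \<open>\<beta> < \<beta>c\<close>, uniformly in the
  box, and then let first \<open>\<beta> \<rightarrow> \<beta>c\<close> and then the box grow.

  By Ginibre's inequality free correlations are dominated by those of a large torus, and a torus
  correlation of two distant points is dominated by the plus-boundary magnetization of a box around
  one of them, which tends to \<open>0\<close> for \<open>\<beta> < \<beta>c\<close>; this controls the zero mode. The other modes are
  controlled by reflection positivity: Gaussian domination holds for an arbitrary antisymmetric edge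
  field \<open>h\<close>, not only for gradients, and gives \<open>\<Sum> d x d y \<langle>S x \<sqdot> S y\<rangle> \<le> 3 \<parallel>h\<parallel>\<^sup>2 / \<beta>\<close> for \<open>d = div h\<close>. No
  Fourier analysis is needed: the uniform distribution on \<open>B\<^sub>n\<close> can be spread over the torus by
  doubling side lengths one coordinate at a time, a flow with \<open>\<parallel>h\<parallel>\<^sup>2 = O(1 / n)\<close> in dimension three.

  All inequalities are proved for the \<open>q\<close>-state clock model with \<open>q\<close> odd, where expectations are finite
  sums, and are transferred to the XY model by letting \<open>q \<rightarrow> \<infinity>\<close>.
\<close>

section \<open>Positive definiteness of exponential kernels\<close>

text \<open>The uniform weight on the torus has non-zero total mass, so it is never a divergence;
  only the difference of two uniform distributions is. Expanding the quadratic form of that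
  difference leaves a cross term, the torus average of correlations with a point of the cube, and
  this is the one place where vanishing magnetization enters. Allowing every antisymmetric field
  costs nothing: among the fields with a given divergence the gradient of the potential has the
  least norm (Thomson's principle), so an explicit test flow can only worsen the constant. Dimension
  three enters through the energy of one doubling: a cube of side s needs a current of about 1/s^2
  on about s^3 bonds, energy about 1/s, and the norms s^(-1/2) are summable over dyadic scales,
  whereas in dimension two they would not decay. The final bound 432 / (\<beta> (2 n + 1)) depends
  neither on the torus nor on L, which lets the cube stay fixed while q, the torus, the wired box,
  \<beta> and L go to their limits in this order.\<close>

lemma power_kernel_psd:
  fixes f :: "'u \<Rightarrow> real" and a :: "'i \<Rightarrow> 'u \<Rightarrow> real"
  assumes "finite I"
  shows "0 \<le> (\<Sum>u\<in>U. \<Sum>v\<in>U. f u * f v * (\<Sum>i\<in>I. a i u * a i v) ^ n)"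
proof -
  have pow: "(\<Sum>i\<in>I. a i u * a i v) ^ n
      = (\<Sum>g\<in>PiE {..<n} (\<lambda>_. I). (\<Prod>k<n. a (g k) u) * (\<Prod>k<n. a (g k) v))" for u v
  proof -
    have "(\<Sum>i\<in>I. a i u * a i v) ^ n = (\<Prod>k<n. \<Sum>i\<in>I. a i u * a i v)" by simp
    also have "\<dots> = (\<Sum>g\<in>PiE {..<n} (\<lambda>_. I). \<Prod>k<n. a (g k) u * a (g k) v)"
      using assms by (subst prod_sum_PiE) auto
    finally show ?thesis by (simp add: prod.distrib)
  qed
  let ?P = "PiE {..<n} (\<lambda>_. I)"
  let ?h = "\<lambda>g u. f u * (\<Prod>k<n. a (g k) u)"
  have "(\<Sum>u\<in>U. \<Sum>v\<in>U. f u * f v * (\<Sum>i\<in>I. a i u * a i v) ^ n)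
      = (\<Sum>u\<in>U. \<Sum>v\<in>U. \<Sum>g\<in>?P. ?h g u * ?h g v)"
    by (simp add: pow sum_distrib_left mult_ac)
  also have "\<dots> = (\<Sum>u\<in>U. \<Sum>g\<in>?P. \<Sum>v\<in>U. ?h g u * ?h g v)"
    by (intro sum.cong sum.swap refl)
  also have "\<dots> = (\<Sum>g\<in>?P. \<Sum>u\<in>U. \<Sum>v\<in>U. ?h g u * ?h g v)"
    by (rule sum.swap)
  also have "\<dots> = (\<Sum>g\<in>?P. (\<Sum>u\<in>U. ?h g u)\<^sup>2)"
    by (simp add: power2_eq_square sum_product)
  finally show ?thesis by (simp add: sum_nonneg)
qed

text \<open>Powers of a Gram kernel are positive semidefinite, because the n-th power expands over
  words of length n into rank-one kernels, and the exponential series has nonnegative coefficients.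
  Both Ginibre's inequality and reflection positivity rest on this one fact.\<close>

lemma exp_kernel_psd:
  fixes f :: "'u \<Rightarrow> real" and a :: "'i \<Rightarrow> 'u \<Rightarrow> real"
  assumes "finite I"
  shows "0 \<le> (\<Sum>u\<in>U. \<Sum>v\<in>U. f u * f v * exp (\<Sum>i\<in>I. a i u * a i v))"
proof -
  let ?t = "\<lambda>u v. \<Sum>i\<in>I. a i u * a i v"
  have "(\<lambda>n. f u * f v * (?t u v ^ n /\<^sub>R fact n)) sums (f u * f v * exp (?t u v))" for u v
    by (intro sums_mult exp_converges)
  then have S: "(\<lambda>n. \<Sum>u\<in>U. \<Sum>v\<in>U. f u * f v * (?t u v ^ n /\<^sub>R fact n))
      sums (\<Sum>u\<in>U. \<Sum>v\<in>U. f u * f v * exp (?t u v))"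
    by (intro sums_sum)
  have P: "0 \<le> (\<Sum>u\<in>U. \<Sum>v\<in>U. f u * f v * (?t u v ^ n /\<^sub>R fact n))" for n
  proof -
    have "(\<Sum>u\<in>U. \<Sum>v\<in>U. f u * f v * (?t u v ^ n /\<^sub>R fact n))
        = (\<Sum>u\<in>U. \<Sum>v\<in>U. f u * f v * ?t u v ^ n) /\<^sub>R fact n"
      by (simp add: sum_distrib_left mult_ac)
    then show ?thesis using power_kernel_psd[OF assms, of f a n U] by simp
  qed
  show ?thesis
    by (rule sums_le[OF P sums_zero S])
qed

text \<open>Positivity of the exponential kernel on the disjoint union \<open>U <+> V\<close> makes
  a 2x2 form in (s, t) positive semidefinite, and its determinant is the claim.\<close>

lemma exp_kernel_Cauchy_Schwarz:
  fixes F :: "'u \<Rightarrow> real" and G :: "'v \<Rightarrow> real"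
    and a :: "'i \<Rightarrow> 'u \<Rightarrow> real" and b :: "'i \<Rightarrow> 'v \<Rightarrow> real"
  assumes "finite I" and U: "finite U" and V: "finite V"
  shows "(\<Sum>u\<in>U. \<Sum>v\<in>V. F u * G v * exp (\<Sum>i\<in>I. a i u * b i v))\<^sup>2
    \<le> (\<Sum>u\<in>U. \<Sum>v\<in>U. F u * F v * exp (\<Sum>i\<in>I. a i u * a i v))
      * (\<Sum>u\<in>V. \<Sum>v\<in>V. G u * G v * exp (\<Sum>i\<in>I. b i u * b i v))"
    (is "?B\<^sup>2 \<le> ?A * ?C")
proof -
  have quad: "0 \<le> s\<^sup>2 * ?A + 2 * s * t * ?B + t\<^sup>2 * ?C" for s t :: real
  proof -
    let ?f = "case_sum (\<lambda>u. s * F u) (\<lambda>v. t * G v)"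
    let ?a = "\<lambda>i. case_sum (a i) (b i)"
    have spl: "(\<Sum>w\<in>U <+> V. k w) = (\<Sum>u\<in>U. k (Inl u)) + (\<Sum>v\<in>V. k (Inr v))"
      for k :: "'u + 'v \<Rightarrow> real"
      using U V by (simp add: sum.Plus)
    have "0 \<le> (\<Sum>w\<in>U <+> V. \<Sum>z\<in>U <+> V. ?f w * ?f z * exp (\<Sum>i\<in>I. ?a i w * ?a i z))"
      by (rule exp_kernel_psd) fact
    also have "\<dots> = s\<^sup>2 * ?A + s * t * ?B
        + s * t * (\<Sum>v\<in>V. \<Sum>u\<in>U. F u * G v * exp (\<Sum>i\<in>I. a i u * b i v)) + t\<^sup>2 * ?C"
      by (simp add: spl sum.distrib sum_distrib_left power2_eq_square mult_ac)
    also have "(\<Sum>v\<in>V. \<Sum>u\<in>U. F u * G v * exp (\<Sum>i\<in>I. a i u * b i v)) = ?B"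
      by (rule sum.swap)
    finally show ?thesis by simp
  qed
  have A0: "0 \<le> ?A" and C0: "0 \<le> ?C"
    using quad[of 1 0] quad[of 0 1] by simp_all
  show ?thesis
  proof (cases "?A = 0")
    case True
    have "?B = 0"
    proof (rule ccontr)
      assume B: "?B \<noteq> 0"
      have "0 \<le> 2 * s * ?B + ?C" for s using quad[of s 1] True by simp
      \<comment> \<open>With A = 0 and t = 1 the form is affine in s, and this s gives it the value
        -1.\<close>
      from this[of "- (?C + 1) / (2 * ?B)"] B show False by (simp add: field_simps)
    qed
    then show ?thesis using True by simp
  next
    case False
    with A0 have A: "0 < ?A" by simp
    \<comment> \<open>The test vector (s, t) = (B, -A) turns the form into A (A C - B^2).\<close>
    have "0 \<le> ?B\<^sup>2 * ?A + 2 * ?B * (- ?A) * ?B + (- ?A)\<^sup>2 * ?C" by (rule quad)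
    then have "0 \<le> ?A * (?A * ?C - ?B\<^sup>2)" by (simp add: algebra_simps power2_eq_square)
    with A show ?thesis by (simp add: zero_le_mult_iff)
  qed
qed

section \<open>Correlation inequalities for the clock model\<close>

definition conf :: "nat \<Rightarrow> 'v set \<Rightarrow> ('v \<Rightarrow> int) set" where
  "conf q V = PiE V (\<lambda>_. {0..<int q})"

definition dcos :: "nat \<Rightarrow> ('v \<Rightarrow> int) \<Rightarrow> 'v \<Rightarrow> 'v \<Rightarrow> real" where
  "dcos q \<theta> x y = cos (2 * pi / real q * real_of_int (\<theta> x - \<theta> y))"

definition energy :: "nat \<Rightarrow> 'v set \<Rightarrow> ('v \<Rightarrow> 'v \<Rightarrow> real) \<Rightarrow> ('v \<Rightarrow> int) \<Rightarrow> real" where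
  "energy q V J \<theta> = (\<Sum>x\<in>V. \<Sum>y\<in>V. J x y * dcos q \<theta> x y)"

text \<open>Wiring is a hard constraint on a fixed configuration space, not a contraction of
  \<open>W\<close> to a point, so that models with different wired sets on the same \<open>V\<close>
  can be compared in one inequality.\<close>

definition wsum :: "nat \<Rightarrow> 'v set \<Rightarrow> ('v \<Rightarrow> 'v \<Rightarrow> real) \<Rightarrow> 'v set \<Rightarrow> 'v \<Rightarrow> (('v \<Rightarrow> int) \<Rightarrow> real) \<Rightarrow> real"
  where "wsum q V J W g f =
    (\<Sum>\<theta>\<in>conf q V. if \<forall>w\<in>W. \<theta> w = \<theta> g then f \<theta> * exp (energy q V J \<theta>) else 0)"

definition wcorr :: "nat \<Rightarrow> 'v set \<Rightarrow> ('v \<Rightarrow> 'v \<Rightarrow> real) \<Rightarrow> 'v set \<Rightarrow> 'v \<Rightarrow> 'v \<Rightarrow> 'v \<Rightarrow> real" where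
  "wcorr q V J W g x y = wsum q V J W g (\<lambda>\<theta>. dcos q \<theta> x y) / wsum q V J W g (\<lambda>_. 1)"

lemma finite_conf [simp]: "finite V \<Longrightarrow> finite (conf q V)"
  unfolding conf_def by (intro finite_PiE) auto

lemma cos_mod_shift:
  assumes "q > 0" "[k = l] (mod int q)"
  shows "cos (2 * pi / real q * real_of_int k) = cos (2 * pi / real q * real_of_int l)"
proof -
  from assms(2) obtain n where "k = l + int q * n"
    by (metis cong_iff_lin cong_sym)
  then have "2 * pi / real q * real_of_int k = 2 * pi / real q * real_of_int l + real_of_int n * (2 * pi)"
    using assms(1) by (simp add: field_simps)
  then show ?thesis
    using cos.plus_of_int[of "2 * pi / real q * real_of_int l" n] by simp
qed

lemma sum_conf_double:
  fixes h :: "('v \<Rightarrow> int) \<Rightarrow> ('v \<Rightarrow> int) \<Rightarrow> real"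
  assumes q: "odd q" and V: "finite V"
  shows "(\<Sum>\<theta>\<in>conf q V. \<Sum>\<theta>'\<in>conf q V. h \<theta> \<theta>') =
    (\<Sum>\<phi>\<in>conf q V. \<Sum>\<psi>\<in>conf q V.
      h (\<lambda>x\<in>V. (\<phi> x - \<psi> x) mod int q) (\<lambda>x\<in>V. (\<phi> x + \<psi> x) mod int q))"
proof -
  let ?C = "conf q V \<times> conf q V"
  let ?T = "\<lambda>(\<phi>, \<psi>). ((\<lambda>x\<in>V. (\<phi> x - \<psi> x) mod int q), (\<lambda>x\<in>V. (\<phi> x + \<psi> x) mod int q))"
  have q0: "q > 0" using q by (cases q) auto
  have fin: "finite ?C" using V by simp
  have into: "?T ` ?C \<subseteq> ?C"
    using q0 by (auto simp: conf_def PiE_def extensional_def Pi_def)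
  have inj: "inj_on ?T ?C"
  proof (rule inj_onI, clarify)
    fix a b c d assume m: "a \<in> conf q V" "b \<in> conf q V" "c \<in> conf q V" "d \<in> conf q V"
      and e1: "(\<lambda>x\<in>V. (a x - b x) mod int q) = (\<lambda>x\<in>V. (c x - d x) mod int q)"
      and e2: "(\<lambda>x\<in>V. (a x + b x) mod int q) = (\<lambda>x\<in>V. (c x + d x) mod int q)"
    have "a x = c x \<and> b x = d x" if x: "x \<in> V" for x
    proof -
      have c1: "[a x - b x = c x - d x] (mod int q)" and c2: "[a x + b x = c x + d x] (mod int q)"
        using fun_cong[OF e1, of x] fun_cong[OF e2, of x] x by (simp_all add: cong_def)
      have cop: "coprime 2 (int q)" using q by simp
      have "[2 * a x = 2 * c x] (mod int q)" using cong_add[OF c1 c2] by simp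
      then have "[a x = c x] (mod int q)" using cop by (simp add: cong_mult_lcancel)
      moreover have "[2 * b x = 2 * d x] (mod int q)" using cong_diff[OF c2 c1] by simp
      then have "[b x = d x] (mod int q)" using cop by (simp add: cong_mult_lcancel)
      moreover have "0 \<le> a x" "a x < int q" "0 \<le> b x" "b x < int q"
        "0 \<le> c x" "c x < int q" "0 \<le> d x" "d x < int q"
        using m x by (auto simp: conf_def PiE_def Pi_def)
      ultimately show ?thesis by (simp add: cong_def)
    qed
    moreover have "a x = c x \<and> b x = d x" if "x \<notin> V" for x
      using m that by (auto simp: conf_def PiE_def extensional_def)
    ultimately show "a = c \<and> b = d" by blast
  qed
  have "bij_betw ?T ?C ?C"
    using fin into inj by (simp add: bij_betw_def endo_inj_surj)
  from sum.reindex_bij_betw[OF this, of "\<lambda>(\<theta>, \<theta>'). h \<theta> \<theta>'"]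
  show ?thesis by (simp add: sum.cartesian_product case_prod_unfold)
qed

lemma dcos_mod:
  assumes "q > 0" "x \<in> V" "y \<in> V"
  shows "dcos q (\<lambda>x\<in>V. f x mod int q) x y = dcos q f x y"
  unfolding dcos_def using assms
  by (intro cos_mod_shift) (auto simp: cong_def mod_diff_eq)

text \<open>Ginibre's duplication: in the variables \<open>\<theta> = \<phi> - \<psi>\<close>, \<open>\<theta>' = \<phi> + \<psi>\<close> the difference of the two
  expectations becomes a quadratic form with exponential kernel. The substitution is a bijection
  because 2 is invertible modulo an odd number.\<close>

lemma wsum_Ginibre:
  assumes q: "odd q" and V: "finite V" and x: "x \<in> V" "y \<in> V"
    and J: "\<And>x y. x \<in> V \<Longrightarrow> y \<in> V \<Longrightarrow> 0 \<le> J x y \<and> J x y \<le> J' x y"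
  shows "wsum q V J {} g (\<lambda>\<theta>. dcos q \<theta> x y) * wsum q V J' {} g (\<lambda>_. 1)
    \<le> wsum q V J' {} g (\<lambda>\<theta>. dcos q \<theta> x y) * wsum q V J {} g (\<lambda>_. 1)"
proof -
  let ?C = "conf q V"
  let ?w = "2 * pi / real q"
  have q0: "q > 0" using q by (cases q) auto
  define c where "c \<phi> x y = cos (?w * real_of_int (\<phi> x - \<phi> y))" for \<phi> :: "'a \<Rightarrow> int" and x y
  define s where "s \<phi> x y = sin (?w * real_of_int (\<phi> x - \<phi> y))" for \<phi> :: "'a \<Rightarrow> int" and x y
  \<comment> \<open>In the new variables J' cos + J cos becomes (J' + J) c c + (J' - J) s s. Since 0
    \<le> J \<le> J', both weights are nonnegative and can be split into square roots, which
    exhibits a Gram kernel.\<close>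
  define a where "a i \<phi> = (case i of Inl (x, y) \<Rightarrow> sqrt (J' x y + J x y) * c \<phi> x y
      | Inr (x, y) \<Rightarrow> sqrt (J' x y - J x y) * s \<phi> x y)" for i \<phi>
  let ?I = "(V \<times> V) <+> (V \<times> V)"
  have d1: "dcos q (\<lambda>x. \<phi> x - \<psi> x) x y = c \<phi> x y * c \<psi> x y + s \<phi> x y * s \<psi> x y"
    and d2: "dcos q (\<lambda>x. \<phi> x + \<psi> x) x y = c \<phi> x y * c \<psi> x y - s \<phi> x y * s \<psi> x y"
    for \<phi> \<psi> :: "'a \<Rightarrow> int" and x y
  proof -
    have "w * real_of_int ((\<phi> x - \<psi> x) - (\<phi> y - \<psi> y))
        = w * real_of_int (\<phi> x - \<phi> y) - w * real_of_int (\<psi> x - \<psi> y)"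
      "w * real_of_int ((\<phi> x + \<psi> x) - (\<phi> y + \<psi> y))
        = w * real_of_int (\<phi> x - \<phi> y) + w * real_of_int (\<psi> x - \<psi> y)" for w :: real
      by (simp_all add: algebra_simps)
    from this[of ?w] show "dcos q (\<lambda>x. \<phi> x - \<psi> x) x y = c \<phi> x y * c \<psi> x y + s \<phi> x y * s \<psi> x y"
      "dcos q (\<lambda>x. \<phi> x + \<psi> x) x y = c \<phi> x y * c \<psi> x y - s \<phi> x y * s \<psi> x y"
      unfolding dcos_def c_def s_def by (simp_all only: cos_diff cos_add)
  qed
  have ker: "(\<Sum>i\<in>?I. a i \<phi> * a i \<psi>)
      = energy q V J' (\<lambda>x. \<phi> x - \<psi> x) + energy q V J (\<lambda>x. \<phi> x + \<psi> x)" for \<phi> \<psi>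
  proof -
    have sq: "sqrt r * u * (sqrt r * v) = r * (u * v)" if "0 \<le> r" for r u v :: real
      using that by (metis mult.assoc mult.left_commute real_sqrt_mult_self abs_of_nonneg)
    have "(\<Sum>i\<in>?I. a i \<phi> * a i \<psi>) =
      (\<Sum>p\<in>V\<times>V. a (Inl p) \<phi> * a (Inl p) \<psi>) + (\<Sum>p\<in>V\<times>V. a (Inr p) \<phi> * a (Inr p) \<psi>)"
      using V by (simp add: sum.Plus)
    also have "(\<Sum>p\<in>V\<times>V. a (Inl p) \<phi> * a (Inl p) \<psi>)
        = (\<Sum>x\<in>V. \<Sum>y\<in>V. (J' x y + J x y) * (c \<phi> x y * c \<psi> x y))"
      unfolding sum.cartesian_product a_def
      by (intro sum.cong refl) (auto simp: sq J add_nonneg_nonneg order_trans[OF conjunct1[OF J] conjunct2[OF J]])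
    also have "(\<Sum>p\<in>V\<times>V. a (Inr p) \<phi> * a (Inr p) \<psi>)
        = (\<Sum>x\<in>V. \<Sum>y\<in>V. (J' x y - J x y) * (s \<phi> x y * s \<psi> x y))"
      unfolding sum.cartesian_product a_def
      by (intro sum.cong refl) (auto simp: sq J)
    finally show ?thesis
      by (simp add: energy_def d1 d2 sum.distrib[symmetric]) (simp add: algebra_simps)
  qed
  \<comment> \<open>The difference of the two cosines is 2 s \<phi> s \<psi>, a product prefactor as
    \<open>exp_kernel_psd\<close> requires.\<close>
  have "0 \<le> (\<Sum>\<phi>\<in>?C. \<Sum>\<psi>\<in>?C. s \<phi> x y * s \<psi> x y * exp (\<Sum>i\<in>?I. a i \<phi> * a i \<psi>))"
    by (rule exp_kernel_psd) (simp add: V)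
  also have "2 * \<dots> = (\<Sum>\<phi>\<in>?C. \<Sum>\<psi>\<in>?C.
      (dcos q (\<lambda>x. \<phi> x - \<psi> x) x y - dcos q (\<lambda>x. \<phi> x + \<psi> x) x y) *
        exp (energy q V J' (\<lambda>x. \<phi> x - \<psi> x) + energy q V J (\<lambda>x. \<phi> x + \<psi> x)))"
    by (simp add: ker d1 d2 sum_distrib_left mult_ac)
  also have "\<dots> = (\<Sum>\<theta>\<in>?C. \<Sum>\<theta>'\<in>?C. (dcos q \<theta> x y - dcos q \<theta>' x y) *
      exp (energy q V J' \<theta> + energy q V J \<theta>'))"
    unfolding sum_conf_double[OF q V, where h = "\<lambda>\<theta> \<theta>'. (dcos q \<theta> x y - dcos q \<theta>' x y) *
      exp (energy q V J' \<theta> + energy q V J \<theta>')"]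
    by (intro sum.cong refl arg_cong2[where f = "(*)"] arg_cong2[where f = "(-)"]
        arg_cong2[where f = "(+)"] arg_cong[where f = exp])
      (simp_all add: energy_def dcos_mod q0 x)
  also have "\<dots> = wsum q V J' {} g (\<lambda>\<theta>. dcos q \<theta> x y) * wsum q V J {} g (\<lambda>_. 1)
      - wsum q V J' {} g (\<lambda>_. 1) * wsum q V J {} g (\<lambda>\<theta>. dcos q \<theta> x y)"
    unfolding wsum_def sum_product sum_subtractf[symmetric]
    by (intro sum.cong refl) (simp add: exp_add algebra_simps)
  finally show ?thesis by (simp add: mult.commute)
qed

lemma dcos_eq_1_iff:
  assumes "\<theta> \<in> conf q V" "x \<in> V" "y \<in> V"
  shows "dcos q \<theta> x y = 1 \<longleftrightarrow> \<theta> x = \<theta> y"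
proof
  have b: "0 \<le> \<theta> x" "\<theta> x < int q" "0 \<le> \<theta> y" "\<theta> y < int q"
    using assms by (auto simp: conf_def PiE_def Pi_def)
  assume "dcos q \<theta> x y = 1"
  then obtain n :: int where "2 * pi / real q * real_of_int (\<theta> x - \<theta> y) = of_int n * 2 * pi"
    unfolding dcos_def cos_one_2pi_int by auto
  then have "2 * pi * real_of_int (\<theta> x - \<theta> y) = 2 * pi * real_of_int (n * int q)"
    using b by (simp add: field_simps)
  then have "real_of_int (\<theta> x - \<theta> y) = real_of_int (n * int q)"
    by (subst (asm) mult_left_cancel) auto
  then have "\<theta> x - \<theta> y = n * int q" by (simp only: of_int_eq_iff)
  moreover have "\<bar>\<theta> x - \<theta> y\<bar> < int q" using b by auto
  ultimately have "\<theta> x - \<theta> y = 0"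
    by (metis abs_mult abs_of_nat dvd_imp_le_int dvd_triv_right linorder_not_less)
  then show "\<theta> x = \<theta> y" by simp
qed (simp add: dcos_def)

text \<open>Wiring is the limit of an infinite ferromagnetic coupling to \<open>g\<close>.\<close>

lemma wsum_wired_limit:
  assumes V: "finite V" and W: "W \<subseteq> V" and g: "g \<in> V"
  shows "(\<lambda>n. exp (- real n * real (card W)) *
      wsum q V (\<lambda>x y. J x y + (if x \<in> W \<and> y = g then real n else 0)) {} g f)
    \<longlonglongrightarrow> wsum q V J W g f"
proof -
  have finW: "finite W" using V W finite_subset by blast
  have en: "energy q V (\<lambda>x y. J x y + (if x \<in> W \<and> y = g then real n else 0)) \<theta>
      = energy q V J \<theta> + real n * (\<Sum>w\<in>W. dcos q \<theta> w g)" for n \<theta>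
  proof -
    have "(\<Sum>y\<in>V. (if x \<in> W \<and> y = g then real n else 0) * dcos q \<theta> x y)
        = (if x \<in> W then real n * dcos q \<theta> x g else 0)" for x
    proof -
      have "(\<Sum>y\<in>V. (if x \<in> W \<and> y = g then real n else 0) * dcos q \<theta> x y)
         = (\<Sum>y\<in>V. if y = g then (if x \<in> W then real n * dcos q \<theta> x g else 0) else 0)"
        by (intro sum.cong) auto
      then show ?thesis using V g by simp
    qed
    moreover have "(\<Sum>x\<in>V. if x \<in> W then real n * dcos q \<theta> x g else 0) = (\<Sum>x\<in>W. real n * dcos q \<theta> x g)"
      using V W by (simp add: sum.If_cases inf.absorb2)
    ultimately show ?thesis
      unfolding energy_def by (simp add: distrib_right sum.distrib sum_distrib_left)
  qed
  have "(\<lambda>n. exp (- real n * real (card W)) * (f \<theta> * exp (energy q V J \<theta> + real n * (\<Sum>w\<in>W. dcos q \<theta> w g))))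
     \<longlonglongrightarrow> (if \<forall>w\<in>W. \<theta> w = \<theta> g then f \<theta> * exp (energy q V J \<theta>) else 0)" if \<theta>: "\<theta> \<in> conf q V" for \<theta>
  proof -
    \<comment> \<open>D is the alignment deficit: the normalisation cancels the extra energy of
      aligned configurations exactly, and every other configuration keeps a factor exp (- D) ^ n
      with D > 0.\<close>
    define D where "D = real (card W) - (\<Sum>w\<in>W. dcos q \<theta> w g)"
    have D: "D = (\<Sum>w\<in>W. 1 - dcos q \<theta> w g)" by (simp add: D_def sum_subtractf)
    have le: "0 \<le> 1 - dcos q \<theta> w g" for w by (simp add: dcos_def)
    have form: "exp (- real n * real (card W)) * (f \<theta> * exp (energy q V J \<theta> + real n * (\<Sum>w\<in>W. dcos q \<theta> w g)))
       = f \<theta> * exp (energy q V J \<theta>) * exp (- D) ^ n" for n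
      by (simp add: D_def exp_of_nat_mult[symmetric] exp_add[symmetric] mult_ac) (simp add: algebra_simps)
    show ?thesis
    proof (cases "\<forall>w\<in>W. \<theta> w = \<theta> g")
      case True
      then have "D = 0" by (simp add: D dcos_def)
      with True show ?thesis unfolding form by simp
    next
      case False
      then obtain w where w: "w \<in> W" "\<theta> w \<noteq> \<theta> g" by blast
      then have "dcos q \<theta> w g \<noteq> 1" using dcos_eq_1_iff[OF \<theta>, of w g] W g by auto
      with le[of w] have "0 < 1 - dcos q \<theta> w g" by linarith
      then have "0 < D" unfolding D by (rule sum_pos2[OF finW w(1)]) (rule le)
      then have "(\<lambda>n. f \<theta> * exp (energy q V J \<theta>) * exp (- D) ^ n) \<longlonglongrightarrow> f \<theta> * exp (energy q V J \<theta>) * 0"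
        by (intro tendsto_intros LIMSEQ_power_zero) simp
      with False show ?thesis by (simp only: form) auto
    qed
  qed
  then show ?thesis
    unfolding wsum_def en sum_distrib_left by (auto intro!: tendsto_sum)
qed

lemma wsum_1_pos:
  assumes "finite V" "q > 0" "W \<subseteq> V" "g \<in> V"
  shows "0 < wsum q V J W g (\<lambda>_. 1)"
proof -
  have "(\<lambda>x\<in>V. 0) \<in> conf q V" using assms by (auto simp: conf_def)
  then show ?thesis
    unfolding wsum_def using assms
    by (intro sum_pos2[where i = "\<lambda>x\<in>V. 0"]) auto
qed

text \<open>Before the limit, enlarging the wired set is only an increase of couplings to
  \<open>g\<close>, so both monotonicities are one application of Ginibre. In product form the
  normalising factors of the two wired sets simply multiply through.\<close>

lemma wcorr_mono:
  assumes q: "odd q" and V: "finite V" and x: "x \<in> V" "y \<in> V" and g: "g \<in> V"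
    and W: "W \<subseteq> W'" "W' \<subseteq> V"
    and J: "\<And>x y. x \<in> V \<Longrightarrow> y \<in> V \<Longrightarrow> 0 \<le> J x y \<and> J x y \<le> J' x y"
  shows "wcorr q V J W g x y \<le> wcorr q V J' W' g x y"
proof -
  have q0: "q > 0" using q by (cases q) auto
  let ?J = "\<lambda>n x y. J x y + (if x \<in> W \<and> y = g then real n else 0)"
  let ?J' = "\<lambda>n x y. J' x y + (if x \<in> W' \<and> y = g then real n else 0)"
  let ?f = "\<lambda>\<theta>. dcos q \<theta> x y" and ?one = "\<lambda>_. 1 :: real"
  let ?e = "\<lambda>W n. exp (- real n * real (card W))"
  have WV: "W \<subseteq> V" using W by blast
  have step: "(?e W n * wsum q V (?J n) {} g ?f) * (?e W' n * wsum q V (?J' n) {} g ?one)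
      \<le> (?e W' n * wsum q V (?J' n) {} g ?f) * (?e W n * wsum q V (?J n) {} g ?one)" for n
  proof -
    have "0 \<le> ?J n x y \<and> ?J n x y \<le> ?J' n x y" if "x \<in> V" "y \<in> V" for x y
      using J[OF that] W by auto
    then have "wsum q V (?J n) {} g ?f * wsum q V (?J' n) {} g ?one
      \<le> wsum q V (?J' n) {} g ?f * wsum q V (?J n) {} g ?one"
      by (intro wsum_Ginibre q V x) auto
    from mult_left_mono[OF this, of "?e W n * ?e W' n"] show ?thesis by (simp add: mult_ac)
  qed
  have "wsum q V J W g ?f * wsum q V J' W' g ?one \<le> wsum q V J' W' g ?f * wsum q V J W g ?one"
    by (rule LIMSEQ_le[OF tendsto_mult[OF wsum_wired_limit[OF V WV g] wsum_wired_limit[OF V W(2) g]]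
          tendsto_mult[OF wsum_wired_limit[OF V W(2) g] wsum_wired_limit[OF V WV g]]])
      (use step in blast)
  moreover have "0 < wsum q V J W g ?one" "0 < wsum q V J' W' g ?one"
    using V q0 W WV g by (auto intro: wsum_1_pos)
  ultimately show ?thesis unfolding wcorr_def by (simp add: field_simps)
qed

section \<open>Reflection positivity and Gaussian domination\<close>

text \<open>A reflection through bond midplanes: no site is fixed, the halves are exchanged, and by
  the last clause a crossing edge joins a site to its mirror image, so the interaction between the
  halves is diagonal in mirror pairs.\<close>

definition is_reflection :: "'v set \<Rightarrow> ('v \<times> 'v) set \<Rightarrow> ('v \<Rightarrow> 'v) \<Rightarrow> 'v set \<Rightarrow> bool" where
  "is_reflection V E r L \<longleftrightarrow> L \<subseteq> V \<and> (\<forall>x\<in>V. r x \<in> V \<and> r (r x) = x \<and> (r x \<in> L \<longleftrightarrow> x \<notin> L)) \<and>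
    (\<forall>x y. (x, y) \<in> E \<longrightarrow> (r x, r y) \<in> E) \<and>
    (\<forall>x y. (x, y) \<in> E \<longrightarrow> (x \<in> L \<longleftrightarrow> y \<notin> L) \<longrightarrow> y = r x)"

text \<open>|S_i - S_j - t e_1|^2 for spins S = (c, s): only the first component is shifted.
  Abstract \<open>c\<close> and \<open>s\<close> allow the components to be swapped later.\<close>

definition sqdist :: "(int \<Rightarrow> real) \<Rightarrow> (int \<Rightarrow> real) \<Rightarrow> int \<Rightarrow> int \<Rightarrow> real \<Rightarrow> real" where
  "sqdist c s i j t = (c i - c j - t)\<^sup>2 + (s i - s j)\<^sup>2"

definition shift_energy ::
  "(int \<Rightarrow> real) \<Rightarrow> (int \<Rightarrow> real) \<Rightarrow> ('v \<times> 'v) set \<Rightarrow> ('v \<times> 'v \<Rightarrow> real) \<Rightarrow> ('v \<Rightarrow> int) \<Rightarrow> real" where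
  "shift_energy c s E h \<theta> = (\<Sum>(x, y)\<in>E. sqdist c s (\<theta> x) (\<theta> y) (h (x, y)))"

text \<open>\<open>E\<close> holds each bond in both orientations, hence \<kappa> / 2. For unit
  spins and h = 0 the squares expand to a constant times exp (\<kappa> sum over E of S_x .
  S_y).\<close>

definition shift_Z ::
  "nat \<Rightarrow> (int \<Rightarrow> real) \<Rightarrow> (int \<Rightarrow> real) \<Rightarrow> 'v set \<Rightarrow> ('v \<times> 'v) set \<Rightarrow> real \<Rightarrow> ('v \<times> 'v \<Rightarrow> real) \<Rightarrow> real" where
  "shift_Z q c s V E \<kappa> h = (\<Sum>\<theta>\<in>conf q V. exp (- \<kappa> / 2 * shift_energy c s E h \<theta>))"

text \<open>The part of \<open>h\<close> inside \<open>L\<close> is copied to both halves and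
  crossing edges get 0; these zeros are what lowers the number of non-zero edges in Gaussian
  domination.\<close>

definition fold_field ::
  "('v \<Rightarrow> 'v) \<Rightarrow> 'v set \<Rightarrow> ('v \<times> 'v) set \<Rightarrow> ('v \<times> 'v \<Rightarrow> real) \<Rightarrow> 'v \<times> 'v \<Rightarrow> real" where
  "fold_field r L E h = (\<lambda>(x, y). if (x, y) \<in> E then
      if x \<in> L \<and> y \<in> L then h (x, y) else if x \<notin> L \<and> y \<notin> L then h (r x, r y) else 0 else 0)"

definition antisym_field :: "('v \<times> 'v) set \<Rightarrow> ('v \<times> 'v \<Rightarrow> real) \<Rightarrow> bool" where
  "antisym_field E h \<longleftrightarrow> (\<forall>x y. (x, y) \<in> E \<longrightarrow> h (y, x) = - h (x, y))"

lemma is_reflection_complement: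
  assumes "is_reflection V E r L" "E \<subseteq> V \<times> V"
  shows "is_reflection V E r (V - L)"
  using assms unfolding is_reflection_def by (safe; blast)

lemma antisym_field_fold:
  assumes "sym E" and "\<And>x y. (x, y) \<in> E \<Longrightarrow> (r x, r y) \<in> E" and "antisym_field E h"
  shows "antisym_field E (fold_field r M E h)"
  unfolding antisym_field_def
proof (intro allI impI)
  fix x y assume xy: "(x, y) \<in> E"
  then have "(y, x) \<in> E" "h (y, x) = - h (x, y)" "h (r y, r x) = - h (r x, r y)"
    using assms unfolding antisym_field_def by (blast dest: symD)+
  with xy show "fold_field r M E h (y, x) = - fold_field r M E h (x, y)"
    by (auto simp: fold_field_def)
qed

context
  fixes V :: "'v set" and E :: "('v \<times> 'v) set" and r :: "'v \<Rightarrow> 'v" and L :: "'v set"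
  assumes V: "finite V" and E: "E \<subseteq> V \<times> V" and symE: "sym E" and R: "is_reflection V E r L"
begin

private definition EL where "EL = E \<inter> (L \<times> L)"
private definition X where "X = {x \<in> L. (x, r x) \<in> E}"
private definition join :: "('v \<Rightarrow> int) \<Rightarrow> ('v \<Rightarrow> int) \<Rightarrow> 'v \<Rightarrow> int" where
  "join u v = (\<lambda>x\<in>V. if x \<in> L then u x else v (r x))"

private lemma LV: "L \<subseteq> V" and rV: "x \<in> V \<Longrightarrow> r x \<in> V" and rr: "x \<in> V \<Longrightarrow> r (r x) = x"
  and rL: "x \<in> V \<Longrightarrow> r x \<in> L \<longleftrightarrow> x \<notin> L" and rE: "(x, y) \<in> E \<Longrightarrow> (r x, r y) \<in> E"
  and cross: "(x, y) \<in> E \<Longrightarrow> (x \<in> L \<longleftrightarrow> y \<notin> L) \<Longrightarrow> y = r x"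
  using R unfolding is_reflection_def by blast+

private lemma finE: "finite E"
  using V E by (meson finite_SigmaI finite_subset)

private lemma sum_join:
  fixes F :: "('v \<Rightarrow> int) \<Rightarrow> real"
  shows "(\<Sum>\<theta>\<in>conf q V. F \<theta>) = (\<Sum>u\<in>conf q L. \<Sum>v\<in>conf q L. F (join u v))"
proof -
  have "bij_betw (\<lambda>(u, v). join u v) (conf q L \<times> conf q L) (conf q V)"
  proof (rule bij_betw_byWitness[where f' = "\<lambda>\<theta>. (\<lambda>x\<in>L. \<theta> x, \<lambda>x\<in>L. \<theta> (r x))"])
    show "\<forall>p\<in>conf q L \<times> conf q L. (\<lambda>\<theta>. (\<lambda>x\<in>L. \<theta> x, \<lambda>x\<in>L. \<theta> (r x))) (case p of (u, v) \<Rightarrow> join u v) = p"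
      using LV rV rr rL
      by (auto simp: conf_def join_def PiE_def extensional_def restrict_def fun_eq_iff subset_eq)
    show "\<forall>\<theta>\<in>conf q V. (case (\<lambda>x\<in>L. \<theta> x, \<lambda>x\<in>L. \<theta> (r x)) of (u, v) \<Rightarrow> join u v) = \<theta>"
      using LV rV rr rL
      by (auto simp: conf_def join_def PiE_def extensional_def restrict_def fun_eq_iff subset_eq)
    show "(\<lambda>(u, v). join u v) ` (conf q L \<times> conf q L) \<subseteq> conf q V"
      using LV rV rL by (auto simp: conf_def join_def PiE_def Pi_def)
    show "(\<lambda>\<theta>. (\<lambda>x\<in>L. \<theta> x, \<lambda>x\<in>L. \<theta> (r x))) ` conf q V \<subseteq> conf q L \<times> conf q L"
      using LV rV by (auto simp: conf_def PiE_def Pi_def subset_eq)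
  qed
  from sum.reindex_bij_betw[OF this, of F] show ?thesis
    by (simp add: sum.cartesian_product case_prod_unfold)
qed

text \<open>An edge lies in \<open>L\<close>, is the mirror image of such an edge, or crosses.
  Crossing bonds occur in two orientations, with equal energy by antisymmetry of \<open>h\<close>,
  hence the factor 2.\<close>

private lemma shift_energy_join:
  assumes h: "antisym_field E h"
  shows "shift_energy c s E h (join u v) =
    (\<Sum>(x, y)\<in>EL. sqdist c s (u x) (u y) (h (x, y))) + (\<Sum>(x, y)\<in>EL. sqdist c s (v x) (v y) (h (r x, r y)))
    + 2 * (\<Sum>x\<in>X. sqdist c s (u x) (v x) (h (x, r x)))"
proof -
  let ?j = "join u v"
  let ?t = "\<lambda>(x, y). sqdist c s (?j x) (?j y) (h (x, y))"
  let ?rr = "\<lambda>(x, y). (r x, r y)"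
  let ?A = "?rr ` EL" and ?B = "(\<lambda>x. (x, r x)) ` X" and ?C = "(\<lambda>x. (r x, x)) ` X"
  have jL: "?j x = u x" if "x \<in> L" for x using that LV by (auto simp: join_def)
  have jR: "?j (r x) = v x" if "x \<in> L" for x using that LV rV rL rr by (auto simp: join_def)
  have part: "E = EL \<union> (?A \<union> (?B \<union> ?C))"
  proof (intro equalityI subsetI)
    fix e assume e: "e \<in> E"
    obtain x y where xy: "e = (x, y)" by fastforce
    with e E have v: "x \<in> V" "y \<in> V" by auto
    consider "x \<in> L" "y \<in> L" | "x \<notin> L" "y \<notin> L" | "x \<in> L" "y \<notin> L" | "x \<notin> L" "y \<in> L" by blast
    then show "e \<in> EL \<union> (?A \<union> (?B \<union> ?C))"
    proof cases
      case 1 then show ?thesis using e xy by (auto simp: EL_def)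
    next
      case 2
      then have "(r x, r y) \<in> EL" using rE e xy rL v by (auto simp: EL_def)
      then have "(r (r x), r (r y)) \<in> ?A" by (rule image_eqI[rotated]) simp
      then show ?thesis using rr v xy by simp
    next
      case 3
      then have "y = r x" using cross[of x y] e xy by auto
      then show ?thesis using 3 e xy by (auto simp: X_def)
    next
      case 4
      then have "y = r x" using cross[of x y] e xy by auto
      then have x: "x = r y" using rr v by simp
      have "(y, x) \<in> E" using symE e xy by (auto dest: symD)
      then have "y \<in> X" using 4 x by (auto simp: X_def)
      then show ?thesis using x xy by auto
    qed
  next
    fix e assume "e \<in> EL \<union> (?A \<union> (?B \<union> ?C))"
    then show "e \<in> E" using rE symE by (auto simp: EL_def X_def dest: symD)
  qed
  have fin: "finite EL" "finite X" using finE V LV by (auto simp: EL_def X_def intro: finite_subset)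
  have XL: "x \<in> L" if "x \<in> X" for x using that by (auto simp: X_def)
  have rnL: "r x \<notin> L" if "x \<in> L" for x using that rL LV by auto
  have d1: "EL \<inter> (?A \<union> (?B \<union> ?C)) = {}" using rnL by (auto simp: EL_def X_def)
  have d2: "?A \<inter> (?B \<union> ?C) = {}" using rnL by (auto simp: EL_def X_def)
  have d3: "?B \<inter> ?C = {}" using rnL by (auto simp: EL_def X_def)
  have "shift_energy c s E h ?j = sum ?t (EL \<union> (?A \<union> (?B \<union> ?C)))"
    unfolding shift_energy_def using part by simp
  also have "\<dots> = sum ?t EL + (sum ?t ?A + (sum ?t ?B + sum ?t ?C))"
    using fin d1 d2 d3 by (simp add: sum.union_disjoint)
  also have "sum ?t EL = (\<Sum>(x, y)\<in>EL. sqdist c s (u x) (u y) (h (x, y)))"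
    by (intro sum.cong refl) (auto simp: jL EL_def)
  also have "sum ?t ?A = (\<Sum>(x, y)\<in>EL. sqdist c s (v x) (v y) (h (r x, r y)))"
  proof -
    have "inj_on ?rr EL"
      using rr LV by (intro inj_on_inverseI[where g = ?rr]) (auto simp: EL_def)
    then have "sum ?t ?A = sum (?t \<circ> ?rr) EL" by (rule sum.reindex)
    also have "\<dots> = (\<Sum>(x, y)\<in>EL. sqdist c s (v x) (v y) (h (r x, r y)))"
      by (intro sum.cong refl) (auto simp: jR EL_def)
    finally show ?thesis .
  qed
  also have "sum ?t ?B = (\<Sum>x\<in>X. sqdist c s (u x) (v x) (h (x, r x)))"
    by (subst sum.reindex) (auto simp: inj_on_def jL jR XL intro!: sum.cong)
  also have "sum ?t ?C = (\<Sum>x\<in>X. sqdist c s (u x) (v x) (h (x, r x)))"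
  proof -
    have "h (r x, x) = - h (x, r x)" if "x \<in> X" for x
      using h that by (auto simp: antisym_field_def X_def)
    then show ?thesis
      by (subst sum.reindex)
        (auto simp: inj_on_def jL jR XL sqdist_def power2_eq_square algebra_simps intro!: sum.cong)
  qed
  finally show ?thesis by simp
qed

text \<open>The crossing shift is written as a difference a0 x - b0 x, one part attached to each
  side. Cauchy-Schwarz pairs each side with itself, so the shift becomes a0 - a0 or b0 - b0 and
  disappears.\<close>

private definition T where
  "T q c s \<kappa> k1 k2 a0 b0 = (\<Sum>u\<in>conf q L. \<Sum>v\<in>conf q L. exp (- \<kappa> / 2 *
     ((\<Sum>(x, y)\<in>EL. sqdist c s (u x) (u y) (k1 (x, y))) + (\<Sum>(x, y)\<in>EL. sqdist c s (v x) (v y) (k2 (x, y)))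
      + 2 * (\<Sum>x\<in>X. sqdist c s (u x) (v x) (a0 x - b0 x)))))"

text \<open>Each crossing square splits into a left part, a right part and a cross term, 2 \<kappa>
  times an inner product, which is a kernel of the type of \<open>exp_kernel_Cauchy_Schwarz\<close>;
  0 \<le> \<kappa> supplies the square roots.\<close>

private lemma T_Cauchy_Schwarz:
  assumes \<kappa>: "0 \<le> \<kappa>"
  shows "(T q c s \<kappa> k1 k2 a0 b0)\<^sup>2 \<le> T q c s \<kappa> k1 k1 a0 a0 * T q c s \<kappa> k2 k2 b0 b0"
proof -
  define F where "F k a0 u = exp (- \<kappa> / 2 * (\<Sum>(x, y)\<in>EL. sqdist c s (u x) (u y) (k (x, y)))
      - \<kappa> * (\<Sum>x\<in>X. (c (u x) - a0 x)\<^sup>2 + (s (u x))\<^sup>2))"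
    for k :: "'v \<times> 'v \<Rightarrow> real" and a0 and u :: "'v \<Rightarrow> int"
  define a where "a a0 i u = (case i of Inl x \<Rightarrow> sqrt (2 * \<kappa>) * (c (u x) - a0 x)
      | Inr x \<Rightarrow> sqrt (2 * \<kappa>) * s (u x))" for a0 and i :: "'v + 'v" and u :: "'v \<Rightarrow> int"
  have finX: "finite X" using V LV by (auto simp: X_def intro: finite_subset)
  have finL: "finite L" using V LV by (rule finite_subset[rotated])
  have eq: "T q c s \<kappa> k1 k2 a0 b0 = (\<Sum>u\<in>conf q L. \<Sum>v\<in>conf q L.
      F k1 a0 u * F k2 b0 v * exp (\<Sum>i\<in>X <+> X. a a0 i u * a b0 i v))" for k1 k2 a0 b0
  proof -
    have sq: "sqrt (2 * \<kappa>) * w * (sqrt (2 * \<kappa>) * z) = 2 * \<kappa> * (w * z)" for w z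
      using \<kappa> by (metis abs_of_nonneg mult.assoc mult.left_commute real_sqrt_mult_self
          mult_nonneg_nonneg zero_le_numeral)
    have ker: "(\<Sum>i\<in>X <+> X. a a0 i u * a b0 i v)
        = (\<Sum>x\<in>X. 2 * \<kappa> * ((c (u x) - a0 x) * (c (v x) - b0 x)) + 2 * \<kappa> * (s (u x) * s (v x)))" for u v
      using finX by (simp add: sum.Plus a_def sum.distrib sq)
    have cr: "\<kappa> * (\<Sum>x\<in>X. sqdist c s (u x) (v x) (a0 x - b0 x)) =
        \<kappa> * (\<Sum>x\<in>X. (c (u x) - a0 x)\<^sup>2 + (s (u x))\<^sup>2) + \<kappa> * (\<Sum>x\<in>X. (c (v x) - b0 x)\<^sup>2 + (s (v x))\<^sup>2)
        - (\<Sum>i\<in>X <+> X. a a0 i u * a b0 i v)" for u v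
      unfolding ker sum_distrib_left sum.distrib[symmetric] sum_subtractf[symmetric]
      by (intro sum.cong refl) (simp add: sqdist_def power2_eq_square algebra_simps)
    show ?thesis
      unfolding T_def F_def
      apply (intro sum.cong refl)
      apply (simp only: exp_add[symmetric] exp_minus)
      apply (rule arg_cong[where f = exp])
      subgoal for u v using cr[of u v] by (simp add: algebra_simps)
      done
  qed
  show ?thesis unfolding eq
    by (rule exp_kernel_Cauchy_Schwarz) (use finX finL in auto)
qed

lemma reflection_positivity:
  assumes h: "antisym_field E h" and \<kappa>: "0 \<le> \<kappa>"
  shows "(shift_Z q c s V E \<kappa> h)\<^sup>2
    \<le> shift_Z q c s V E \<kappa> (fold_field r L E h) * shift_Z q c s V E \<kappa> (fold_field r (V - L) E h)"
proof -
  have EL: "(x, y) \<in> E" "x \<in> L" "y \<in> L" "x \<in> V" "y \<in> V" "(r x, r y) \<in> E" "r x \<notin> L" "r y \<notin> L"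
      "r x \<in> V" "r y \<in> V"
    if "(x, y) \<in> EL" for x y using that LV rE rL rV by (auto simp: EL_def)
  have X: "(x, r x) \<in> E" "x \<in> L" "x \<in> V" "r x \<notin> L" "r x \<in> V" if "x \<in> X" for x
    using that LV rL rV by (auto simp: X_def)
  have anti: "antisym_field E (fold_field r M E h)" for M
    by (rule antisym_field_fold[OF symE _ h]) (rule rE)
  \<comment> \<open>The whole crossing shift is attached to the left side; the field of the right
    half is pulled back by r.\<close>
  have 1: "shift_Z q c s V E \<kappa> h = T q c s \<kappa> h (\<lambda>(x, y). h (r x, r y)) (\<lambda>x. h (x, r x)) (\<lambda>_. 0)"
    unfolding shift_Z_def sum_join shift_energy_join[OF h] T_def by simp
  have 2: "shift_Z q c s V E \<kappa> (fold_field r L E h) = T q c s \<kappa> h h (\<lambda>x. h (x, r x)) (\<lambda>x. h (x, r x))"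
    unfolding shift_Z_def sum_join shift_energy_join[OF anti] T_def
    by (intro sum.cong refl arg_cong[where f = exp] arg_cong2[where f = "(*)"] arg_cong2[where f = "(+)"])
      (auto simp: fold_field_def EL X rr split: if_splits)
  have 3: "shift_Z q c s V E \<kappa> (fold_field r (V - L) E h)
      = T q c s \<kappa> (\<lambda>(x, y). h (r x, r y)) (\<lambda>(x, y). h (r x, r y)) (\<lambda>_. 0) (\<lambda>_. 0)"
    unfolding shift_Z_def sum_join shift_energy_join[OF anti] T_def
    by (intro sum.cong refl arg_cong[where f = exp] arg_cong2[where f = "(*)"] arg_cong2[where f = "(+)"])
      (auto simp: fold_field_def EL X rr split: if_splits)
  show ?thesis unfolding 1 2 3 by (rule T_Cauchy_Schwarz) fact
qed

text \<open>Applied to both halves: the non-zero edges of the two foldings together number at most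
  twice the non-crossing non-zero edges of \<open>h\<close>, fewer than twice all of them as soon as
  one crossing edge is non-zero.\<close>

lemma fold_field_support_card:
  "card {e \<in> E. fold_field r L E h e \<noteq> 0} \<le> 2 * card {e \<in> E \<inter> L \<times> L. h e \<noteq> 0}"
proof -
  let ?S = "{e \<in> E \<inter> L \<times> L. h e \<noteq> 0}"
  let ?rr = "\<lambda>(x, y). (r x, r y)"
  have fin: "finite ?S" using finE by auto
  have "{e \<in> E. fold_field r L E h e \<noteq> 0} \<subseteq> ?S \<union> ?rr ` ?S"
  proof
    fix e assume e: "e \<in> {e \<in> E. fold_field r L E h e \<noteq> 0}"
    obtain x y where xy: "e = (x, y)" by fastforce
    with e E have v: "(x, y) \<in> E" "x \<in> V" "y \<in> V" by auto
    from e xy consider "x \<in> L" "y \<in> L" "h (x, y) \<noteq> 0" | "x \<notin> L" "y \<notin> L" "h (r x, r y) \<noteq> 0"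
      by (auto simp: fold_field_def split: if_splits)
    then show "e \<in> ?S \<union> ?rr ` ?S"
    proof cases
      case 1 then show ?thesis using v xy by auto
    next
      case 2
      then have "(r x, r y) \<in> ?S" using v rE rL by auto
      then have "?rr (r x, r y) \<in> ?rr ` ?S" by (rule imageI)
      then show ?thesis using rr v xy by simp
    qed
  qed
  then have "card {e \<in> E. fold_field r L E h e \<noteq> 0} \<le> card (?S \<union> ?rr ` ?S)"
    using fin by (intro card_mono) auto
  also have "\<dots> \<le> card ?S + card (?rr ` ?S)" by (rule card_Un_le)
  also have "\<dots> \<le> 2 * card ?S" using card_image_le[OF fin, of ?rr] by simp
  finally show ?thesis .
qed

end

section \<open>Gaussian domination and the infrared bound\<close>

lemma shift_Z_cong:
  assumes "\<And>e. e \<in> E \<Longrightarrow> h e = h' e"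
  shows "shift_Z q c s V E \<kappa> h = shift_Z q c s V E \<kappa> h'"
  unfolding shift_Z_def shift_energy_def
  using assms by (intro sum.cong refl arg_cong[where f = exp] arg_cong2[where f = "(*)"]) auto

text \<open>Folding never leaves the finite set of fields with values in \<open>insert 0 (range h)\<close>, so a maximiser
  of the partition function exists; one with the fewest non-zero edges must vanish, since folding
  at a non-zero edge would produce another maximiser with fewer.\<close>

theorem Gaussian_domination:
  fixes V :: "'v set"
  assumes V: "finite V" and q: "q > 0" and E: "E \<subseteq> V \<times> V" and symE: "sym E" and \<kappa>: "0 \<le> \<kappa>"
    and R: "\<And>x y. (x, y) \<in> E \<Longrightarrow> \<exists>r L. is_reflection V E r L \<and> (x \<in> L \<longleftrightarrow> y \<notin> L)"
    and h: "antisym_field E h"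
  shows "shift_Z q c s V E \<kappa> h \<le> shift_Z q c s V E \<kappa> (\<lambda>_. 0)"
proof -
  have finE: "finite E" using V E by (meson finite_SigmaI finite_subset)
  let ?Z = "shift_Z q c s V E \<kappa>"
  define B where "B = insert 0 (h ` E)"
  define \<Phi> where "\<Phi> = {k. antisym_field E k \<and> (\<forall>e. (e \<in> E \<longrightarrow> k e \<in> B) \<and> (e \<notin> E \<longrightarrow> k e = 0))}"
  define h0 where "h0 e = (if e \<in> E then h e else 0)" for e
  have Zpos: "0 < ?Z k" for k
  proof -
    have "(\<lambda>x\<in>V. 0) \<in> conf q V" using q by (auto simp: conf_def)
    then show ?thesis unfolding shift_Z_def using V by (intro sum_pos) auto
  qed
  have "antisym_field E h0"
    unfolding antisym_field_def
  proof (intro allI impI)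
    fix x y assume xy: "(x, y) \<in> E"
    then have "h (y, x) = - h (x, y)" using h unfolding antisym_field_def by blast
    with xy symD[OF symE xy] show "h0 (y, x) = - h0 (x, y)" by (simp add: h0_def)
  qed
  then have h0: "h0 \<in> \<Phi>" by (simp add: \<Phi>_def h0_def B_def)
  have fin: "finite \<Phi>"
  proof (rule finite_subset)
    show "\<Phi> \<subseteq> {k. \<forall>e. (e \<in> E \<longrightarrow> k e \<in> B) \<and> (e \<notin> E \<longrightarrow> k e = 0)}" by (auto simp: \<Phi>_def)
    show "finite {k. \<forall>e. (e \<in> E \<longrightarrow> k e \<in> B) \<and> (e \<notin> E \<longrightarrow> k e = 0)}"
      using finE by (intro finite_set_of_finite_funs) (auto simp: B_def)
  qed
  define M where "M = Max (?Z ` \<Phi>)"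
  have M: "?Z k \<le> M" if "k \<in> \<Phi>" for k using fin that by (simp add: M_def)
  have "M \<in> ?Z ` \<Phi>" unfolding M_def using fin h0 by (intro Max_in) auto
  define nz where "nz k = card {e \<in> E. k e \<noteq> 0}" for k :: "'v \<times> 'v \<Rightarrow> real"
  from \<open>M \<in> ?Z ` \<Phi>\<close> have "\<exists>k. k \<in> \<Phi> \<and> ?Z k = M" by auto
  from ex_has_least_nat[of "\<lambda>k. k \<in> \<Phi> \<and> ?Z k = M" _ nz] this
  obtain k where k: "k \<in> \<Phi>" "?Z k = M" and least: "\<And>k'. k' \<in> \<Phi> \<Longrightarrow> ?Z k' = M \<Longrightarrow> nz k \<le> nz k'"
    by blast
  have ka: "antisym_field E k" using k by (simp add: \<Phi>_def)
  have k0: "k e = 0" if "e \<in> E" for e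
  proof (rule ccontr)
    assume ne: "k e \<noteq> 0"
    obtain x y where xy: "e = (x, y)" by fastforce
    with that obtain r L where r: "is_reflection V E r L" and cr: "x \<in> L \<longleftrightarrow> y \<notin> L" using R by blast
    have r': "is_reflection V E r (V - L)" using r E by (rule is_reflection_complement)
    let ?a = "fold_field r L E k" and ?b = "fold_field r (V - L) E k"
    have rE: "(r x, r y) \<in> E" if "(x, y) \<in> E" for x y using r that by (auto simp: is_reflection_def)
    have mem: "fold_field r M' E k \<in> \<Phi>" for M'
      using k(1) antisym_field_fold[OF symE rE ka] rE unfolding \<Phi>_def
      by (auto simp: fold_field_def B_def)
    have "M\<^sup>2 \<le> ?Z ?a * ?Z ?b"
      using reflection_positivity[OF V E symE r ka \<kappa>, of q c s] k(2) by simp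
    then have Zab: "M * M \<le> ?Z ?a * ?Z ?b" by (simp add: power2_eq_square)
    \<comment> \<open>Neither factor exceeds M and their product is at least M * M, so both foldings
      are maximisers and minimality of \<open>nz k\<close> applies to both.\<close>
    have le: "?Z ?a \<le> M" "?Z ?b \<le> M" and pos: "0 < ?Z ?a" "0 < ?Z ?b" "0 < M"
      using M mem Zpos k(2) by auto
    have "?Z ?a = M"
    proof (rule ccontr)
      assume "?Z ?a \<noteq> M"
      then have "?Z ?a * ?Z ?b < M * ?Z ?b" using le pos by simp
      also have "\<dots> \<le> M * M" using le pos by simp
      finally show False using Zab by simp
    qed
    moreover have "?Z ?b = M"
    proof (rule ccontr)
      assume "?Z ?b \<noteq> M"
      then have "?Z ?a * ?Z ?b < ?Z ?a * M" using le pos by simp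
      also have "\<dots> \<le> M * M" using le pos by simp
      finally show False using Zab by simp
    qed
    ultimately have "2 * nz k \<le> nz ?a + nz ?b" using least mem by (metis add_mono mult_2)
    also have "\<dots> \<le> 2 * (card {e \<in> E \<inter> L \<times> L. k e \<noteq> 0} + card {e \<in> E \<inter> (V - L) \<times> (V - L). k e \<noteq> 0})"
      using fold_field_support_card[OF V E symE r, of k] fold_field_support_card[OF V E symE r', of k]
      unfolding nz_def by simp
    also have "\<dots> = 2 * card ({e \<in> E \<inter> L \<times> L. k e \<noteq> 0} \<union> {e \<in> E \<inter> (V - L) \<times> (V - L). k e \<noteq> 0})"
      using finE by (subst card_Un_disjoint) auto
    also have "\<dots> < 2 * nz k"
    proof -
      have "e \<in> {e \<in> E. k e \<noteq> 0}"
        "e \<notin> {e \<in> E \<inter> L \<times> L. k e \<noteq> 0} \<union> {e \<in> E \<inter> (V - L) \<times> (V - L). k e \<noteq> 0}"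
        using that ne xy cr by auto
      then have "{e \<in> E \<inter> L \<times> L. k e \<noteq> 0} \<union> {e \<in> E \<inter> (V - L) \<times> (V - L). k e \<noteq> 0} \<subset> {e \<in> E. k e \<noteq> 0}"
        by blast
      from psubset_card_mono[OF _ this] finE show ?thesis by (simp add: nz_def)
    qed
    finally show False by simp
  qed
  have "?Z h = ?Z h0" by (intro shift_Z_cong) (simp add: h0_def)
  also have "\<dots> \<le> M" using M h0 by blast
  also have "M = ?Z (\<lambda>_. 0)" unfolding k(2)[symmetric] by (intro shift_Z_cong) (simp add: k0)
  finally show ?thesis .
qed

text \<open>Second-order expansion of Gaussian domination for the fields t h at t = 0, which reads 4
  \<kappa>^2 <X^2> \<le> \<kappa> N. Averaging t and -t removes the linear term, so a limit of
  second differences replaces differentiation.\<close>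

lemma infrared_bound_component:
  fixes V :: "'v set"
  assumes V: "finite V" and q: "q > 0" and E: "E \<subseteq> V \<times> V" and symE: "sym E" and \<kappa>: "0 < \<kappa>"
    and R: "\<And>x y. (x, y) \<in> E \<Longrightarrow> \<exists>r L. is_reflection V E r L \<and> (x \<in> L \<longleftrightarrow> y \<notin> L)"
    and h: "antisym_field E h" and cs: "\<And>i. (c i)\<^sup>2 + (s i)\<^sup>2 = 1"
  shows "(\<Sum>\<theta>\<in>conf q V. exp (\<kappa> * (\<Sum>(x, y)\<in>E. c (\<theta> x) * c (\<theta> y) + s (\<theta> x) * s (\<theta> y))) *
        (\<Sum>(x, y)\<in>E. h (x, y) * c (\<theta> x))\<^sup>2)
    \<le> (\<Sum>e\<in>E. (h e)\<^sup>2) / (4 * \<kappa>) *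
      (\<Sum>\<theta>\<in>conf q V. exp (\<kappa> * (\<Sum>(x, y)\<in>E. c (\<theta> x) * c (\<theta> y) + s (\<theta> x) * s (\<theta> y))))"
proof -
  define B where "B \<theta> = exp (\<kappa> * (\<Sum>(x, y)\<in>E. c (\<theta> x) * c (\<theta> y) + s (\<theta> x) * s (\<theta> y)))" for \<theta> :: "'v \<Rightarrow> int"
  define X where "X \<theta> = (\<Sum>(x, y)\<in>E. h (x, y) * c (\<theta> x))" for \<theta> :: "'v \<Rightarrow> int"
  define N where "N = (\<Sum>e\<in>E. (h e)\<^sup>2)"
  define ZB where "ZB = (\<Sum>\<theta>\<in>conf q V. B \<theta>)"
  have hneg: "h (y, x) = - h (x, y)" if "(x, y) \<in> E" for x y
    using h that unfolding antisym_field_def by blast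
  have bij: "bij_betw (\<lambda>(x, y). (y, x)) E E"
    using symE by (intro bij_betw_byWitness[where f' = "\<lambda>(x, y). (y, x)"]) (auto dest: symD)
  \<comment> \<open>Reversing every edge and using antisymmetry makes the two terms of the
    difference contribute equally.\<close>
  have X2: "(\<Sum>(x, y)\<in>E. h (x, y) * (c (\<theta> x) - c (\<theta> y))) = 2 * X \<theta>" for \<theta>
  proof -
    have "(\<Sum>(x, y)\<in>E. h (x, y) * c (\<theta> y)) = (\<Sum>(x, y)\<in>E. h (y, x) * c (\<theta> x))"
      using sum.reindex_bij_betw[OF bij, of "\<lambda>(x, y). h (x, y) * c (\<theta> y)"] by (simp add: case_prod_unfold)
    also have "\<dots> = - X \<theta>"
      unfolding X_def sum_negf[symmetric] by (intro sum.cong refl) (auto simp: hneg)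
    finally show ?thesis
      by (simp add: X_def right_diff_distrib sum_subtractf case_prod_unfold)
  qed
  have en: "exp (- \<kappa> / 2 * shift_energy c s E (\<lambda>e. t * h e) \<theta>)
      = exp (- \<kappa> * real (card E)) * exp (- \<kappa> * t\<^sup>2 * N / 2) * (B \<theta> * exp (2 * \<kappa> * t * X \<theta>))" for t \<theta>
  proof -
    have "sqdist c s (\<theta> x) (\<theta> y) (t * h (x, y)) = 2 - 2 * (c (\<theta> x) * c (\<theta> y) + s (\<theta> x) * s (\<theta> y))
        - 2 * t * (h (x, y) * (c (\<theta> x) - c (\<theta> y))) + t\<^sup>2 * (h (x, y))\<^sup>2" for x y
      using cs[of "\<theta> x"] cs[of "\<theta> y"] unfolding sqdist_def power2_eq_square
      by (simp add: algebra_simps)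
    then have SE: "shift_energy c s E (\<lambda>e. t * h e) \<theta> = 2 * real (card E)
        - 2 * (\<Sum>(x, y)\<in>E. c (\<theta> x) * c (\<theta> y) + s (\<theta> x) * s (\<theta> y)) - 2 * t * (2 * X \<theta>) + t\<^sup>2 * N"
      unfolding X2[symmetric] N_def shift_energy_def
      by (simp add: sum.distrib sum_subtractf sum_distrib_left case_prod_unfold)
    show ?thesis unfolding B_def exp_add[symmetric] SE
      by (rule arg_cong[where f = exp]) (simp add: field_simps)
  qed
  have Zt: "shift_Z q c s V E \<kappa> (\<lambda>e. t * h e) = exp (- \<kappa> * real (card E)) * exp (- \<kappa> * t\<^sup>2 * N / 2) *
      (\<Sum>\<theta>\<in>conf q V. B \<theta> * exp (2 * \<kappa> * t * X \<theta>))" for t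
    unfolding shift_Z_def en sum_distrib_left by simp
  have dom: "(\<Sum>\<theta>\<in>conf q V. B \<theta> * exp (2 * \<kappa> * t * X \<theta>)) \<le> exp (\<kappa> * t\<^sup>2 * N / 2) * ZB" for t
  proof -
    have "antisym_field E (\<lambda>e. t * h e)" using hneg by (auto simp: antisym_field_def)
    then have "shift_Z q c s V E \<kappa> (\<lambda>e. t * h e) \<le> shift_Z q c s V E \<kappa> (\<lambda>e. 0 * h e)"
      using Gaussian_domination[OF V q E symE less_imp_le[OF \<kappa>] R, of "\<lambda>e. t * h e" c s] by simp
    then have "exp (- \<kappa> * real (card E)) * (exp (- \<kappa> * t\<^sup>2 * N / 2) *
      (\<Sum>\<theta>\<in>conf q V. B \<theta> * exp (2 * \<kappa> * t * X \<theta>))) \<le> exp (- \<kappa> * real (card E)) * ZB"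
      unfolding Zt ZB_def by simp
    then have "exp (- \<kappa> * t\<^sup>2 * N / 2) * (\<Sum>\<theta>\<in>conf q V. B \<theta> * exp (2 * \<kappa> * t * X \<theta>)) \<le> ZB"
      by (simp only: mult_le_cancel_left_pos[OF exp_gt_zero])
    from mult_left_mono[OF this, of "exp (\<kappa> * t\<^sup>2 * N / 2)"] show ?thesis
      by (simp add: mult.assoc[symmetric] exp_add[symmetric])
  qed
  have le: "(\<Sum>\<theta>\<in>conf q V. B \<theta> * ((exp (2 * \<kappa> * t * X \<theta>) + exp (- (2 * \<kappa> * t * X \<theta>)) - 2) / t\<^sup>2))
      \<le> 2 * ((exp (\<kappa> * t\<^sup>2 * N / 2) - 1) / t\<^sup>2) * ZB" for t
  proof -
    have "(\<Sum>\<theta>\<in>conf q V. B \<theta> * ((exp (2 * \<kappa> * t * X \<theta>) + exp (- (2 * \<kappa> * t * X \<theta>)) - 2) / t\<^sup>2))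
      = ((\<Sum>\<theta>\<in>conf q V. B \<theta> * exp (2 * \<kappa> * t * X \<theta>)) + (\<Sum>\<theta>\<in>conf q V. B \<theta> * exp (2 * \<kappa> * (- t) * X \<theta>))
          - 2 * ZB) / t\<^sup>2"
      unfolding ZB_def
      by (simp add: sum.distrib[symmetric] sum_subtractf[symmetric] sum_distrib_left sum_divide_distrib algebra_simps)
    also have "\<dots> \<le> (exp (\<kappa> * t\<^sup>2 * N / 2) * ZB + exp (\<kappa> * (- t)\<^sup>2 * N / 2) * ZB - 2 * ZB) / t\<^sup>2"
      by (intro divide_right_mono diff_right_mono add_mono dom) simp
    also have "\<dots> = 2 * ((exp (\<kappa> * t\<^sup>2 * N / 2) - 1) / t\<^sup>2) * ZB" by (simp add: field_simps)
    finally show ?thesis .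
  qed
  have "((\<lambda>t::real. (exp (a * t) + exp (- (a * t)) - 2) / t\<^sup>2) \<longlongrightarrow> a\<^sup>2) (at_right 0)" for a :: real
    unfolding power2_eq_square[of a] by real_asymp
  from this[of "2 * \<kappa> * X \<theta>" for \<theta>]
  have "((\<lambda>t. (exp (2 * \<kappa> * t * X \<theta>) + exp (- (2 * \<kappa> * t * X \<theta>)) - 2) / t\<^sup>2) \<longlongrightarrow> (2 * \<kappa> * X \<theta>)\<^sup>2) (at_right 0)" for \<theta>
    by (simp add: mult_ac)
  then have l1: "((\<lambda>t. \<Sum>\<theta>\<in>conf q V. B \<theta> * ((exp (2 * \<kappa> * t * X \<theta>) + exp (- (2 * \<kappa> * t * X \<theta>)) - 2) / t\<^sup>2))
      \<longlongrightarrow> (\<Sum>\<theta>\<in>conf q V. B \<theta> * (2 * \<kappa> * X \<theta>)\<^sup>2)) (at_right 0)"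
    by (intro tendsto_intros)
  have "((\<lambda>t::real. (exp (a * t\<^sup>2) - 1) / t\<^sup>2) \<longlongrightarrow> a) (at_right 0)" for a :: real
    by real_asymp
  from this[of "\<kappa> * N / 2"]
  have "((\<lambda>t. (exp (\<kappa> * t\<^sup>2 * N / 2) - 1) / t\<^sup>2) \<longlongrightarrow> \<kappa> * N / 2) (at_right 0)"
    by (simp add: mult_ac)
  then have l2: "((\<lambda>t. 2 * ((exp (\<kappa> * t\<^sup>2 * N / 2) - 1) / t\<^sup>2) * ZB) \<longlongrightarrow> 2 * (\<kappa> * N / 2) * ZB) (at_right 0)"
    by (intro tendsto_mult tendsto_const)
  have "(\<Sum>\<theta>\<in>conf q V. B \<theta> * (2 * \<kappa> * X \<theta>)\<^sup>2) \<le> 2 * (\<kappa> * N / 2) * ZB"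
    by (rule tendsto_le[OF _ l2 l1]) (use le in auto)
  also have "(\<Sum>\<theta>\<in>conf q V. B \<theta> * (2 * \<kappa> * X \<theta>)\<^sup>2) = 4 * \<kappa>\<^sup>2 * (\<Sum>\<theta>\<in>conf q V. B \<theta> * (X \<theta>)\<^sup>2)"
    by (simp add: sum_distrib_left power_mult_distrib mult_ac)
  finally have "4 * \<kappa> * (\<Sum>\<theta>\<in>conf q V. B \<theta> * (X \<theta>)\<^sup>2) \<le> N * ZB"
    using \<kappa> by (simp add: power2_eq_square mult.assoc mult.left_commute)
  then have "(\<Sum>\<theta>\<in>conf q V. B \<theta> * (X \<theta>)\<^sup>2) \<le> N / (4 * \<kappa>) * ZB"
    using \<kappa> by (simp add: field_simps)
  then show ?thesis by (simp add: B_def X_def N_def ZB_def)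
qed

lemma sum_dcos_square:
  "(\<Sum>x\<in>V. \<Sum>y\<in>V. d x * d y * dcos q \<theta> x y) =
    (\<Sum>x\<in>V. d x * cos (2 * pi / real q * real_of_int (\<theta> x)))\<^sup>2 +
    (\<Sum>x\<in>V. d x * sin (2 * pi / real q * real_of_int (\<theta> x)))\<^sup>2"
proof -
  have "dcos q \<theta> x y =
      cos (2 * pi / real q * real_of_int (\<theta> x)) * cos (2 * pi / real q * real_of_int (\<theta> y)) +
      sin (2 * pi / real q * real_of_int (\<theta> x)) * sin (2 * pi / real q * real_of_int (\<theta> y))" for x y
    unfolding dcos_def cos_diff[symmetric] by (simp add: right_diff_distrib diff_divide_distrib)
  then show ?thesis
    unfolding power2_eq_square sum_product sum.distrib[symmetric]
    by (intro sum.cong refl) (simp add: algebra_simps)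
qed

text \<open>Testing \<open>h\<close> against a function of the site yields its divergence
  \<open>d\<close> by grouping edges at their first endpoint. Each of the two spin components
  contributes a quarter of the squared norm over \<kappa>.\<close>

theorem infrared_bound:
  fixes V :: "'v set"
  assumes V: "finite V" and q: "q > 0" and E: "E \<subseteq> V \<times> V" and symE: "sym E" and \<kappa>: "0 < \<kappa>"
    and R: "\<And>x y. (x, y) \<in> E \<Longrightarrow> \<exists>r L. is_reflection V E r L \<and> (x \<in> L \<longleftrightarrow> y \<notin> L)"
    and h: "antisym_field E h" and g: "g \<in> V"
    and d: "\<And>x. x \<in> V \<Longrightarrow> d x = (\<Sum>y | (x, y) \<in> E. h (x, y))"
  shows "(\<Sum>x\<in>V. \<Sum>y\<in>V. d x * d y * wcorr q V (\<lambda>x y. if (x, y) \<in> E then \<kappa> else 0) {} g x y)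
    \<le> (\<Sum>e\<in>E. (h e)\<^sup>2) / (2 * \<kappa>)"
proof -
  define J where "J = (\<lambda>x y. if (x, y) \<in> E then \<kappa> else 0)"
  let ?w = "2 * pi / real q"
  define c where "c i = cos (?w * real_of_int i)" for i
  define s where "s i = sin (?w * real_of_int i)" for i
  have finE: "finite E" using V E by (meson finite_SigmaI finite_subset)
  have dc: "dcos q \<theta> x y = c (\<theta> x) * c (\<theta> y) + s (\<theta> x) * s (\<theta> y)" for \<theta> :: "'v \<Rightarrow> int" and x y
    unfolding dcos_def c_def s_def cos_diff[symmetric] by (simp add: right_diff_distrib diff_divide_distrib)
  have cs: "(c i)\<^sup>2 + (s i)\<^sup>2 = 1" for i by (simp add: c_def s_def)
  have en: "energy q V J \<theta> = \<kappa> * (\<Sum>(x, y)\<in>E. c (\<theta> x) * c (\<theta> y) + s (\<theta> x) * s (\<theta> y))" for \<theta>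
  proof -
    have "energy q V J \<theta> = (\<Sum>(x, y)\<in>V \<times> V. if (x, y) \<in> E then \<kappa> * dcos q \<theta> x y else 0)"
      unfolding energy_def sum.cartesian_product J_def by (intro sum.cong refl) auto
    also have "\<dots> = (\<Sum>e\<in>V \<times> V. if e \<in> E then \<kappa> * dcos q \<theta> (fst e) (snd e) else 0)"
      by (intro sum.cong refl) auto
    also have "\<dots> = (\<Sum>e\<in>E. \<kappa> * dcos q \<theta> (fst e) (snd e))"
      using V E by (simp add: sum.If_cases inf.absorb2)
    finally show ?thesis by (simp add: dc sum_distrib_left case_prod_unfold)
  qed
  have div: "(\<Sum>x\<in>V. d x * f (\<theta> x)) = (\<Sum>(x, y)\<in>E. h (x, y) * f (\<theta> x))" for f :: "int \<Rightarrow> real" and \<theta>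
  proof -
    have "(\<Sum>(x, y)\<in>E. h (x, y) * f (\<theta> x)) = (\<Sum>(x, y)\<in>Sigma V (\<lambda>x. {y. (x, y) \<in> E}). h (x, y) * f (\<theta> x))"
      using E by (intro sum.cong) auto
    also have "\<dots> = (\<Sum>x\<in>V. \<Sum>y | (x, y) \<in> E. h (x, y) * f (\<theta> x))"
    proof (subst sum.Sigma)
      show "\<forall>x\<in>V. finite {y. (x, y) \<in> E}"
        using V E by (auto intro: finite_subset[of _ V])
    qed (use V in auto)
    finally show ?thesis by (simp add: d sum_distrib_right)
  qed
  let ?B = "\<lambda>\<theta>. exp (energy q V J \<theta>)"
  let ?N = "\<Sum>e\<in>E. (h e)\<^sup>2" and ?Z = "\<Sum>\<theta>\<in>conf q V. ?B \<theta>"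
  have 1: "(\<Sum>\<theta>\<in>conf q V. ?B \<theta> * (\<Sum>x\<in>V. d x * c (\<theta> x))\<^sup>2) \<le> ?N / (4 * \<kappa>) * ?Z"
    using infrared_bound_component[OF V q E symE \<kappa> R h, of c s] cs unfolding en div by blast
  \<comment> \<open>Exchanging \<open>c\<close> and \<open>s\<close> shifts the second spin
    component instead.\<close>
  have 2: "(\<Sum>\<theta>\<in>conf q V. ?B \<theta> * (\<Sum>x\<in>V. d x * s (\<theta> x))\<^sup>2) \<le> ?N / (4 * \<kappa>) * ?Z"
    using infrared_bound_component[OF V q E symE \<kappa> R h, of s c] cs
    unfolding en div by (simp only: add.commute)
  have Z: "wsum q V J {} g (\<lambda>_. 1) = ?Z" by (simp add: wsum_def)
  have Zpos: "?Z > 0" unfolding Z[symmetric] using V q g by (intro wsum_1_pos) auto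
  have "(\<Sum>x\<in>V. \<Sum>y\<in>V. d x * d y * wsum q V J {} g (\<lambda>\<theta>. dcos q \<theta> x y))
      = (\<Sum>x\<in>V. \<Sum>y\<in>V. \<Sum>\<theta>\<in>conf q V. ?B \<theta> * (d x * d y * dcos q \<theta> x y))"
    by (simp add: wsum_def sum_distrib_left mult_ac)
  also have "\<dots> = (\<Sum>x\<in>V. \<Sum>\<theta>\<in>conf q V. \<Sum>y\<in>V. ?B \<theta> * (d x * d y * dcos q \<theta> x y))"
    by (intro sum.cong refl sum.swap)
  also have "\<dots> = (\<Sum>\<theta>\<in>conf q V. \<Sum>x\<in>V. \<Sum>y\<in>V. ?B \<theta> * (d x * d y * dcos q \<theta> x y))"
    by (rule sum.swap)
  also have "\<dots> = (\<Sum>\<theta>\<in>conf q V. ?B \<theta> * ((\<Sum>x\<in>V. d x * c (\<theta> x))\<^sup>2 + (\<Sum>x\<in>V. d x * s (\<theta> x))\<^sup>2))"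
    unfolding c_def s_def sum_dcos_square[symmetric] by (simp add: sum_distrib_left)
  also have "\<dots> \<le> ?N / (2 * \<kappa>) * ?Z"
    using 1 2 by (simp add: distrib_left sum.distrib)
  finally have "(\<Sum>x\<in>V. \<Sum>y\<in>V. d x * d y * wsum q V J {} g (\<lambda>\<theta>. dcos q \<theta> x y)) / ?Z \<le> ?N / (2 * \<kappa>)"
    using Zpos by (simp add: pos_divide_le_eq)
  then show ?thesis
    unfolding wcorr_def J_def[symmetric] Z by (simp add: sum_divide_distrib)
qed

section \<open>The discrete torus\<close>

definition tor :: "int \<Rightarrow> site set" where
  "tor N = {0..<N} \<times> {0..<N} \<times> {0..<N}"

definition cyc_adj :: "int \<Rightarrow> int \<Rightarrow> int \<Rightarrow> bool" where
  "cyc_adj N a b \<longleftrightarrow> \<bar>a - b\<bar> = 1 \<or> \<bar>a - b\<bar> = N - 1"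

definition tedge :: "int \<Rightarrow> (site \<times> site) set" where
  "tedge N = {((a, b, c), (a', b', c')). (a, b, c) \<in> tor N \<and> (a', b', c') \<in> tor N \<and>
     (cyc_adj N a a' \<and> b = b' \<and> c = c' \<or> a = a' \<and> cyc_adj N b b' \<and> c = c' \<or>
      a = a' \<and> b = b' \<and> cyc_adj N c c')}"

text \<open>An automorphism of the torus of order three. Reflections and flows are built in the
  first direction only and carried to the others by it, with \<open>rot (rot x)\<close> as
  inverse.\<close>

definition rot :: "site \<Rightarrow> site" where
  "rot = (\<lambda>(a, b, c). (b, c, a))"

lemma finite_tor [simp]: "finite (tor N)"
  by (simp add: tor_def)

lemma tedge_subset: "tedge N \<subseteq> tor N \<times> tor N"
  by (auto simp: tedge_def)

lemma finite_tedge [simp]: "finite (tedge N)"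
  using finite_subset[OF tedge_subset] by simp

lemma sym_tedge: "sym (tedge N)"
  by (auto simp: tedge_def sym_def cyc_adj_def abs_minus_commute)

lemma rot_tor [simp]: "rot x \<in> tor N \<longleftrightarrow> x \<in> tor N"
  by (auto simp: rot_def tor_def split: prod.splits)

lemma rot_tedge [simp]: "(rot x, rot y) \<in> tedge N \<longleftrightarrow> (x, y) \<in> tedge N"
  by (cases x; cases y) (auto simp: rot_def tedge_def tor_def)

lemma rot_rot_rot [simp]: "rot (rot (rot x)) = x"
  by (auto simp: rot_def split: prod.splits)

lemma is_reflection_rot:
  assumes "is_reflection (tor N) (tedge N) r L"
  shows "is_reflection (tor N) (tedge N) (\<lambda>x. rot (rot (r (rot x)))) {x. rot x \<in> L}"
proof -
  from assms have L: "L \<subseteq> tor N"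
    and V: "\<And>x. x \<in> tor N \<Longrightarrow> r x \<in> tor N \<and> r (r x) = x \<and> (r x \<in> L \<longleftrightarrow> x \<notin> L)"
    and E: "\<And>x y. (x, y) \<in> tedge N \<Longrightarrow> (r x, r y) \<in> tedge N"
    and C: "\<And>x y. (x, y) \<in> tedge N \<Longrightarrow> (x \<in> L \<longleftrightarrow> y \<notin> L) \<Longrightarrow> y = r x"
    by (auto simp: is_reflection_def)
  have "y = rot (rot (r (rot x)))" if "(x, y) \<in> tedge N" "rot x \<in> L \<longleftrightarrow> rot y \<notin> L" for x y
  proof -
    have "rot y = r (rot x)" using that C[of "rot x" "rot y"] by simp
    then have "rot (rot (rot y)) = rot (rot (r (rot x)))" by simp
    then show ?thesis by simp
  qed
  moreover have "{x. rot x \<in> L} \<subseteq> tor N" using L by auto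
  ultimately show ?thesis using V E unfolding is_reflection_def by simp
qed

text \<open>x goes to 2 k + 1 - x modulo N, the reflection about the midpoint of the edge {k, k +
  1}; explicit cases keep it within linear arithmetic.\<close>

definition cyc_refl :: "int \<Rightarrow> int \<Rightarrow> int \<Rightarrow> int" where
  "cyc_refl N k x = (if 2 * k + 1 - x < 0 then 2 * k + 1 - x + N
     else if 2 * k + 1 - x \<ge> N then 2 * k + 1 - x - N else 2 * k + 1 - x)"

text \<open>The residue of k - x modulo N. One half of the cycle is the set of positions below N /
  2, an arc ending at k.\<close>

definition cyc_pos :: "int \<Rightarrow> int \<Rightarrow> int \<Rightarrow> int" where
  "cyc_pos N k x = (if x \<le> k then k - x else k - x + N)"

text \<open>For even N the cut opposite to {k, k + 1} also passes through the midpoint of an edge,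
  so at both cuts the crossing edge joins mirror images.\<close>

lemma cyc_reflection:
  assumes N: "N = 2 * M" "M \<ge> 1" and k: "0 \<le> k" "k < N" and x: "0 \<le> x" "x < N"
  shows "0 \<le> cyc_refl N k x \<and> cyc_refl N k x < N \<and> cyc_refl N k (cyc_refl N k x) = x \<and>
      (cyc_pos N k (cyc_refl N k x) < M \<longleftrightarrow> \<not> cyc_pos N k x < M)"
    and "0 \<le> y \<Longrightarrow> y < N \<Longrightarrow> cyc_adj N x y \<Longrightarrow> cyc_adj N (cyc_refl N k x) (cyc_refl N k y)"
    and "0 \<le> y \<Longrightarrow> y < N \<Longrightarrow> cyc_adj N x y \<Longrightarrow> (cyc_pos N k x < M \<longleftrightarrow> \<not> cyc_pos N k y < M) \<Longrightarrow>
      y = cyc_refl N k x"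
  using N k x unfolding cyc_refl_def cyc_pos_def cyc_adj_def by (smt (verit))+

lemma torus_reflection_first:
  assumes N: "N = 2 * M" "M \<ge> 1" and e: "((a, b, c), (a', b, c)) \<in> tedge N" and ad: "cyc_adj N a a'"
  shows "\<exists>r L. is_reflection (tor N) (tedge N) r L \<and> ((a, b, c) \<in> L \<longleftrightarrow> (a', b, c) \<notin> L)"
proof -
  have ab: "0 \<le> a" "a < N" "0 \<le> a'" "a' < N" and mem: "(a, b, c) \<in> tor N" "(a', b, c) \<in> tor N"
    using e by (auto simp: tedge_def tor_def)
  \<comment> \<open>The endpoint of {a, a'} that cyclically precedes the other, so that this edge is
    one of those being cut.\<close>
  define k where "k = (if a' = a + 1 \<or> a' = a + 1 - N then a else a')"
  have k: "0 \<le> k" "k < N" using ab by (auto simp: k_def)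
  define r where "r = cyc_refl N k"
  define t where "t = cyc_pos N k"
  note cr = cyc_reflection[OF N k, folded r_def t_def]
  let ?r = "\<lambda>(x, y, z). (r x, y, z)" and ?L = "{(x, y, z) \<in> tor N. t x < M}"
  have "is_reflection (tor N) (tedge N) ?r ?L"
    unfolding is_reflection_def
  proof (intro conjI allI impI ballI)
    show "?L \<subseteq> tor N" by auto
  next
    fix v assume v: "v \<in> tor N"
    obtain x y z where xyz: "v = (x, y, z)" by (cases v)
    have "0 \<le> x" "x < N" using v xyz by (auto simp: tor_def)
    from cr(1)[OF this] show "?r v \<in> tor N" "?r (?r v) = v" "(?r v \<in> ?L) = (v \<notin> ?L)"
      using v xyz by (auto simp: tor_def)
  next
    fix v w assume vw: "(v, w) \<in> tedge N"
    obtain x y z x' y' z' where xyz: "v = (x, y, z)" "w = (x', y', z')" by (cases v; cases w)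
    have b: "0 \<le> x" "x < N" "0 \<le> x'" "x' < N" using vw xyz by (auto simp: tedge_def tor_def)
    show "(?r v, ?r w) \<in> tedge N"
      using vw cr(1)[OF b(1,2)] cr(1)[OF b(3,4)] cr(2)[OF b] unfolding xyz tedge_def tor_def by auto
    assume "(v \<in> ?L) = (w \<notin> ?L)"
    then have "t x < M \<longleftrightarrow> \<not> t x' < M" using vw tedge_subset[of N] unfolding xyz by auto
    with vw cr(3)[OF b] show "w = ?r v" unfolding xyz tedge_def by auto
  qed
  moreover have "t a < M \<longleftrightarrow> \<not> t a' < M"
    using N ab ad unfolding t_def k_def cyc_adj_def cyc_pos_def by (smt (verit))
  ultimately show ?thesis using mem by (intro exI[of _ ?r] exI[of _ ?L]) auto
qed

lemma torus_reflection:
  assumes N: "N = 2 * M" "M \<ge> 1" and e: "(x, y) \<in> tedge N"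
  shows "\<exists>r L. is_reflection (tor N) (tedge N) r L \<and> (x \<in> L \<longleftrightarrow> y \<notin> L)"
proof -
  have unrot: "\<exists>r L. is_reflection (tor N) (tedge N) r L \<and> (x \<in> L \<longleftrightarrow> y \<notin> L)"
    if "\<exists>r L. is_reflection (tor N) (tedge N) r L \<and> (rot x \<in> L \<longleftrightarrow> rot y \<notin> L)" for x y
    using that is_reflection_rot by fastforce
  obtain a b c a' b' c' where xy: "x = (a, b, c)" "y = (a', b', c')" by (cases x; cases y)
  from e xy consider "cyc_adj N a a'" "b = b'" "c = c'" | "a = a'" "cyc_adj N b b'" "c = c'"
    | "a = a'" "b = b'" "cyc_adj N c c'" by (auto simp: tedge_def)
  then show ?thesis
  proof cases
    case 1
    with e show ?thesis using torus_reflection_first[OF N, of a b c a'] xy by simp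
  next
    case 2
    have "(rot x, rot y) \<in> tedge N" using e by simp
    then have "((b, c, a), (b', c, a)) \<in> tedge N" using 2 xy by (simp add: rot_def)
    from torus_reflection_first[OF N this 2(2)]
    have "\<exists>r L. is_reflection (tor N) (tedge N) r L \<and> (rot x \<in> L \<longleftrightarrow> rot y \<notin> L)"
      using 2 xy by (simp add: rot_def)
    then show ?thesis by (rule unrot)
  next
    case 3
    have "(rot (rot x), rot (rot y)) \<in> tedge N" using e by simp
    then have "((c, a, b), (c', a, b)) \<in> tedge N" using 3 xy by (simp add: rot_def)
    from torus_reflection_first[OF N this 3(3)]
    have "\<exists>r L. is_reflection (tor N) (tedge N) r L \<and> (rot (rot x) \<in> L \<longleftrightarrow> rot (rot y) \<notin> L)"
      using 3 xy by (simp add: rot_def)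
    then show ?thesis by (rule unrot[OF unrot])
  qed
qed

subsection \<open>A flow of small energy spreading a cube over the torus\<close>

text \<open>The bound is on the norm and not on the energy, so that successive flows add by the
  triangle inequality. Each bond counts in both orientations.\<close>

definition has_flow :: "int \<Rightarrow> (site \<Rightarrow> real) \<Rightarrow> real \<Rightarrow> bool" where
  "has_flow N \<rho> e \<longleftrightarrow> (\<exists>h. antisym_field (tedge N) h \<and>
     (\<forall>x\<in>tor N. \<rho> x = (\<Sum>y | (x, y) \<in> tedge N. h (x, y))) \<and> L2_set h (tedge N) \<le> e)"

lemma has_flow_add:
  assumes "has_flow N \<rho> e" "has_flow N \<rho>' e'"
  shows "has_flow N (\<lambda>x. \<rho> x + \<rho>' x) (e + e')"
proof -
  from assms obtain h h' where h: "antisym_field (tedge N) h" "L2_set h (tedge N) \<le> e"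
      "\<forall>x\<in>tor N. \<rho> x = (\<Sum>y | (x, y) \<in> tedge N. h (x, y))"
    and h': "antisym_field (tedge N) h'" "L2_set h' (tedge N) \<le> e'"
      "\<forall>x\<in>tor N. \<rho>' x = (\<Sum>y | (x, y) \<in> tedge N. h' (x, y))"
    by (auto simp: has_flow_def)
  have "antisym_field (tedge N) (\<lambda>p. h p + h' p)"
    using h(1) h'(1) unfolding antisym_field_def by (metis add.inverse_distrib_swap add.commute)
  moreover have "L2_set (\<lambda>p. h p + h' p) (tedge N) \<le> e + e'"
    using L2_set_triangle_ineq[of h h' "tedge N"] h(2) h'(2) by linarith
  ultimately show ?thesis
    unfolding has_flow_def using h(3) h'(3) by (intro exI[of _ "\<lambda>p. h p + h' p"]) (simp add: sum.distrib)
qed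

lemma has_flow_mono:
  "has_flow N \<rho> e \<Longrightarrow> e \<le> e' \<Longrightarrow> (\<And>x. x \<in> tor N \<Longrightarrow> \<rho>' x = \<rho> x) \<Longrightarrow> has_flow N \<rho>' e'"
  unfolding has_flow_def by fastforce

lemma has_flow_rot:
  assumes "has_flow N \<rho> e"
  shows "has_flow N (\<lambda>x. \<rho> (rot x)) e"
proof -
  from assms obtain h where h: "antisym_field (tedge N) h" "L2_set h (tedge N) \<le> e"
      "\<forall>x\<in>tor N. \<rho> x = (\<Sum>y | (x, y) \<in> tedge N. h (x, y))"
    by (auto simp: has_flow_def)
  let ?h = "\<lambda>(x, y). h (rot x, rot y)"
  let ?R = "\<lambda>(x, y). (rot x, rot y)"
  have bij: "bij_betw ?R (tedge N) (tedge N)"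
    by (rule bij_betw_byWitness[where f' = "\<lambda>(x, y). (rot (rot x), rot (rot y))"]) auto
  have "antisym_field (tedge N) ?h"
    using h(1) unfolding antisym_field_def by (metis case_prod_conv rot_tedge)
  moreover have "L2_set ?h (tedge N) \<le> e"
    using h(2) sum.reindex_bij_betw[OF bij, of "\<lambda>e. (h e)\<^sup>2"]
    unfolding L2_set_def by (simp add: case_prod_unfold)
  moreover have "\<rho> (rot x) = (\<Sum>y | (x, y) \<in> tedge N. h (rot x, rot y))" if "x \<in> tor N" for x
  proof -
    have "bij_betw rot {y. (x, y) \<in> tedge N} {y. (rot x, y) \<in> tedge N}"
    proof (rule bij_betw_byWitness[where f' = "\<lambda>y. rot (rot y)"])
      show "(\<lambda>y. rot (rot y)) ` {y. (rot x, y) \<in> tedge N} \<subseteq> {y. (x, y) \<in> tedge N}"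
      proof
        fix z assume "z \<in> (\<lambda>y. rot (rot y)) ` {y. (rot x, y) \<in> tedge N}"
        then obtain y where y: "z = rot (rot y)" "(rot x, y) \<in> tedge N" by blast
        then have "(rot x, rot (rot (rot y))) \<in> tedge N" by simp
        then show "z \<in> {y. (x, y) \<in> tedge N}" using y(1) by (simp only: rot_tedge mem_Collect_eq)
      qed
    qed auto
    from sum.reindex_bij_betw[OF this, of "\<lambda>y. h (rot x, y)"] show ?thesis
      using h(3) that by simp
  qed
  ultimately show ?thesis unfolding has_flow_def by (intro exI[of _ ?h]) auto
qed

definition unif :: "int \<Rightarrow> int \<Rightarrow> int \<Rightarrow> site \<Rightarrow> real" where
  "unif p b c = (\<lambda>(x, y, z). if 0 \<le> x \<and> x < p \<and> 0 \<le> y \<and> y < b \<and> 0 \<le> z \<and> z < c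
     then 1 / (real_of_int p * real_of_int b * real_of_int c) else 0)"

lemma unif_rot: "unif p b c (rot x) = unif c p b x"
  by (auto simp: unif_def rot_def mult_ac split: prod.splits)

text \<open>Mass moves along the first axis only. The current through a bond is at most 1 / (2 b c),
  and at most 4 p b c oriented bonds carry any, which gives energy p / (b c).\<close>

lemma has_flow_stretch:
  assumes p: "1 \<le> p" "2 * p \<le> N" and b: "1 \<le> b" and c: "1 \<le> c"
  shows "has_flow N (\<lambda>x. unif p b c x - unif (2 * p) b c x) (sqrt (real_of_int p / (real_of_int b * real_of_int c)))"
proof -
  define D where "D = 2 * real_of_int p * real_of_int b * real_of_int c"
  have Dpos: "D > 0" using p b c by (simp add: D_def)
  define f where "f i = (if 0 \<le> i \<and> i < p then real_of_int (i + 1) / D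
     else if p \<le> i \<and> i < 2 * p then real_of_int (2 * p - 1 - i) / D else 0)" for i
  define h where "h = (\<lambda>((x, y, z), (x', y', z')). if y = y' \<and> z = z' \<and> 0 \<le> y \<and> y < b \<and> 0 \<le> z \<and> z < c then
     (if x' = x + 1 then f x else if x = x' + 1 then - f x' else 0) else 0 :: real)"
  have anti: "antisym_field (tedge N) h"
    by (auto simp: antisym_field_def h_def)
  have f0: "f (- 1) = 0" "f (N - 1) = 0" using p by (auto simp: f_def)
  have df: "f x - f (x - 1) = (if 0 \<le> x \<and> x < p then 2 / D else 0) - (if 0 \<le> x \<and> x < 2 * p then 1 / D else 0)" for x
    using Dpos p by (auto simp: f_def field_simps)
  have divh: "unif p b c v - unif (2 * p) b c v = (\<Sum>w | (v, w) \<in> tedge N. h (v, w))" if v: "v \<in> tor N" for v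
  proof -
    obtain x y z where xyz: "v = (x, y, z)" by (cases v)
    have vb: "0 \<le> x" "x < N" "0 \<le> y" "y < N" "0 \<le> z" "z < N" using v xyz by (auto simp: tor_def)
    let ?B = "{(x + 1, y, z), (x - 1, y, z)}"
    have "(\<Sum>w | (v, w) \<in> tedge N. h (v, w)) = (\<Sum>w\<in>?B. h (v, w))"
    proof (rule sum.mono_neutral_cong)
      show "finite {w. (v, w) \<in> tedge N}"
        using tedge_subset by (intro finite_subset[OF _ finite_tor[of N]]) auto
      show "h (v, w) = 0" if "w \<in> {w. (v, w) \<in> tedge N} - ?B" for w
        using that xyz by (cases w) (auto simp: h_def)
      show "h (v, w) = 0" if w: "w \<in> ?B - {w. (v, w) \<in> tedge N}" for w
      proof -
        have "((x, y, z), (x + 1, y, z)) \<in> tedge N" if "x + 1 < N"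
          using vb that by (simp add: tedge_def tor_def cyc_adj_def)
        moreover have "((x, y, z), (x - 1, y, z)) \<in> tedge N" if "x - 1 \<ge> 0"
          using vb that by (simp add: tedge_def tor_def cyc_adj_def)
        ultimately consider "w = (x + 1, y, z)" "x + 1 \<ge> N" | "w = (x - 1, y, z)" "x - 1 < 0"
          using w unfolding xyz by fastforce
        then show ?thesis
        proof cases
          case 1
          then have "x = N - 1" using vb by simp
          then show ?thesis using 1 xyz f0 by (simp add: h_def)
        next
          case 2
          then have "x = 0" using vb by simp
          then show ?thesis using 2 xyz f0 by (simp add: h_def)
        qed
      qed
    qed auto
    also have "\<dots> = (if y < b \<and> z < c then f x - f (x - 1) else 0)"
      using vb by (simp add: xyz h_def)
    also have "\<dots> = unif p b c v - unif (2 * p) b c v"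
      unfolding df using vb p b c by (simp add: xyz unif_def D_def)
    finally show ?thesis by simp
  qed
  have fle: "(f i)\<^sup>2 \<le> 1 / (2 * real_of_int b * real_of_int c)\<^sup>2" for i
  proof -
    have "0 \<le> f i" using Dpos by (simp add: f_def)
    moreover have "f i \<le> real_of_int p / D" using Dpos p by (auto simp: f_def intro!: divide_right_mono)
    ultimately have "(f i)\<^sup>2 \<le> (real_of_int p / D)\<^sup>2" by (intro power_mono)
    also have "real_of_int p / D = 1 / (2 * real_of_int b * real_of_int c)" using p by (simp add: D_def)
    finally show ?thesis by (simp add: power_one_over)
  qed
  define Q where "Q = {0..<2 * p} \<times> {0..<b} \<times> {0..<c}"
  define S where "S = (\<lambda>(x, y, z). ((x, y, z), (x + 1, y, z))) ` Q \<union> (\<lambda>(x, y, z). ((x + 1, y, z), (x, y, z))) ` Q"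
  have finQ: "finite Q" by (simp add: Q_def)
  then have finS: "finite S" by (simp add: S_def)
  have f00: "f i = 0" if "\<not> (0 \<le> i \<and> i < 2 * p)" for i using that p by (auto simp: f_def)
  have hS: "h w = 0" if "w \<notin> S" for w
  proof -
    obtain x y z x' y' z' where w: "w = ((x, y, z), (x', y', z'))" by (metis prod_cases3 surj_pair)
    show ?thesis
    proof (rule ccontr)
      assume "h w \<noteq> 0"
      then have "y = y'" "z = z'" "0 \<le> y" "y < b" "0 \<le> z" "z < c"
        and "x' = x + 1 \<and> f x \<noteq> 0 \<or> x = x' + 1 \<and> f x' \<noteq> 0"
        by (auto simp: w h_def split: if_splits)
      then have "w \<in> S" using f00[of x] f00[of x'] unfolding w S_def Q_def by (auto simp: image_iff)
      with that show False by simp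
    qed
  qed
  have "(\<Sum>w\<in>tedge N. (h w)\<^sup>2) \<le> (\<Sum>w\<in>S. (h w)\<^sup>2)"
  proof -
    have "(\<Sum>w\<in>tedge N. (h w)\<^sup>2) = (\<Sum>w\<in>tedge N \<inter> S. (h w)\<^sup>2)"
      by (rule sum.mono_neutral_right) (auto simp: hS)
    also have "\<dots> \<le> (\<Sum>w\<in>S. (h w)\<^sup>2)" using finS by (intro sum_mono2) auto
    finally show ?thesis .
  qed
  also have "\<dots> \<le> (\<Sum>w\<in>S. 1 / (2 * real_of_int b * real_of_int c)\<^sup>2)"
  proof (intro sum_mono)
    fix w
    show "(h w)\<^sup>2 \<le> 1 / (2 * real_of_int b * real_of_int c)\<^sup>2"
      using fle unfolding h_def by (auto simp: case_prod_unfold)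
  qed
  also have "\<dots> = real (card S) * (1 / (2 * real_of_int b * real_of_int c)\<^sup>2)" by simp
  also have "\<dots> \<le> (4 * real_of_int p * real_of_int b * real_of_int c) * (1 / (2 * real_of_int b * real_of_int c)\<^sup>2)"
  proof (intro mult_right_mono)
    have "card S \<le> card Q + card Q"
      unfolding S_def by (intro order.trans[OF card_Un_le] add_mono card_image_le finQ)
    also have "card Q = nat (2 * p) * (nat b * nat c)" by (simp add: Q_def card_cartesian_product)
    finally have "real (card S) \<le> real (2 * (nat (2 * p) * (nat b * nat c)))" by linarith
    also have "\<dots> = 4 * real_of_int p * real_of_int b * real_of_int c" using p b c by simp
    finally show "real (card S) \<le> 4 * real_of_int p * real_of_int b * real_of_int c" .
  qed simp
  also have "\<dots> = real_of_int p / (real_of_int b * real_of_int c)"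
    using b c by (simp add: power2_eq_square field_simps)
  finally have "L2_set h (tedge N) \<le> sqrt (real_of_int p / (real_of_int b * real_of_int c))"
    unfolding L2_set_def by simp
  then show ?thesis unfolding has_flow_def using anti divh by (intro exI[of _ h]) auto
qed

text \<open>The coordinates are stretched in turn: each step has p = s and cross-section b c of at
  least s^2, hence norm at most 1 / sqrt s.\<close>

lemma has_flow_double:
  assumes s: "1 \<le> s" "2 * s \<le> N"
  shows "has_flow N (\<lambda>x. unif s s s x - unif (2 * s) (2 * s) (2 * s) x) (3 / sqrt (real_of_int s))"
proof -
  have inv: "1 / sqrt (real_of_int s) = sqrt (1 / real_of_int s)" by (simp add: real_sqrt_divide)
  have "has_flow N (\<lambda>x. unif s s s x - unif (2 * s) s s x) (1 / sqrt (real_of_int s))"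
    unfolding inv by (rule has_flow_mono[OF has_flow_stretch[of s N s s]]) (use s in auto)
  moreover have "has_flow N (\<lambda>x. unif (2 * s) s s x - unif (2 * s) (2 * s) s x) (1 / sqrt (real_of_int s))"
  proof (rule has_flow_mono[OF has_flow_rot[OF has_flow_stretch[of s N s "2 * s"]]])
    show "sqrt (real_of_int s / (real_of_int s * real_of_int (2 * s))) \<le> 1 / sqrt (real_of_int s)"
      unfolding inv using s by (intro real_sqrt_le_mono) (simp add: field_simps)
  qed (use s in \<open>auto simp: unif_rot\<close>)
  moreover have "has_flow N (\<lambda>x. unif (2 * s) (2 * s) s x - unif (2 * s) (2 * s) (2 * s) x) (1 / sqrt (real_of_int s))"
  proof (rule has_flow_mono[OF has_flow_rot[OF has_flow_rot[OF has_flow_stretch[of s N "2 * s" "2 * s"]]]])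
    show "sqrt (real_of_int s / (real_of_int (2 * s) * real_of_int (2 * s))) \<le> 1 / sqrt (real_of_int s)"
      unfolding inv using s by (intro real_sqrt_le_mono) (simp add: field_simps)
  qed (use s in \<open>auto simp: unif_rot\<close>)
  ultimately have "has_flow N (\<lambda>x. (unif s s s x - unif (2 * s) s s x) + ((unif (2 * s) s s x - unif (2 * s) (2 * s) s x)
    + (unif (2 * s) (2 * s) s x - unif (2 * s) (2 * s) (2 * s) x)))
    (1 / sqrt (real_of_int s) + (1 / sqrt (real_of_int s) + 1 / sqrt (real_of_int s)))"
    by (intro has_flow_add)
  then show ?thesis by (rule has_flow_mono) auto
qed

text \<open>The factor 1 - (1 / sqrt 2) ^ K reserves the remaining tail of the geometric series,
  which makes the induction close. The 12 is 3 / (1 - 3 / 4), with 3 / 4 as an upper bound for 1 /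
  sqrt 2.\<close>

lemma has_flow_dyadic:
  assumes a: "1 \<le> a" and N: "a * 2 ^ K \<le> N"
  shows "has_flow N (\<lambda>x. unif a a a x - unif (a * 2 ^ K) (a * 2 ^ K) (a * 2 ^ K) x)
    (12 / sqrt (real_of_int a) * (1 - (1 / sqrt 2) ^ K))"
  using N
proof (induction K)
  case 0
  have "has_flow N (\<lambda>x. 0) 0"
    unfolding has_flow_def by (intro exI[of _ "\<lambda>_. 0"]) (auto simp: antisym_field_def L2_set_def)
  then show ?case by simp
next
  case (Suc K)
  let ?s = "a * 2 ^ K"
  let ?r = "1 / sqrt 2 :: real"
  have s: "1 \<le> ?s" using a by (metis mult_mono' one_le_numeral one_le_power mult_1 zero_le_one)
  have N2: "2 * ?s \<le> N" using Suc.prems by simp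
  then have N1: "?s \<le> N" using s by linarith
  have "has_flow N (\<lambda>x. (unif a a a x - unif ?s ?s ?s x) + (unif ?s ?s ?s x - unif (2 * ?s) (2 * ?s) (2 * ?s) x))
     (12 / sqrt (real_of_int a) * (1 - ?r ^ K) + 3 / sqrt (real_of_int ?s))"
    by (intro has_flow_add Suc.IH N1 has_flow_double s N2)
  moreover have "12 / sqrt (real_of_int a) * (1 - ?r ^ K) + 3 / sqrt (real_of_int ?s)
      \<le> 12 / sqrt (real_of_int a) * (1 - ?r ^ Suc K)"
  proof -
    have "sqrt (real_of_int ?s) = sqrt (real_of_int a) * sqrt 2 ^ K"
      by (simp add: real_sqrt_mult real_sqrt_power)
    then have eq: "3 / sqrt (real_of_int ?s) = 3 / sqrt (real_of_int a) * ?r ^ K"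
      by (simp add: power_divide)
    have r: "?r \<le> 3 / 4"
    proof -
      have "4 / 3 \<le> sqrt 2" by (rule real_le_rsqrt) (simp add: power2_eq_square)
      then show ?thesis by (simp add: field_simps)
    qed
    have "?r ^ Suc K \<le> 3 / 4 * ?r ^ K" using mult_right_mono[OF r, of "?r ^ K"] by simp
    then have "(1 - ?r ^ K) + ?r ^ K / 4 \<le> 1 - ?r ^ Suc K" by simp
    then have "12 / sqrt (real_of_int a) * ((1 - ?r ^ K) + ?r ^ K / 4) \<le> 12 / sqrt (real_of_int a) * (1 - ?r ^ Suc K)"
      using a by (intro mult_left_mono) auto
    then show ?thesis unfolding eq by (simp add: algebra_simps)
  qed
  ultimately show ?case by (rule has_flow_mono) (simp add: mult.left_commute)
qed

section \<open>Comparison of box and torus models\<close>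

text \<open>Spins outside the image are uncoupled and multiply numerator and denominator by the same
  number of configurations.\<close>

lemma wcorr_embed:
  fixes e :: "'u \<Rightarrow> 'v"
  assumes V: "finite V" and q: "q > 0" and inj: "inj_on e U" and eU: "e ` U \<subseteq> V"
    and J: "\<And>x y. x \<in> U \<Longrightarrow> y \<in> U \<Longrightarrow> J0 (e x) (e y) = J x y"
    and J0: "\<And>v w. v \<notin> e ` U \<or> w \<notin> e ` U \<Longrightarrow> J0 v w = 0" and xy: "x \<in> U" "y \<in> U"
  shows "wcorr q V J0 {} g' (e x) (e y) = wcorr q U J {} g x y"
proof -
  let ?R = "V - e ` U"
  define j where "j \<phi> \<psi> = (\<lambda>v\<in>V. if v \<in> e ` U then \<phi> (the_inv_into U e v) else \<psi> v)" for \<phi> \<psi> :: "_ \<Rightarrow> int"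
  have inv: "the_inv_into U e (e u) = u" if "u \<in> U" for u using inj that by (rule the_inv_into_f_f)
  have je: "j \<phi> \<psi> (e u) = \<phi> u" if "u \<in> U" for u \<phi> \<psi> using that eU inv by (auto simp: j_def)
  have bij: "bij_betw (\<lambda>(\<phi>, \<psi>). j \<phi> \<psi>) (conf q U \<times> conf q ?R) (conf q V)"
  proof (rule bij_betw_byWitness[where f' = "\<lambda>\<theta>. (\<lambda>u\<in>U. \<theta> (e u), \<lambda>v\<in>?R. \<theta> v)"])
    show "\<forall>p\<in>conf q U \<times> conf q ?R. (\<lambda>\<theta>. (\<lambda>u\<in>U. \<theta> (e u), \<lambda>v\<in>?R. \<theta> v)) (case p of (\<phi>, \<psi>) \<Rightarrow> j \<phi> \<psi>) = p"
      using je by (auto simp: conf_def PiE_def extensional_def restrict_def fun_eq_iff j_def)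
    show "\<forall>\<theta>\<in>conf q V. (case (\<lambda>u\<in>U. \<theta> (e u), \<lambda>v\<in>?R. \<theta> v) of (\<phi>, \<psi>) \<Rightarrow> j \<phi> \<psi>) = \<theta>"
      using inv by (auto simp: conf_def PiE_def extensional_def restrict_def fun_eq_iff j_def)
    show "(\<lambda>(\<phi>, \<psi>). j \<phi> \<psi>) ` (conf q U \<times> conf q ?R) \<subseteq> conf q V"
      using inv by (auto simp: conf_def j_def PiE_def Pi_def)
    show "(\<lambda>\<theta>. (\<lambda>u\<in>U. \<theta> (e u), \<lambda>v\<in>?R. \<theta> v)) ` conf q V \<subseteq> conf q U \<times> conf q ?R"
      using eU by (auto simp: conf_def PiE_def Pi_def)
  qed
  have en: "energy q V J0 (j \<phi> \<psi>) = energy q U J \<phi>" for \<phi> \<psi>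
  proof -
    have "energy q V J0 (j \<phi> \<psi>) = (\<Sum>v\<in>e ` U. \<Sum>w\<in>e ` U. J0 v w * dcos q (j \<phi> \<psi>) v w)"
      unfolding energy_def
      by (rule sum.mono_neutral_cong_right[OF V eU])
        (auto simp: J0 intro!: sum.neutral sum.mono_neutral_right[OF V eU])
    also have "\<dots> = energy q U J \<phi>"
      unfolding energy_def sum.reindex[OF inj] o_def
      by (intro sum.cong refl) (simp add: J dcos_def je)
    finally show ?thesis .
  qed
  have ws: "wsum q V J0 {} g' f' = real (card (conf q ?R)) * wsum q U J {} g f"
    if "\<And>\<phi> \<psi>. f' (j \<phi> \<psi>) = f \<phi>" for f' f
  proof -
    have "wsum q V J0 {} g' f' = (\<Sum>(\<phi>, \<psi>)\<in>conf q U \<times> conf q ?R. f \<phi> * exp (energy q U J \<phi>))"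
      unfolding wsum_def using sum.reindex_bij_betw[OF bij, of "\<lambda>\<theta>. f' \<theta> * exp (energy q V J0 \<theta>)"]
      by (simp add: case_prod_unfold that en)
    also have "\<dots> = (\<Sum>\<phi>\<in>conf q U. \<Sum>\<psi>\<in>conf q ?R. f \<phi> * exp (energy q U J \<phi>))"
      by (rule sum.cartesian_product[symmetric])
    finally show ?thesis by (simp add: wsum_def sum_distrib_left)
  qed
  have "conf q ?R \<noteq> {}" using q by (auto simp: conf_def PiE_eq_empty_iff)
  then have c: "card (conf q ?R) \<noteq> 0" using V by simp
  show ?thesis
    unfolding wcorr_def
    by (subst ws[where f = "\<lambda>\<phi>. dcos q \<phi> x y"], simp add: dcos_def je xy)
      (subst ws[where f = "\<lambda>_. 1"], simp_all add: c)
qed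

lemma wcorr_free_ground: "wcorr q V J {} g x y = wcorr q V J {} g' x y"
  by (simp add: wcorr_def wsum_def)

lemma wcorr_sym: "wcorr q V J W g x y = wcorr q V J W g y x"
proof -
  have "dcos q \<theta> x y = dcos q \<theta> y x" for \<theta>
    unfolding dcos_def by (metis cos_minus minus_diff_eq mult_minus_right of_int_minus)
  then show ?thesis by (simp add: wcorr_def)
qed

lemma wcorr_le_1:
  assumes "finite V" "q > 0" "W \<subseteq> V" "g \<in> V"
  shows "wcorr q V J W g x y \<le> 1"
proof -
  have "wsum q V J W g (\<lambda>\<theta>. dcos q \<theta> x y) \<le> wsum q V J W g (\<lambda>_. 1)"
    unfolding wsum_def by (intro sum_mono) (auto simp: dcos_def)
  with wsum_1_pos[OF assms, of J] show ?thesis by (simp add: wcorr_def)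
qed

text \<open>The double sum is the expectation of the squared length of the total spin in A. It
  serves twice: to discard the zero-mode square on the torus and to bound the final average from
  below.\<close>

lemma sum_sum_wcorr_nonneg:
  assumes "finite V" "q > 0" "W \<subseteq> V" "g \<in> V"
  shows "0 \<le> (\<Sum>x\<in>A. \<Sum>y\<in>A. wcorr q V J W g x y)"
proof -
  let ?w = "\<lambda>\<theta>. if \<forall>w\<in>W. \<theta> w = \<theta> g then exp (energy q V J \<theta>) else 0"
  have ws: "wsum q V J W g f = (\<Sum>\<theta>\<in>conf q V. ?w \<theta> * f \<theta>)" for f
    unfolding wsum_def by (intro sum.cong) auto
  have "(\<Sum>x\<in>A. \<Sum>y\<in>A. wsum q V J W g (\<lambda>\<theta>. dcos q \<theta> x y))
      = (\<Sum>x\<in>A. \<Sum>\<theta>\<in>conf q V. \<Sum>y\<in>A. ?w \<theta> * dcos q \<theta> x y)"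
    unfolding ws by (intro sum.cong refl sum.swap)
  also have "\<dots> = (\<Sum>\<theta>\<in>conf q V. \<Sum>x\<in>A. \<Sum>y\<in>A. ?w \<theta> * dcos q \<theta> x y)"
    by (rule sum.swap)
  also have "\<dots> = (\<Sum>\<theta>\<in>conf q V. ?w \<theta> * (\<Sum>x\<in>A. \<Sum>y\<in>A. dcos q \<theta> x y))"
    by (simp add: sum_distrib_left)
  also have "\<dots> \<ge> 0"
  proof (rule sum_nonneg)
    fix \<theta>
    have "0 \<le> (\<Sum>x\<in>A. \<Sum>y\<in>A. dcos q \<theta> x y)" using sum_dcos_square[of "\<lambda>_. 1" q \<theta> A] by simp
    then show "0 \<le> ?w \<theta> * (\<Sum>x\<in>A. \<Sum>y\<in>A. dcos q \<theta> x y)" by simp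
  qed
  finally show ?thesis
    using wsum_1_pos[OF assms, of J] unfolding wcorr_def
    by (simp add: sum_divide_distrib[symmetric])
qed

section \<open>Lattice boxes, the Hamiltonian, and clock correlations in a box\<close>

lemma finite_box [simp]: "finite (box L)"
proof (rule finite_subset)
  show "box L \<subseteq> {- int L..int L} \<times> {- int L..int L} \<times> {- int L..int L}"
    by (auto simp: box_def supnorm_def)
qed simp

lemma box_split: "box L = intr L \<union> bdry L" "intr L \<inter> bdry L = {}"
  by (auto simp: box_def intr_def bdry_def)

lemma finite_intr [simp]: "finite (intr L)" and finite_bdry [simp]: "finite (bdry L)"
  using finite_box[of L] unfolding box_split(1) by auto

lemma intr_iff: "(a, b, c) \<in> intr L \<longleftrightarrow> \<bar>a\<bar> < int L \<and> \<bar>b\<bar> < int L \<and> \<bar>c\<bar> < int L"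
  by (auto simp: intr_def box_def bdry_def supnorm_def max_def)

lemma box_iff: "(a, b, c) \<in> box L \<longleftrightarrow> \<bar>a\<bar> \<le> int L \<and> \<bar>b\<bar> \<le> int L \<and> \<bar>c\<bar> \<le> int L"
  by (auto simp: box_def supnorm_def)

lemma sum_squares_eq_1:
  fixes a b c :: int
  shows "a\<^sup>2 + b\<^sup>2 + c\<^sup>2 = 1 \<longleftrightarrow> \<bar>a\<bar> = 1 \<and> b = 0 \<and> c = 0 \<or> a = 0 \<and> \<bar>b\<bar> = 1 \<and> c = 0 \<or> a = 0 \<and> b = 0 \<and> \<bar>c\<bar> = 1"
proof -
  have "0 \<le> a\<^sup>2" "0 \<le> b\<^sup>2" "0 \<le> c\<^sup>2" by simp_all
  then have "a\<^sup>2 + b\<^sup>2 + c\<^sup>2 = 1 \<longleftrightarrow> a\<^sup>2 = 1 \<and> b\<^sup>2 = 0 \<and> c\<^sup>2 = 0 \<or> a\<^sup>2 = 0 \<and> b\<^sup>2 = 1 \<and> c\<^sup>2 = 0 \<or> a\<^sup>2 = 0 \<and> b\<^sup>2 = 0 \<and> c\<^sup>2 = 1"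
    by linarith
  then show ?thesis by (simp add: abs_square_eq_1)
qed

lemma coupling_eq: "coupling (a, b, c) (a', b', c') =
  (if \<bar>a - a'\<bar> = 1 \<and> b = b' \<and> c = c' \<or> a = a' \<and> \<bar>b - b'\<bar> = 1 \<and> c = c' \<or> a = a' \<and> b = b' \<and> \<bar>c - c'\<bar> = 1
   then 1 / 6 else 0)"
  by (simp add: coupling_def sum_squares_eq_1)

lemma coupling_nonneg: "0 \<le> coupling k l"
  by (cases k; cases l) (simp add: coupling_eq)

lemma coupling_sym: "coupling k l = coupling l k"
  by (cases k; cases l) (auto simp: coupling_eq abs_minus_commute)

text \<open>The Riemann sum of \<open>fv_expect\<close> without the cell volume (2 pi / q) ^ card
  (intr L), which cancels in every ratio.\<close>

definition clock_sum :: "real \<Rightarrow> bc \<Rightarrow> nat \<Rightarrow> nat \<Rightarrow> ((site \<Rightarrow> real) \<Rightarrow> real) \<Rightarrow> real" where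
  "clock_sum \<beta> \<nu> L q F = (\<Sum>\<phi>\<in>conf q (intr L).
     exp (- \<beta> * hamiltonian \<nu> L (\<lambda>x. 2 * pi / real q * real_of_int (\<phi> x))) * F (\<lambda>x. 2 * pi / real q * real_of_int (\<phi> x)))"

definition free_clock :: "real \<Rightarrow> nat \<Rightarrow> nat \<Rightarrow> site \<Rightarrow> site \<Rightarrow> real" where
  "free_clock \<beta> L q x y = clock_sum \<beta> Free L q (spin_corr_obs x y) / clock_sum \<beta> Free L q (\<lambda>_. 1)"

definition plus_clock :: "real \<Rightarrow> nat \<Rightarrow> nat \<Rightarrow> real" where
  "plus_clock \<beta> L q = clock_sum \<beta> Plus L q (\<lambda>\<theta>. cos (\<theta> (0, 0, 0))) / clock_sum \<beta> Plus L q (\<lambda>_. 1)"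

lemma hamiltonian_Free:
  "hamiltonian Free L \<theta> = - (\<Sum>k\<in>intr L. \<Sum>l\<in>intr L. coupling k l * cos (\<theta> k - \<theta> l))"
proof -
  have "(\<Sum>k\<in>box L. \<Sum>l\<in>box L. coupling k l * sdot (spin Free L \<theta> k) (spin Free L \<theta> l))
     = (\<Sum>k\<in>intr L. \<Sum>l\<in>intr L. coupling k l * cos (\<theta> k - \<theta> l))"
    by (intro sum.mono_neutral_cong_right) 
      (auto simp: box_split spin_def sdot_def cos_diff intro!: sum.neutral sum.mono_neutral_cong_right)
  then show ?thesis by (simp add: hamiltonian_def)
qed

lemma hamiltonian_Plus:
  "hamiltonian Plus L \<theta> = - ((\<Sum>k\<in>intr L. \<Sum>l\<in>intr L. coupling k l * cos (\<theta> k - \<theta> l))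
    + 2 * (\<Sum>k\<in>intr L. (\<Sum>l\<in>bdry L. coupling k l) * cos (\<theta> k)) + (\<Sum>k\<in>bdry L. \<Sum>l\<in>bdry L. coupling k l))"
proof -
  let ?s = "spin Plus L \<theta>"
  have i: "?s k = (cos (\<theta> k), sin (\<theta> k))" if "k \<in> intr L" for k using that by (simp add: spin_def)
  have b: "?s k = (1, 0)" if "k \<in> bdry L" for k using that box_split(2)[of L] by (auto simp: spin_def)
  have spl: "sum f (box L) = sum f (intr L) + sum f (bdry L)" for f :: "site \<Rightarrow> real"
    unfolding box_split(1) by (rule sum.union_disjoint) (auto simp: box_split(2))
  have "(\<Sum>k\<in>intr L. \<Sum>l\<in>bdry L. coupling k l * sdot (?s k) (?s l)) = (\<Sum>k\<in>intr L. (\<Sum>l\<in>bdry L. coupling k l) * cos (\<theta> k))"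
    by (intro sum.cong refl) (simp add: i b sdot_def sum_distrib_right)
  moreover have "(\<Sum>k\<in>bdry L. \<Sum>l\<in>intr L. coupling k l * sdot (?s k) (?s l)) = (\<Sum>l\<in>intr L. (\<Sum>k\<in>bdry L. coupling l k) * cos (\<theta> l))"
    by (subst sum.swap, intro sum.cong refl) (simp add: i b sdot_def sum_distrib_right coupling_sym)
  moreover have "(\<Sum>k\<in>bdry L. \<Sum>l\<in>bdry L. coupling k l * sdot (?s k) (?s l)) = (\<Sum>k\<in>bdry L. \<Sum>l\<in>bdry L. coupling k l)"
    by (intro sum.cong refl) (simp add: b sdot_def)
  moreover have "(\<Sum>k\<in>intr L. \<Sum>l\<in>intr L. coupling k l * sdot (?s k) (?s l)) = (\<Sum>k\<in>intr L. \<Sum>l\<in>intr L. coupling k l * cos (\<theta> k - \<theta> l))"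
    by (intro sum.cong refl) (simp add: i sdot_def cos_diff)
  ultimately show ?thesis
    unfolding hamiltonian_def spl by (simp add: sum.distrib)
qed

lemma dcos_alt: "dcos q \<phi> x y = cos (2 * pi / real q * real_of_int (\<phi> x) - 2 * pi / real q * real_of_int (\<phi> y))"
  unfolding dcos_def by (simp add: right_diff_distrib diff_divide_distrib)

lemma free_clock_eq_wcorr:
  "free_clock \<beta> L q x y = wcorr q (intr L) (\<lambda>k l. \<beta> * coupling k l) {} g x y"
proof -
  have "- \<beta> * hamiltonian Free L (\<lambda>x. 2 * pi / real q * real_of_int (\<phi> x)) = energy q (intr L) (\<lambda>k l. \<beta> * coupling k l) \<phi>" for \<phi>
    unfolding hamiltonian_Free energy_def dcos_alt by (simp add: sum_distrib_left mult.assoc sum_negf)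
  moreover have "spin_corr_obs x y (\<lambda>x. 2 * pi / real q * real_of_int (\<phi> x)) = dcos q \<phi> x y" for \<phi>
    unfolding spin_corr_obs_def sdot_def dcos_alt by (simp add: cos_diff)
  ultimately show ?thesis
    unfolding free_clock_def clock_sum_def wcorr_def wsum_def by (simp add: mult.commute)
qed

text \<open>Fixing the constant value on the wired region by rotation invariance turns wired into plus
  boundary conditions.\<close>

lemma wired_eq_plus:
  fixes e :: "site \<Rightarrow> 'v"
  assumes V: "finite V" and q: "q > 0" and L: "L \<ge> 1" and inj: "inj_on e (box L)" and eV: "e ` box L \<subseteq> V"
    and g: "g \<in> V - e ` intr L"
    and J: "\<And>k l. k \<in> intr L \<Longrightarrow> l \<in> box L \<Longrightarrow> J (e k) (e l) = \<beta> * coupling k l \<and> J (e l) (e k) = \<beta> * coupling k l"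
    and J0: "\<And>k v. k \<in> intr L \<Longrightarrow> v \<in> V - e ` box L \<Longrightarrow> J (e k) v = 0 \<and> J v (e k) = 0"
  shows "wcorr q V J (V - e ` intr L) g (e (0, 0, 0)) g = plus_clock \<beta> L q"
proof -
  let ?I = "intr L"
  define W where "W = V - e ` ?I"
  have inI: "inj_on e ?I" using inj box_split(1)[of L] by (auto intro: inj_on_subset)
  have eI: "e ` ?I \<subseteq> V" using eV box_split(1)[of L] by auto
  have gW: "g \<in> W" "g \<in> V" using g by (auto simp: W_def)
  have WV: "W \<subseteq> V" by (auto simp: W_def)
  have finW: "finite W" using V by (simp add: W_def)
  have inv: "the_inv_into ?I e (e u) = u" if "u \<in> ?I" for u using inI that by (rule the_inv_into_f_f)
  \<comment> \<open>Wired configurations are parametrised by the common value a on \<open>W\<close>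
    and the interior angles relative to it.\<close>
  define ext where "ext \<phi> a = (\<lambda>v\<in>V. if v \<in> W then a else (\<phi> (the_inv_into ?I e v) + a) mod int q)"
    for \<phi> :: "site \<Rightarrow> int" and a :: int
  have ext_e: "ext \<phi> a (e k) = (\<phi> k + a) mod int q" if "k \<in> ?I" for \<phi> a k
    using that eI inv by (auto simp: ext_def W_def)
  have ext_W: "ext \<phi> a w = a" if "w \<in> W" for \<phi> a w using that WV by (auto simp: ext_def)
  define C where "C = {\<theta> \<in> conf q V. \<forall>w\<in>W. \<theta> w = \<theta> g}"
  have bij: "bij_betw (\<lambda>(\<phi>, a). ext \<phi> a) (conf q ?I \<times> {0..<int q}) C"
  proof (rule bij_betw_byWitness[where f' = "\<lambda>\<theta>. (\<lambda>k\<in>?I. (\<theta> (e k) - \<theta> g) mod int q, \<theta> g)"])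
    show "\<forall>p\<in>conf q ?I \<times> {0..<int q}. (\<lambda>\<theta>. (\<lambda>k\<in>?I. (\<theta> (e k) - \<theta> g) mod int q, \<theta> g)) (case p of (\<phi>, a) \<Rightarrow> ext \<phi> a) = p"
    proof (rule ballI)
      fix p assume "p \<in> conf q ?I \<times> {0..<int q}"
      then obtain \<phi> a where p: "p = (\<phi>, a)" and \<phi>: "\<phi> \<in> conf q ?I" by blast
      have "(\<lambda>k\<in>?I. (ext \<phi> a (e k) - ext \<phi> a g) mod int q) x = \<phi> x" for x
      proof (cases "x \<in> ?I")
        case True
        with \<phi> have "0 \<le> \<phi> x" "\<phi> x < int q" by (auto simp: conf_def dest: PiE_mem)
        with True show ?thesis by (simp add: ext_e ext_W gW mod_diff_left_eq)
      next
        case False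
        have "\<phi> x = undefined" using PiE_arb[OF \<phi>[unfolded conf_def] False] .
        with False show ?thesis by simp
      qed
      then show "(\<lambda>\<theta>. (\<lambda>k\<in>?I. (\<theta> (e k) - \<theta> g) mod int q, \<theta> g)) (case p of (\<phi>, a) \<Rightarrow> ext \<phi> a) = p"
        unfolding p by (auto simp: ext_W gW)
    qed
    show "\<forall>\<theta>\<in>C. (case (\<lambda>k\<in>?I. (\<theta> (e k) - \<theta> g) mod int q, \<theta> g) of (\<phi>, a) \<Rightarrow> ext \<phi> a) = \<theta>"
    proof (rule ballI)
      fix \<theta> assume \<theta>: "\<theta> \<in> C"
      have "ext (\<lambda>k\<in>?I. (\<theta> (e k) - \<theta> g) mod int q) (\<theta> g) v = \<theta> v" for v
      proof -
        consider "v \<in> W" | k where "k \<in> ?I" "v = e k" | "v \<notin> V" unfolding W_def by blast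
        then show ?thesis
        proof cases
          case 1
          then show ?thesis using \<theta> by (simp add: ext_W C_def)
        next
          case 2
          then have "v \<in> V" using eI by auto
          then have "0 \<le> \<theta> v" "\<theta> v < int q" using \<theta> by (auto simp: C_def conf_def dest: PiE_mem)
          with 2 show ?thesis by (simp add: ext_e mod_add_left_eq)
        next
          case 3
          then show ?thesis using \<theta> by (auto simp: C_def conf_def ext_def PiE_def extensional_def)
        qed
      qed
      then show "(case (\<lambda>k\<in>?I. (\<theta> (e k) - \<theta> g) mod int q, \<theta> g) of (\<phi>, a) \<Rightarrow> ext \<phi> a) = \<theta>"
        by (simp add: fun_eq_iff)
    qed
    show "(\<lambda>(\<phi>, a). ext \<phi> a) ` (conf q ?I \<times> {0..<int q}) \<subseteq> C"
    proof (rule image_subsetI)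
      fix p assume "p \<in> conf q ?I \<times> {0..<int q}"
      then obtain \<phi> a where p: "p = (\<phi>, a)" and a: "a \<in> {0..<int q}" by blast
      have "ext \<phi> a \<in> conf q V" using q a unfolding conf_def ext_def by (simp add: Pi_def)
      then show "(\<lambda>(\<phi>, a). ext \<phi> a) p \<in> C" unfolding p C_def by (simp add: ext_W gW)
    qed
    show "(\<lambda>\<theta>. (\<lambda>k\<in>?I. (\<theta> (e k) - \<theta> g) mod int q, \<theta> g)) ` C \<subseteq> conf q ?I \<times> {0..<int q}"
    proof (rule image_subsetI)
      fix \<theta> assume "\<theta> \<in> C"
      then have "\<theta> g \<in> {0..<int q}" using PiE_mem[of \<theta> V "\<lambda>_. {0..<int q}" g] gW
        unfolding C_def conf_def by blast
      then show "(\<lambda>k\<in>?I. (\<theta> (e k) - \<theta> g) mod int q, \<theta> g) \<in> conf q ?I \<times> {0..<int q}"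
        using q by (simp add: conf_def)
    qed
  qed
  let ?w = "2 * pi / real q"
  have d1: "dcos q (ext \<phi> a) (e k) (e l) = cos (?w * real_of_int (\<phi> k) - ?w * real_of_int (\<phi> l))"
    if "k \<in> ?I" "l \<in> ?I" for \<phi> a k l
  proof -
    have "[(\<phi> k + a) mod int q - (\<phi> l + a) mod int q = \<phi> k - \<phi> l] (mod int q)"
      by (simp add: cong_def mod_diff_eq)
    from cos_mod_shift[OF q this] show ?thesis
      unfolding dcos_def ext_e[OF that(1)] ext_e[OF that(2)] by (simp add: right_diff_distrib diff_divide_distrib)
  qed
  have d2: "dcos q (ext \<phi> a) (e k) w = cos (?w * real_of_int (\<phi> k))"
    "dcos q (ext \<phi> a) w (e k) = cos (?w * real_of_int (\<phi> k))" if "k \<in> ?I" "w \<in> W" for \<phi> a k w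
  proof -
    have "[(\<phi> k + a) mod int q - a = \<phi> k] (mod int q)" by (simp add: cong_def mod_diff_left_eq)
    from cos_mod_shift[OF q this] show *: "dcos q (ext \<phi> a) (e k) w = cos (?w * real_of_int (\<phi> k))"
      unfolding dcos_def ext_e[OF that(1)] ext_W[OF that(2)] .
    have "dcos q (ext \<phi> a) w (e k) = dcos q (ext \<phi> a) (e k) w"
      unfolding dcos_def by (metis cos_minus minus_diff_eq mult_minus_right of_int_minus)
    with * show "dcos q (ext \<phi> a) w (e k) = cos (?w * real_of_int (\<phi> k))" by simp
  qed
  \<comment> \<open>Difference between the wired-wired couplings and the boundary-boundary terms of
    the Hamiltonian; it does not depend on the configuration, so exp K cancels in the ratio.\<close>
  define K where "K = (\<Sum>v\<in>W. \<Sum>w\<in>W. J v w) - \<beta> * (\<Sum>k\<in>bdry L. \<Sum>l\<in>bdry L. coupling k l)"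
  \<comment> \<open>Among the wired sites only the images of \<open>bdry L\<close> interact with the
    interior.\<close>
  have nb: "(\<Sum>w\<in>W. J (e k) w) = \<beta> * (\<Sum>l\<in>bdry L. coupling k l)"
    "(\<Sum>w\<in>W. J w (e k)) = \<beta> * (\<Sum>l\<in>bdry L. coupling k l)" if k: "k \<in> ?I" for k
  proof -
    have eb: "e ` bdry L \<subseteq> W"
    proof
      fix v assume "v \<in> e ` bdry L"
      then obtain l where l: "l \<in> bdry L" "v = e l" by auto
      have "e l \<noteq> e k" if "k \<in> ?I" for k
        using inj_onD[OF inj, of l k] l(1) that box_split[of L] by auto
      moreover have "e l \<in> V" using eV l(1) box_split(1)[of L] by auto
      ultimately show "v \<in> W" using l by (auto simp: W_def)
    qed
    have z: "w \<in> V - e ` box L" if "w \<in> W - e ` bdry L" for w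
      using that box_split(1)[of L] by (auto simp: W_def)
    have ib: "inj_on e (bdry L)" using inj box_split(1)[of L] by (auto intro: inj_on_subset)
    have bx: "l \<in> box L" if "l \<in> bdry L" for l using that box_split(1)[of L] by auto
    have "(\<Sum>w\<in>W. J (e k) w) = (\<Sum>w\<in>e ` bdry L. J (e k) w)"
      by (rule sum.mono_neutral_right[OF finW eb]) (use J0[OF k] z in blast)
    also have "\<dots> = \<beta> * (\<Sum>l\<in>bdry L. coupling k l)"
      unfolding sum.reindex[OF ib] o_def sum_distrib_left using J[OF k bx] by (intro sum.cong) auto
    finally show "(\<Sum>w\<in>W. J (e k) w) = \<beta> * (\<Sum>l\<in>bdry L. coupling k l)" .
    have "(\<Sum>w\<in>W. J w (e k)) = (\<Sum>w\<in>e ` bdry L. J w (e k))"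
      by (rule sum.mono_neutral_right[OF finW eb]) (use J0[OF k] z in blast)
    also have "\<dots> = \<beta> * (\<Sum>l\<in>bdry L. coupling k l)"
      unfolding sum.reindex[OF ib] o_def sum_distrib_left using J[OF k bx] by (intro sum.cong) auto
    finally show "(\<Sum>w\<in>W. J w (e k)) = \<beta> * (\<Sum>l\<in>bdry L. coupling k l)" .
  qed
  have spl: "sum f V = (\<Sum>k\<in>?I. f (e k)) + sum f W" for f :: "'v \<Rightarrow> real"
  proof -
    have "sum f V = sum f (e ` ?I) + sum f W"
      unfolding W_def using V eI by (metis sum.subset_diff add.commute)
    then show ?thesis by (simp add: sum.reindex[OF inI])
  qed
  have bxI: "l \<in> box L" if "l \<in> ?I" for l using that box_split(1)[of L] by auto
  have en: "energy q V J (ext \<phi> a) = - \<beta> * hamiltonian Plus L (\<lambda>x. ?w * real_of_int (\<phi> x)) + K" for \<phi> a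
  proof -
    have "(\<Sum>k\<in>?I. \<Sum>l\<in>?I. J (e k) (e l) * dcos q (ext \<phi> a) (e k) (e l)) =
      \<beta> * (\<Sum>k\<in>?I. \<Sum>l\<in>?I. coupling k l * cos (?w * real_of_int (\<phi> k) - ?w * real_of_int (\<phi> l)))"
      unfolding sum_distrib_left by (intro sum.cong refl) (simp add: d1 J bxI)
    moreover have "(\<Sum>k\<in>?I. \<Sum>w\<in>W. J (e k) w * dcos q (ext \<phi> a) (e k) w) =
      \<beta> * (\<Sum>k\<in>?I. (\<Sum>l\<in>bdry L. coupling k l) * cos (?w * real_of_int (\<phi> k)))"
    proof -
      have "(\<Sum>w\<in>W. J (e k) w * dcos q (ext \<phi> a) (e k) w) = \<beta> * ((\<Sum>l\<in>bdry L. coupling k l) * cos (?w * real_of_int (\<phi> k)))"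
        if "k \<in> ?I" for k
      proof -
        have "(\<Sum>w\<in>W. J (e k) w * dcos q (ext \<phi> a) (e k) w) = (\<Sum>w\<in>W. J (e k) w) * cos (?w * real_of_int (\<phi> k))"
          unfolding sum_distrib_right using that by (intro sum.cong refl) (simp add: d2)
        then show ?thesis by (simp only: nb(1)[OF that] mult.assoc)
      qed
      then show ?thesis by (subst sum_distrib_left) (intro sum.cong refl)
    qed
    moreover have "(\<Sum>w\<in>W. \<Sum>k\<in>?I. J w (e k) * dcos q (ext \<phi> a) w (e k)) =
      \<beta> * (\<Sum>k\<in>?I. (\<Sum>l\<in>bdry L. coupling k l) * cos (?w * real_of_int (\<phi> k)))"
    proof -
      have "(\<Sum>w\<in>W. J w (e k) * dcos q (ext \<phi> a) w (e k)) = \<beta> * ((\<Sum>l\<in>bdry L. coupling k l) * cos (?w * real_of_int (\<phi> k)))"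
        if "k \<in> ?I" for k
      proof -
        have "(\<Sum>w\<in>W. J w (e k) * dcos q (ext \<phi> a) w (e k)) = (\<Sum>w\<in>W. J w (e k)) * cos (?w * real_of_int (\<phi> k))"
          unfolding sum_distrib_right using that by (intro sum.cong refl) (simp add: d2)
        then show ?thesis by (simp only: nb(2)[OF that] mult.assoc)
      qed
      then show ?thesis by (subst sum.swap, subst sum_distrib_left) (intro sum.cong refl)
    qed
    moreover have "(\<Sum>v\<in>W. \<Sum>w\<in>W. J v w * dcos q (ext \<phi> a) v w) = (\<Sum>v\<in>W. \<Sum>w\<in>W. J v w)"
      by (intro sum.cong refl) (simp add: dcos_def ext_W)
    ultimately show ?thesis
      unfolding energy_def spl hamiltonian_Plus K_def by (simp add: sum.distrib algebra_simps)
  qed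
  have zero: "(0, 0, 0) \<in> ?I" using L by (simp add: intr_iff)
  have ws: "wsum q V J W g f' = real q * exp K * clock_sum \<beta> Plus L q f"
    if f: "\<And>\<phi> a. f' (ext \<phi> a) = f (\<lambda>x. ?w * real_of_int (\<phi> x))" for f f'
  proof -
    have "wsum q V J W g f' = (\<Sum>\<theta>\<in>C. f' \<theta> * exp (energy q V J \<theta>))"
      unfolding wsum_def C_def using V by (intro sum.inter_filter[symmetric]) simp
    also have "\<dots> = (\<Sum>p\<in>conf q ?I \<times> {0..<int q}. f' (case p of (\<phi>, a) \<Rightarrow> ext \<phi> a) *
        exp (energy q V J (case p of (\<phi>, a) \<Rightarrow> ext \<phi> a)))"
      by (rule sum.reindex_bij_betw[OF bij, symmetric])
    also have "\<dots> = (\<Sum>(\<phi>, a)\<in>conf q ?I \<times> {0..<int q}. exp K *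
        (exp (- \<beta> * hamiltonian Plus L (\<lambda>x. ?w * real_of_int (\<phi> x))) * f (\<lambda>x. ?w * real_of_int (\<phi> x))))"
    proof (intro sum.cong refl)
      fix p :: "(site \<Rightarrow> int) \<times> int"
      obtain \<phi> a where p: "p = (\<phi>, a)" by fastforce
      show "f' (case p of (\<phi>, a) \<Rightarrow> ext \<phi> a) * exp (energy q V J (case p of (\<phi>, a) \<Rightarrow> ext \<phi> a)) =
        (case p of (\<phi>, a) \<Rightarrow> exp K *
          (exp (- \<beta> * hamiltonian Plus L (\<lambda>x. ?w * real_of_int (\<phi> x))) * f (\<lambda>x. ?w * real_of_int (\<phi> x))))"
        unfolding p case_prod_conv f en exp_add by (simp only: mult_ac)
    qed
    also have "\<dots> = (\<Sum>\<phi>\<in>conf q ?I. \<Sum>a\<in>{0..<int q}. exp K *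
        (exp (- \<beta> * hamiltonian Plus L (\<lambda>x. ?w * real_of_int (\<phi> x))) * f (\<lambda>x. ?w * real_of_int (\<phi> x))))"
      by (rule sum.cartesian_product[symmetric])
    finally show ?thesis by (simp add: clock_sum_def sum_distrib_left mult_ac)
  qed
  show ?thesis
    unfolding wcorr_def plus_clock_def W_def[symmetric]
    by (subst ws[where f = "\<lambda>\<theta>. cos (\<theta> (0, 0, 0))"], simp add: d2 zero gW)
      (subst ws[where f = "\<lambda>_. 1"], use q in simp_all)
qed

section \<open>Boxes embedded in the torus, and the comparisons they give\<close>

definition temb :: "int \<Rightarrow> site \<Rightarrow> site \<Rightarrow> site" where
  "temb N a z = (case a of (a1, a2, a3) \<Rightarrow> case z of (z1, z2, z3) \<Rightarrow>
     ((a1 + z1) mod N, (a2 + z2) mod N, (a3 + z3) mod N))"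

definition tcoupling :: "int \<Rightarrow> real \<Rightarrow> site \<Rightarrow> site \<Rightarrow> real" where
  "tcoupling N \<beta> = (\<lambda>x y. if (x, y) \<in> tedge N then \<beta> / 6 else 0)"

text \<open>Reduction modulo N could identify points at difference N and make points at difference N
  - 1 adjacent; the bound N - 2 excludes both. For a box of radius L, with differences up to 2 L,
  this is the condition 2 L + 2 \<le> N.\<close>

lemma cyc_mod_eq_iff:
  fixes N u z z' :: int
  assumes N: "2 \<le> N" and d: "\<bar>z - z'\<bar> \<le> N - 2"
  shows "(u + z) mod N = (u + z') mod N \<longleftrightarrow> z = z'"
    and "cyc_adj N ((u + z) mod N) ((u + z') mod N) \<longleftrightarrow> \<bar>z - z'\<bar> = 1"
proof -
  define i where "i = (u + z) div N - (u + z') div N"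
  have b: "0 \<le> (u + z) mod N" "(u + z) mod N < N" "0 \<le> (u + z') mod N" "(u + z') mod N < N"
    using N by auto
  have D: "(u + z) mod N - (u + z') mod N = z - z' - N * i"
    unfolding i_def by (simp add: minus_mult_div_eq_mod[symmetric] algebra_simps)
  have "\<bar>N * i\<bar> < N * 2" using D b d by linarith
  then have "\<bar>i\<bar> < 2" using N by (simp add: abs_mult)
  then consider "i = 0" | "i = 1" | "i = - 1" by linarith
  then have D': "(u + z) mod N - (u + z') mod N = z - z' \<or> (u + z) mod N - (u + z') mod N = z - z' - N
      \<or> (u + z) mod N - (u + z') mod N = z - z' + N"
    using D by cases auto
  then show "(u + z) mod N = (u + z') mod N \<longleftrightarrow> z = z'"
    using b d by auto
  show "cyc_adj N ((u + z) mod N) ((u + z') mod N) \<longleftrightarrow> \<bar>z - z'\<bar> = 1"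
    using D' b d N unfolding cyc_adj_def by (smt (verit))
qed

lemma cyc_adj_neighbour:
  assumes N: "2 \<le> N" and v: "0 \<le> v" "v < N" and ad: "cyc_adj N (u mod N) v"
  shows "v = (u + 1) mod N \<or> v = (u - 1) mod N"
proof -
  have b: "0 \<le> u mod N" "u mod N < N" using N by auto
  have m: "(u + 1) mod N = (u mod N + 1) mod N" "(u - 1) mod N = (u mod N - 1) mod N"
    by (simp_all add: mod_simps)
  from ad consider "v = u mod N + 1" | "v = u mod N - 1" | "v = u mod N + 1 - N" | "v = u mod N - 1 + N"
    unfolding cyc_adj_def by linarith
  then show ?thesis
  proof cases
    case 1 then show ?thesis using m v by simp
  next
    case 2 then show ?thesis using m v by simp
  next
    case 3
    have "(u mod N + 1) mod N = (u mod N + 1 - N) mod N" by simp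
    also have "\<dots> = v" unfolding 3[symmetric] using v by simp
    finally show ?thesis using m by simp
  next
    case 4
    have "(u mod N - 1) mod N = (u mod N - 1 + N) mod N" by simp
    also have "\<dots> = v" unfolding 4[symmetric] using v by simp
    finally show ?thesis using m by simp
  qed
qed

context
  fixes N :: int and L :: nat
  assumes N: "2 * int L + 2 \<le> N"
begin

private lemma N2: "2 \<le> N"
  using N by linarith

lemma temb_tor: "temb N a z \<in> tor N"
  using N2 by (auto simp: temb_def tor_def split: prod.splits)

lemma box_diff: "(a, b, c) \<in> box L \<Longrightarrow> (a', b', c') \<in> box L \<Longrightarrow>
    \<bar>a - a'\<bar> \<le> N - 2 \<and> \<bar>b - b'\<bar> \<le> N - 2 \<and> \<bar>c - c'\<bar> \<le> N - 2"
  using N by (auto simp: box_iff)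

lemma inj_on_temb: "inj_on (temb N a) (box L)"
proof (rule inj_onI)
  fix x y assume xy: "x \<in> box L" "y \<in> box L" "temb N a x = temb N a y"
  obtain a1 a2 a3 x1 x2 x3 y1 y2 y3 where [simp]: "a = (a1, a2, a3)" "x = (x1, x2, x3)" "y = (y1, y2, y3)"
    by (cases a; cases x; cases y)
  from box_diff xy(1,2) have d: "\<bar>x1 - y1\<bar> \<le> N - 2" "\<bar>x2 - y2\<bar> \<le> N - 2" "\<bar>x3 - y3\<bar> \<le> N - 2" by auto
  from xy(3) show "x = y"
    by (simp add: temb_def cyc_mod_eq_iff(1)[OF N2 d(1)] cyc_mod_eq_iff(1)[OF N2 d(2)] cyc_mod_eq_iff(1)[OF N2 d(3)])
qed

lemma tcoupling_temb:
  assumes xy: "x \<in> box L" "y \<in> box L"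
  shows "tcoupling N \<beta> (temb N a x) (temb N a y) = \<beta> * coupling x y"
proof -
  obtain a1 a2 a3 x1 x2 x3 y1 y2 y3 where eqs: "a = (a1, a2, a3)" "x = (x1, x2, x3)" "y = (y1, y2, y3)"
    by (cases a; cases x; cases y)
  from box_diff xy eqs have d: "\<bar>x1 - y1\<bar> \<le> N - 2" "\<bar>x2 - y2\<bar> \<le> N - 2" "\<bar>x3 - y3\<bar> \<le> N - 2" by auto
  have "(temb N a x, temb N a y) \<in> tedge N \<longleftrightarrow> coupling x y \<noteq> 0"
    using temb_tor[of a x] temb_tor[of a y] unfolding eqs temb_def tedge_def
    by (simp add: coupling_eq cyc_mod_eq_iff[OF N2 d(1)] cyc_mod_eq_iff[OF N2 d(2)] cyc_mod_eq_iff[OF N2 d(3)])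
  then show ?thesis unfolding eqs by (auto simp: tcoupling_def coupling_eq)
qed

text \<open>The torus adds no neighbours to an interior site, so wiring outside the interior acts on
  it only through the box boundary; this supplies the vanishing couplings that
  \<open>wired_eq_plus\<close> asks for.\<close>

lemma tedge_temb_intr:
  assumes k: "k \<in> intr L" and e: "(temb N a k, v) \<in> tedge N"
  shows "v \<in> temb N a ` box L"
proof -
  obtain a1 a2 a3 k1 k2 k3 v1 v2 v3 where eqs: "a = (a1, a2, a3)" "k = (k1, k2, k3)" "v = (v1, v2, v3)"
    by (cases a; cases k; cases v)
  have kb: "\<bar>k1\<bar> < int L" "\<bar>k2\<bar> < int L" "\<bar>k3\<bar> < int L" using k eqs by (auto simp: intr_iff)
  have vb: "0 \<le> v1" "v1 < N" "0 \<le> v2" "v2 < N" "0 \<le> v3" "v3 < N"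
    using e eqs by (auto simp: tedge_def tor_def)
  from e consider
      "cyc_adj N ((a1 + k1) mod N) v1" "v2 = (a2 + k2) mod N" "v3 = (a3 + k3) mod N"
    | "cyc_adj N ((a2 + k2) mod N) v2" "v1 = (a1 + k1) mod N" "v3 = (a3 + k3) mod N"
    | "cyc_adj N ((a3 + k3) mod N) v3" "v1 = (a1 + k1) mod N" "v2 = (a2 + k2) mod N"
    unfolding eqs by (auto simp: tedge_def temb_def)
  then obtain l1 l2 l3 where "v = temb N a (l1, l2, l3)" "\<bar>l1 - k1\<bar> \<le> 1" "\<bar>l2 - k2\<bar> \<le> 1" "\<bar>l3 - k3\<bar> \<le> 1"
  proof cases
    case 1
    from cyc_adj_neighbour[OF N2 vb(1,2) 1(1)] 1(2,3) that[of "k1 + 1" k2 k3] that[of "k1 - 1" k2 k3]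
    show ?thesis unfolding eqs temb_def by (auto simp: algebra_simps)
  next
    case 2
    from cyc_adj_neighbour[OF N2 vb(3,4) 2(1)] 2(2,3) that[of k1 "k2 + 1" k3] that[of k1 "k2 - 1" k3]
    show ?thesis unfolding eqs temb_def by (auto simp: algebra_simps)
  next
    case 3
    from cyc_adj_neighbour[OF N2 vb(5,6) 3(1)] 3(2,3) that[of k1 k2 "k3 + 1"] that[of k1 k2 "k3 - 1"]
    show ?thesis unfolding eqs temb_def by (auto simp: algebra_simps)
  qed
  moreover from this kb have "(l1, l2, l3) \<in> box L" by (auto simp: box_iff)
  ultimately show ?thesis by blast
qed

text \<open>Everything outside the interior of a box centred at x is wired, y included. Then S_x .
  S_y compares the centre with the boundary value, which is the plus magnetization at the centre of
  that box.\<close>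

lemma torus_le_plus:
  assumes q: "odd q" and \<beta>: "0 \<le> \<beta>" and L: "L \<ge> 1" and x: "x \<in> tor N" and y: "y \<in> tor N - temb N x ` intr L"
  shows "wcorr q (tor N) (tcoupling N \<beta>) {} g x y \<le> plus_clock \<beta> L q"
proof -
  have q0: "q > 0" using q by (cases q) auto
  have x0: "temb N x (0, 0, 0) = x" using x by (auto simp: temb_def tor_def split: prod.splits)
  let ?W = "tor N - temb N x ` intr L"
  have sym: "tcoupling N \<beta> v w = tcoupling N \<beta> w v" for v w
    unfolding tcoupling_def using symD[OF sym_tedge[of N]] by metis
  have bx: "l \<in> box L" if "l \<in> intr L" for l using that box_split(1)[of L] by auto
  have "wcorr q (tor N) (tcoupling N \<beta>) {} g x y = wcorr q (tor N) (tcoupling N \<beta>) {} y x y"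
    by (rule wcorr_free_ground)
  also have "\<dots> \<le> wcorr q (tor N) (tcoupling N \<beta>) ?W y x y"
    by (rule wcorr_mono) (use q x y \<beta> in \<open>auto simp: tcoupling_def\<close>)
  also have "\<dots> = wcorr q (tor N) (tcoupling N \<beta>) ?W y (temb N x (0, 0, 0)) y" by (simp add: x0)
  also have "\<dots> = plus_clock \<beta> L q"
  proof (rule wired_eq_plus)
    show "temb N x ` box L \<subseteq> tor N" by (intro image_subsetI temb_tor)
    show "tcoupling N \<beta> (temb N x k) (temb N x l) = \<beta> * coupling k l \<and>
        tcoupling N \<beta> (temb N x l) (temb N x k) = \<beta> * coupling k l" if "k \<in> intr L" "l \<in> box L" for k l
      using tcoupling_temb[OF bx[OF that(1)] that(2)] sym by simp
    show "tcoupling N \<beta> (temb N x k) v = 0 \<and> tcoupling N \<beta> v (temb N x k) = 0"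
      if "k \<in> intr L" "v \<in> tor N - temb N x ` box L" for k v
    proof -
      have "tcoupling N \<beta> (temb N x k) v = 0"
        using tedge_temb_intr[OF that(1), of x v] that(2) by (auto simp: tcoupling_def)
      then show ?thesis using sym by metis
    qed
  qed (use q0 L y inj_on_temb in auto)
  finally show ?thesis .
qed

text \<open>The free box is the torus with all couplings not inside the embedded interior switched
  off; switching them on can only raise correlations.\<close>

lemma free_le_torus:
  assumes q: "odd q" and \<beta>: "0 \<le> \<beta>" and xy: "x \<in> intr L" "y \<in> intr L"
  shows "free_clock \<beta> L q x y \<le> wcorr q (tor N) (tcoupling N \<beta>) {} g (temb N a x) (temb N a y)"
proof -
  let ?e = "temb N a"
  have q0: "q > 0" using q by (cases q) auto
  have bx: "intr L \<subseteq> box L" using box_split(1)[of L] by auto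
  have inj: "inj_on ?e (intr L)" using inj_on_temb bx by (rule inj_on_subset)
  define J0 where "J0 v w = (if v \<in> ?e ` intr L \<and> w \<in> ?e ` intr L then tcoupling N \<beta> v w else 0)" for v w
  have "free_clock \<beta> L q x y = wcorr q (intr L) (\<lambda>k l. \<beta> * coupling k l) {} x x y"
    by (rule free_clock_eq_wcorr)
  also have "\<dots> = wcorr q (tor N) J0 {} (?e x) (?e x) (?e y)"
  proof (rule wcorr_embed[symmetric])
    show "?e ` intr L \<subseteq> tor N" by (intro image_subsetI temb_tor)
    show "J0 (?e k) (?e l) = \<beta> * coupling k l" if "k \<in> intr L" "l \<in> intr L" for k l
      using that bx tcoupling_temb[of k l \<beta> a] by (auto simp: J0_def)
  qed (use q0 inj xy in \<open>auto simp: J0_def\<close>)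
  also have "\<dots> \<le> wcorr q (tor N) (tcoupling N \<beta>) {} (?e x) (?e x) (?e y)"
    by (rule wcorr_mono) (use q temb_tor[of a x] temb_tor[of a y] \<beta> in \<open>auto simp: J0_def tcoupling_def\<close>)
  also have "\<dots> = wcorr q (tor N) (tcoupling N \<beta>) {} g (?e x) (?e y)" by (rule wcorr_free_ground)
  finally show ?thesis .
qed

end

lemma coupling_intr_outside: "k \<in> intr L \<Longrightarrow> l \<notin> box L \<Longrightarrow> coupling k l = 0"
  by (cases k; cases l) (auto simp: coupling_eq intr_iff box_iff)

text \<open>Both magnetizations are wired correlations in the same box, and the smaller interior has
  the larger wired set. The reference site (L + 1, 0, 0) lies outside both interiors.\<close>

lemma plus_clock_antimono:
  assumes q: "odd q" and \<beta>: "0 \<le> \<beta>" and L: "L \<ge> 1"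
  shows "plus_clock \<beta> (Suc L) q \<le> plus_clock \<beta> L q"
proof -
  have q0: "q > 0" using q by (cases q) auto
  let ?V = "box (Suc L)" and ?g = "(int (Suc L), 0, 0) :: site" and ?J = "\<lambda>k l. \<beta> * coupling k l"
  have eq: "wcorr q ?V ?J (?V - intr M) ?g (0, 0, 0) ?g = plus_clock \<beta> M q" if "1 \<le> M" "M \<le> Suc L" for M
  proof -
    have sub: "box M \<subseteq> ?V" using that by (auto simp: box_iff)
    have "wcorr q ?V ?J (?V - id ` intr M) ?g (id (0, 0, 0)) ?g = plus_clock \<beta> M q"
      by (rule wired_eq_plus)
        (use q0 that sub in \<open>auto simp: intr_iff box_iff coupling_sym coupling_intr_outside
            coupling_intr_outside[THEN trans[OF coupling_sym]]\<close>)
    then show ?thesis by simp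
  qed
  have "plus_clock \<beta> (Suc L) q = wcorr q ?V ?J (?V - intr (Suc L)) ?g (0, 0, 0) ?g"
    by (rule eq[symmetric]) auto
  also have "\<dots> \<le> wcorr q ?V ?J (?V - intr L) ?g (0, 0, 0) ?g"
    by (rule wcorr_mono) (use q \<beta> in \<open>auto simp: box_iff intr_iff coupling_nonneg\<close>)
  also have "\<dots> = plus_clock \<beta> L q" by (rule eq) (use L in auto)
  finally show ?thesis .
qed

lemma free_clock_mono:
  assumes q: "odd q" and \<beta>: "0 \<le> \<beta>" and xy: "x \<in> intr L" "y \<in> intr L"
  shows "free_clock \<beta> L q x y \<le> free_clock \<beta> (Suc L) q x y"
proof -
  have q0: "q > 0" using q by (cases q) auto
  have sub: "intr L \<subseteq> intr (Suc L)" by (auto simp: intr_iff)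
  let ?J = "\<lambda>k l. \<beta> * coupling k l"
  define J0 where "J0 v w = (if v \<in> intr L \<and> w \<in> intr L then ?J v w else 0)" for v w
  have "free_clock \<beta> L q x y = wcorr q (intr L) ?J {} x x y" by (rule free_clock_eq_wcorr)
  also have "\<dots> = wcorr q (intr (Suc L)) J0 {} x (id x) (id y)"
    by (rule wcorr_embed[symmetric]) (use q0 sub xy in \<open>auto simp: J0_def\<close>)
  also have "\<dots> \<le> wcorr q (intr (Suc L)) ?J {} x (id x) (id y)"
    by (rule wcorr_mono) (use q sub xy \<beta> in \<open>auto simp: J0_def coupling_nonneg\<close>)
  also have "\<dots> = free_clock \<beta> (Suc L) q x y" by (simp add: free_clock_eq_wcorr[where g = x])
  finally show ?thesis .
qed

section \<open>Averages over a cube: infrared bound plus zero mode\<close>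

lemma unif_tor: "unif n n n x = (if x \<in> tor n then 1 / real_of_int n ^ 3 else 0)"
proof -
  obtain a b c where x: "x = (a, b, c)" by (cases x)
  have "x \<in> tor n \<longleftrightarrow> 0 \<le> a \<and> a < n \<and> 0 \<le> b \<and> b < n \<and> 0 \<le> c \<and> c < n" by (auto simp: x tor_def)
  then show ?thesis by (simp add: x unif_def power3_eq_cube)
qed

text \<open>The infrared bound is applied to \<alpha> on the cube minus \<gamma> on the torus. The
  \<gamma>^2 term is nonnegative and dropped; the cross term is bounded by row sums, with
  correlations at most 1 near x and at most the plus magnetization elsewhere. The 432 is 144 / (2
  \<beta> / 6) up to \<beta>, and 144 = 12^2 comes from the flow.\<close>

lemma torus_average_bound:
  fixes a N :: int
  assumes q: "odd q" and \<beta>: "0 < \<beta>" and a: "1 \<le> a" and K: "1 \<le> K" and N: "N = a * 2 ^ K"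
    and l: "1 \<le> l" "2 * int l + 2 \<le> N" and g: "g \<in> tor N"
  shows "(\<Sum>x\<in>tor a. \<Sum>y\<in>tor a. wcorr q (tor N) (tcoupling N \<beta>) {} g x y) / (real_of_int a ^ 3)\<^sup>2
    \<le> 432 / (\<beta> * real_of_int a) + 2 * (real (card (intr l)) / real_of_int N ^ 3 + \<bar>plus_clock \<beta> l q\<bar>)"
proof -
  have q0: "q > 0" using q by (cases q) auto
  define G where "G = wcorr q (tor N) (tcoupling N \<beta>) {} g"
  define \<alpha> where "\<alpha> = 1 / real_of_int a ^ 3"
  define \<gamma> where "\<gamma> = 1 / real_of_int N ^ 3"
  define M where "M = a * 2 ^ (K - 1)"
  have "(1 :: int) \<le> 2 ^ K" by simp
  then have aN: "a \<le> N" using N a mult_left_mono[of 1 "2 ^ K" a] by simp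
  \<comment> \<open>At least one doubling makes the side even, as the reflections require.\<close>
  have NM: "N = 2 * M" using N K by (cases K) (auto simp: M_def)
  have M1: "1 \<le> M" using NM a aN by linarith
  have sub: "tor a \<subseteq> tor N" using aN by (auto simp: tor_def)
  have card_tor: "real (card (tor n)) = real_of_int n ^ 3" if "0 \<le> n" for n
    using that by (simp add: tor_def card_cartesian_product power3_eq_cube)
  have pos: "0 < real_of_int a" "0 < real_of_int N" using a aN by auto
  have \<alpha>0: "0 \<le> \<alpha>" and \<gamma>0: "0 \<le> \<gamma>" using pos by (auto simp: \<alpha>_def \<gamma>_def)
  have "has_flow N (\<lambda>x. unif a a a x - unif (a * 2 ^ K) (a * 2 ^ K) (a * 2 ^ K) x)
      (12 / sqrt (real_of_int a) * (1 - (1 / sqrt 2) ^ K))"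
    by (rule has_flow_dyadic) (use a N in auto)
  then obtain h where anti: "antisym_field (tedge N) h"
    and divh: "\<And>x. x \<in> tor N \<Longrightarrow> unif a a a x - unif N N N x = (\<Sum>y | (x, y) \<in> tedge N. h (x, y))"
    and L2: "L2_set h (tedge N) \<le> 12 / sqrt (real_of_int a) * (1 - (1 / sqrt 2) ^ K)"
    unfolding has_flow_def N[symmetric] by blast
  have "L2_set h (tedge N) \<le> 12 / sqrt (real_of_int a)"
    by (rule order_trans[OF L2 mult_left_le]) (use pos in auto)
  then have "(L2_set h (tedge N))\<^sup>2 \<le> (12 / sqrt (real_of_int a))\<^sup>2"
    by (intro power_mono L2_set_nonneg)
  then have h2: "(\<Sum>e\<in>tedge N. (h e)\<^sup>2) \<le> 144 / real_of_int a"
    using pos by (simp add: L2_set_def power_divide sum_nonneg)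
  let ?d = "\<lambda>x. unif a a a x - unif N N N x"
  have tJ: "(\<lambda>x y. if (x, y) \<in> tedge N then \<beta> / 6 else 0) = tcoupling N \<beta>" by (simp add: tcoupling_def)
  have "(\<Sum>x\<in>tor N. \<Sum>y\<in>tor N. ?d x * ?d y * G x y) \<le> (\<Sum>e\<in>tedge N. (h e)\<^sup>2) / (2 * (\<beta> / 6))"
    unfolding G_def tJ[symmetric]
    by (rule infrared_bound[OF finite_tor q0 tedge_subset sym_tedge _ torus_reflection[OF NM M1] anti g divh])
      (use \<beta> in auto)
  also have "\<dots> \<le> (144 / real_of_int a) / (2 * (\<beta> / 6))"
    using h2 \<beta> by (intro divide_right_mono) auto
  also have "\<dots> = 432 / (\<beta> * real_of_int a)" by simp
  finally have IR: "(\<Sum>x\<in>tor N. \<Sum>y\<in>tor N. ?d x * ?d y * G x y) \<le> 432 / (\<beta> * real_of_int a)" .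
  have d: "?d x = (if x \<in> tor a then \<alpha> else 0) - \<gamma>" if "x \<in> tor N" for x
    using that unif_tor[of a x] unif_tor[of N x] by (simp add: \<alpha>_def \<gamma>_def)
  define R where "R x = (\<Sum>y\<in>tor N. G x y)" for x
  have Gsym: "G x y = G y x" for x y unfolding G_def by (rule wcorr_sym)
  have ind: "(\<Sum>x\<in>tor N. (if x \<in> tor a then \<alpha> else 0) * f x) = \<alpha> * (\<Sum>x\<in>tor a. f x)" for f
  proof -
    have "(\<Sum>x\<in>tor N. (if x \<in> tor a then \<alpha> else 0) * f x) = (\<Sum>x\<in>tor a. \<alpha> * f x)"
      by (rule sum.mono_neutral_cong_right) (use sub in auto)
    then show ?thesis by (simp add: sum_distrib_left)
  qed
  have "(\<Sum>x\<in>tor N. \<Sum>y\<in>tor N. ?d x * ?d y * G x y)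
      = (\<Sum>x\<in>tor N. ?d x * (\<alpha> * (\<Sum>y\<in>tor a. G x y) - \<gamma> * R x))"
  proof (intro sum.cong refl)
    fix x assume "x \<in> tor N"
    have "(\<Sum>y\<in>tor N. ?d y * G x y) = (\<Sum>y\<in>tor N. (if y \<in> tor a then \<alpha> else 0) * G x y - \<gamma> * G x y)"
      by (intro sum.cong refl) (simp add: d left_diff_distrib)
    also have "\<dots> = \<alpha> * (\<Sum>y\<in>tor a. G x y) - \<gamma> * R x"
      unfolding sum_subtractf ind R_def sum_distrib_left ..
    finally show "(\<Sum>y\<in>tor N. ?d x * ?d y * G x y) = ?d x * (\<alpha> * (\<Sum>y\<in>tor a. G x y) - \<gamma> * R x)"
      by (simp add: sum_distrib_left[symmetric] mult.assoc)
  qed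
  also have "\<dots> = (\<Sum>x\<in>tor N. (if x \<in> tor a then \<alpha> else 0) * (\<alpha> * (\<Sum>y\<in>tor a. G x y) - \<gamma> * R x)
      - \<gamma> * (\<alpha> * (\<Sum>y\<in>tor a. G x y) - \<gamma> * R x))"
    by (intro sum.cong refl) (simp add: d left_diff_distrib)
  also have "\<dots> = \<alpha> * (\<Sum>x\<in>tor a. \<alpha> * (\<Sum>y\<in>tor a. G x y) - \<gamma> * R x)
      - \<gamma> * (\<Sum>x\<in>tor N. \<alpha> * (\<Sum>y\<in>tor a. G x y) - \<gamma> * R x)"
    unfolding sum_subtractf[of "\<lambda>x. (if x \<in> tor a then \<alpha> else 0) * (\<alpha> * (\<Sum>y\<in>tor a. G x y) - \<gamma> * R x)"] ind
    by (simp only: sum_distrib_left)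
  also have "\<dots> = \<alpha>\<^sup>2 * (\<Sum>x\<in>tor a. \<Sum>y\<in>tor a. G x y) - \<alpha> * \<gamma> * (\<Sum>x\<in>tor a. R x)
      - \<gamma> * \<alpha> * (\<Sum>x\<in>tor N. \<Sum>y\<in>tor a. G x y) + \<gamma>\<^sup>2 * (\<Sum>x\<in>tor N. R x)"
    by (simp add: sum_subtractf sum_distrib_left[symmetric] algebra_simps power2_eq_square)
  also have "(\<Sum>x\<in>tor N. \<Sum>y\<in>tor a. G x y) = (\<Sum>x\<in>tor a. R x)"
    unfolding R_def by (subst sum.swap) (simp add: Gsym)
  finally have expand: "(\<Sum>x\<in>tor N. \<Sum>y\<in>tor N. ?d x * ?d y * G x y) = \<alpha>\<^sup>2 * (\<Sum>x\<in>tor a. \<Sum>y\<in>tor a. G x y)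
      - 2 * \<alpha> * \<gamma> * (\<Sum>x\<in>tor a. R x) + \<gamma>\<^sup>2 * (\<Sum>x\<in>tor N. R x)" by simp
  have "0 \<le> (\<Sum>x\<in>tor N. R x)"
    unfolding R_def G_def by (rule sum_sum_wcorr_nonneg) (use q0 g in auto)
  then have RN: "0 \<le> \<gamma>\<^sup>2 * (\<Sum>x\<in>tor N. R x)" by simp
  define m where "m = \<bar>plus_clock \<beta> l q\<bar>"
  have row: "R x \<le> real (card (intr l)) + real_of_int N ^ 3 * m" if x: "x \<in> tor N" for x
  proof -
    let ?I = "temb N x ` intr l"
    have I: "?I \<subseteq> tor N" by (intro image_subsetI temb_tor[OF l(2)])
    have "R x = sum (G x) (tor N - ?I) + sum (G x) ?I"
      unfolding R_def using I by (intro sum.subset_diff) auto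
    also have "sum (G x) ?I \<le> (\<Sum>y\<in>?I. 1)"
      unfolding G_def by (intro sum_mono wcorr_le_1) (use q0 g in auto)
    also have "(\<Sum>y\<in>?I. 1) \<le> real (card (intr l))" by (simp add: card_image_le)
    also have "sum (G x) (tor N - ?I) \<le> (\<Sum>y\<in>tor N - ?I. m)"
    proof (rule sum_mono)
      fix y assume "y \<in> tor N - ?I"
      then have "G x y \<le> plus_clock \<beta> l q"
        unfolding G_def using torus_le_plus[OF l(2) q less_imp_le[OF \<beta>] l(1) x] by blast
      then show "G x y \<le> m" by (simp add: m_def)
    qed
    also have "(\<Sum>y\<in>tor N - ?I. m) \<le> (\<Sum>y\<in>tor N. m)"
      by (rule sum_mono2) (auto simp: m_def)
    also have "\<dots> = real_of_int N ^ 3 * m" using card_tor[of N] pos by simp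
    finally show ?thesis by simp
  qed
  have "(\<Sum>x\<in>tor a. R x) \<le> (\<Sum>x\<in>tor a. real (card (intr l)) + real_of_int N ^ 3 * m)"
    by (rule sum_mono) (use row sub in blast)
  also have "\<dots> = real_of_int a ^ 3 * (real (card (intr l)) + real_of_int N ^ 3 * m)"
    using card_tor[of a] pos by simp
  finally have "2 * \<alpha> * \<gamma> * (\<Sum>x\<in>tor a. R x)
      \<le> 2 * \<alpha> * \<gamma> * (real_of_int a ^ 3 * (real (card (intr l)) + real_of_int N ^ 3 * m))"
    using \<alpha>0 \<gamma>0 by (intro mult_left_mono) auto
  also have "\<dots> = 2 * (real (card (intr l)) / real_of_int N ^ 3 + m)"
    using pos by (simp add: \<alpha>_def \<gamma>_def field_simps)
  finally have "\<alpha>\<^sup>2 * (\<Sum>x\<in>tor a. \<Sum>y\<in>tor a. G x y) \<le> 432 / (\<beta> * real_of_int a)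
      + 2 * (real (card (intr l)) / real_of_int N ^ 3 + m)"
    using IR RN unfolding expand by linarith
  then show ?thesis unfolding G_def m_def \<alpha>_def by (simp add: power_divide)
qed

lemma card_box: "real (card (box n)) = real_of_int (2 * int n + 1) ^ 3"
proof -
  have "box n = {- int n..int n} \<times> {- int n..int n} \<times> {- int n..int n}"
    by (auto simp: box_iff)
  then show ?thesis by (simp add: card_cartesian_product power3_eq_cube)
qed

text \<open>The flow starts from a cube in the corner of the torus, so the shift (n, n, n) carries
  \<open>box n\<close> onto {0..2 n}^3, the cube of side 2 n + 1.\<close>

lemma free_average_bound:
  assumes q: "odd q" and \<beta>: "0 < \<beta>" and K: "1 \<le> K" and N: "N = (2 * int n + 1) * 2 ^ K" and nL: "n < L"
    and l: "1 \<le> l" "2 * int l + 2 \<le> N" and L: "2 * int L + 2 \<le> N"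
  shows "(1 / real (card (box n)) ^ 2) * (\<Sum>x\<in>box n. \<Sum>y\<in>box n. free_clock \<beta> L q x y)
    \<le> 432 / (\<beta> * real (2 * n + 1)) + 2 * (real (card (intr l)) / real_of_int N ^ 3 + \<bar>plus_clock \<beta> l q\<bar>)"
proof -
  let ?a = "2 * int n + 1" and ?s = "(int n, int n, int n)"
  let ?G = "wcorr q (tor N) (tcoupling N \<beta>) {} (temb N ?s ?s)"
  have sub: "box n \<subseteq> intr L" using nL by (auto simp: box_iff intr_iff)
  have "(1 :: int) \<le> 2 ^ K" by simp
  then have aN: "?a \<le> N" using N mult_left_mono[of 1 "2 ^ K" ?a] by simp
  have bij: "bij_betw (temb N ?s) (box n) (tor ?a)"
  proof (rule bij_betw_byWitness[where f' = "\<lambda>(x, y, z). (x - int n, y - int n, z - int n)"])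
    show "\<forall>z\<in>box n. (case temb N ?s z of (x, y, z) \<Rightarrow> (x - int n, y - int n, z - int n)) = z"
      using aN by (auto simp: temb_def box_iff)
    show "\<forall>z\<in>tor ?a. temb N ?s (case z of (x, y, z) \<Rightarrow> (x - int n, y - int n, z - int n)) = z"
      using aN by (auto simp: temb_def tor_def)
    show "temb N ?s ` box n \<subseteq> tor ?a" using aN by (auto simp: temb_def tor_def box_iff)
    show "(\<lambda>(x, y, z). (x - int n, y - int n, z - int n)) ` tor ?a \<subseteq> box n"
      by (auto simp: tor_def box_iff)
  qed
  have "(\<Sum>x\<in>box n. \<Sum>y\<in>box n. free_clock \<beta> L q x y)
      \<le> (\<Sum>x\<in>box n. \<Sum>y\<in>box n. ?G (temb N ?s x) (temb N ?s y))"
    by (intro sum_mono free_le_torus[OF L q less_imp_le[OF \<beta>]]) (use sub in blast)+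
  also have "\<dots> = (\<Sum>x\<in>box n. \<Sum>y\<in>tor ?a. ?G (temb N ?s x) y)"
    by (intro sum.cong refl sum.reindex_bij_betw[OF bij])
  also have "\<dots> = (\<Sum>x\<in>tor ?a. \<Sum>y\<in>tor ?a. ?G x y)"
    by (rule sum.reindex_bij_betw[OF bij])
  finally have "(1 / real (card (box n)) ^ 2) * (\<Sum>x\<in>box n. \<Sum>y\<in>box n. free_clock \<beta> L q x y)
     \<le> (1 / real (card (box n)) ^ 2) * (\<Sum>x\<in>tor ?a. \<Sum>y\<in>tor ?a. ?G x y)"
    by (intro mult_left_mono) auto
  also have "\<dots> = (\<Sum>x\<in>tor ?a. \<Sum>y\<in>tor ?a. ?G x y) / (real_of_int ?a ^ 3)\<^sup>2"
    unfolding card_box by simp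
  also have "\<dots> \<le> 432 / (\<beta> * real_of_int ?a) + 2 * (real (card (intr l)) / real_of_int N ^ 3 + \<bar>plus_clock \<beta> l q\<bar>)"
    by (rule torus_average_bound[OF q \<beta> _ K N l temb_tor[OF L]]) simp
  finally show ?thesis by (simp add: add.commute)
qed

section \<open>Riemann sums and the continuum limit of the clock model\<close>

abbreviation arc :: "real measure" where
  "arc \<equiv> restrict_space lborel {0..2 * pi}"

text \<open>The minimum puts the endpoint t = 2 pi into the last cell, where the floor alone would
  give q.\<close>

definition round_angle :: "nat \<Rightarrow> real \<Rightarrow> int" where
  "round_angle q t = min \<lfloor>t * real q / (2 * pi)\<rfloor> (int q - 1)"

lemma round_angle_range:
  assumes "q > 0" "0 \<le> t"
  shows "round_angle q t \<in> {0..<int q}"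
  using assms by (auto simp: round_angle_def)

lemma round_angle_error:
  assumes q: "q > 0" and t: "0 \<le> t" "t \<le> 2 * pi"
  shows "\<bar>2 * pi / real q * real_of_int (round_angle q t) - t\<bar> \<le> 2 * pi / real q"
proof -
  define u where "u = t * real q / (2 * pi)"
  have tu: "t = 2 * pi / real q * u" using q by (simp add: u_def)
  have u: "u \<le> real q" using t q by (simp add: u_def field_simps)
  have "\<bar>real_of_int (round_angle q t) - u\<bar> \<le> 1"
    using u unfolding round_angle_def u_def[symmetric] by (simp add: min_def) linarith
  then have "2 * pi / real q * \<bar>real_of_int (round_angle q t) - u\<bar> \<le> 2 * pi / real q * 1"
    by (intro mult_left_mono) auto
  moreover have "2 * pi / real q * \<bar>real_of_int (round_angle q t) - u\<bar>
      = \<bar>2 * pi / real q * real_of_int (round_angle q t) - t\<bar>"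
    unfolding tu by (simp add: right_diff_distrib[symmetric] abs_mult del: times_divide_eq_left)
  ultimately show ?thesis by simp
qed

lemma round_angle_fibre:
  assumes q: "q > 0" and k: "k \<in> {0..<int q}"
  shows "{t \<in> {0..2 * pi}. round_angle q t = k} =
    (if k = int q - 1 then {2 * pi / real q * real_of_int k..2 * pi}
     else {2 * pi / real q * real_of_int k..<2 * pi / real q * real_of_int (k + 1)})"
proof (rule set_eqI)
  fix t
  define u where "u = t * real q / (2 * pi)"
  have tu: "t = 2 * pi / real q * u" using q by (simp add: u_def)
  have w: "0 < 2 * pi / real q" using q by simp
  have le: "2 * pi / real q * a \<le> t \<longleftrightarrow> a \<le> u" "t < 2 * pi / real q * a \<longleftrightarrow> u < a"
    "t \<le> 2 * pi / real q * a \<longleftrightarrow> u \<le> a" for a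
    unfolding tu using mult_le_cancel_left_pos[OF w] mult_less_cancel_left_pos[OF w] by simp_all
  have t0: "0 \<le> t \<longleftrightarrow> 0 \<le> u" using le(1)[of 0] by simp
  have t1: "t \<le> 2 * pi \<longleftrightarrow> u \<le> real q"
    using le(3)[of "real q"] q by simp
  have k': "0 \<le> real_of_int k" "real_of_int k + 1 \<le> real q" using k by auto
  show "t \<in> {t \<in> {0..2 * pi}. round_angle q t = k} \<longleftrightarrow>
      t \<in> (if k = int q - 1 then {2 * pi / real q * real_of_int k..2 * pi}
     else {2 * pi / real q * real_of_int k..<2 * pi / real q * real_of_int (k + 1)})"
  proof (cases "k = int q - 1")
    case True
    then have "round_angle q t = k \<longleftrightarrow> k \<le> \<lfloor>u\<rfloor>"
      unfolding round_angle_def u_def[symmetric] by (auto simp: min_def)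
    then have "round_angle q t = k \<longleftrightarrow> real_of_int k \<le> u" by (simp only: le_floor_iff)
    then show ?thesis
      unfolding if_P[OF True] mem_Collect_eq atLeastAtMost_iff le t0 t1 using k' by auto
  next
    case False
    then have "k < int q - 1" using k by auto
    then have "round_angle q t = k \<longleftrightarrow> \<lfloor>u\<rfloor> = k"
      unfolding round_angle_def u_def[symmetric] by (auto simp: min_def)
    then have "round_angle q t = k \<longleftrightarrow> real_of_int k \<le> u \<and> u < real_of_int k + 1"
      by (simp only: floor_eq_iff)
    then show ?thesis
      unfolding if_not_P[OF False] mem_Collect_eq atLeastAtMost_iff atLeastLessThan_iff le t0 t1 using k' by auto
  qed
qed

lemma emeasure_round_angle_fibre:
  assumes q: "q > 0" and k: "k \<in> {0..<int q}"
  shows "{t \<in> {0..2 * pi}. round_angle q t = k} \<in> sets arc"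
    and "emeasure arc {t \<in> {0..2 * pi}. round_angle q t = k} = ennreal (2 * pi / real q)"
proof -
  let ?A = "{t \<in> {0..2 * pi}. round_angle q t = k}"
  have A: "?A \<in> sets lborel" unfolding round_angle_fibre[OF q k] by auto
  then show "?A \<in> sets arc" by (subst sets_restrict_space_iff) auto
  have "emeasure arc ?A = emeasure lborel ?A"
    using A by (intro emeasure_restrict_space) auto
  also have "\<dots> = ennreal (2 * pi / real q)"
  proof (cases "k = int q - 1")
    case True
    then have rk: "real_of_int k = real q - 1" by simp
    have "2 * pi / real q * real_of_int k \<le> 2 * pi" using q by (simp add: rk field_simps)
    moreover have "2 * pi - 2 * pi / real q * real_of_int k = 2 * pi / real q"
      using q by (simp add: rk field_simps)
    ultimately show ?thesis unfolding round_angle_fibre[OF q k] using True by simp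
  next
    case False
    have "2 * pi / real q * real_of_int k \<le> 2 * pi / real q * real_of_int (k + 1)"
      by (intro mult_left_mono) auto
    moreover have "2 * pi / real q * real_of_int (k + 1) - 2 * pi / real q * real_of_int k = 2 * pi / real q"
      by (simp add: right_diff_distrib[symmetric] del: times_divide_eq_left)
    ultimately show ?thesis unfolding round_angle_fibre[OF q k] using False
      by (simp del: times_divide_eq_left of_int_add)
  qed
  finally show "emeasure arc ?A = ennreal (2 * pi / real q)" .
qed

lemma finite_measure_arc: "finite_measure arc"
  by (rule finite_measureI) (simp add: emeasure_restrict_space space_restrict_space)

lemma space_arc: "space arc = {0..2 * pi}"
  by (simp add: space_restrict_space)

lemma finite_measure_PiM_arc:
  assumes "finite I"
  shows "finite_measure (PiM I (\<lambda>_. arc))"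
proof (rule finite_measureI)
  interpret product_sigma_finite "\<lambda>_. arc"
    unfolding product_sigma_finite_def
    using finite_measure.axioms(1)[OF finite_measure_arc] by blast
  have "emeasure (PiM I (\<lambda>_. arc)) (space (PiM I (\<lambda>_. arc))) = (\<Prod>i\<in>I. emeasure arc (space arc))"
    unfolding space_PiM by (rule emeasure_PiM[OF assms]) (rule sets.top)
  also have "\<dots> \<noteq> \<infinity>"
    using finite_measure.emeasure_finite[OF finite_measure_arc]
    by (simp add: ennreal_prod_eq_top power_eq_top_ennreal)
  finally show "emeasure (PiM I (\<lambda>_. arc)) (space (PiM I (\<lambda>_. arc))) \<noteq> \<infinity>" .
qed

text \<open>After rounding, F is constant on product cells of equal volume, so its integral is
  exactly the Riemann sum. No quadrature error has to be estimated: the continuum limit becomes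
  dominated convergence.\<close>

lemma integral_round_angle:
  fixes F :: "(site \<Rightarrow> real) \<Rightarrow> real"
  assumes I: "finite I" and q: "q > 0"
    and loc: "\<And>\<theta> \<theta>'. (\<And>i. i \<in> I \<Longrightarrow> \<theta> i = \<theta>' i) \<Longrightarrow> F \<theta> = F \<theta>'"
  defines "s \<equiv> \<lambda>\<theta>. F (\<lambda>i. 2 * pi / real q * real_of_int (round_angle q (\<theta> i)))"
  shows "s \<in> borel_measurable (PiM I (\<lambda>_. arc))"
    and "integral\<^sup>L (PiM I (\<lambda>_. arc)) s =
      (2 * pi / real q) ^ card I * (\<Sum>\<phi>\<in>conf q I. F (\<lambda>i. 2 * pi / real q * real_of_int (\<phi> i)))"
proof -
  interpret product_sigma_finite "\<lambda>_. arc"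
    unfolding product_sigma_finite_def
    using finite_measure.axioms(1)[OF finite_measure_arc] by blast
  let ?M = "PiM I (\<lambda>_. arc)"
  interpret fm: finite_measure ?M by (rule finite_measure_PiM_arc) fact
  let ?A = "\<lambda>\<phi>. PiE I (\<lambda>i. {t \<in> {0..2 * pi}. round_angle q t = \<phi> i})"
  let ?f = "\<lambda>\<phi>. F (\<lambda>i. 2 * pi / real q * real_of_int (\<phi> i))"
  have mem: "\<phi> i \<in> {0..<int q}" if "\<phi> \<in> conf q I" "i \<in> I" for \<phi> i
    using that by (auto simp: conf_def dest: PiE_mem)
  have setA: "?A \<phi> \<in> sets ?M" if "\<phi> \<in> conf q I" for \<phi>
    using I by (intro sets_PiM_I_finite emeasure_round_angle_fibre(1) q mem[OF that])
  have measA: "measure ?M (?A \<phi>) = (2 * pi / real q) ^ card I" if "\<phi> \<in> conf q I" for \<phi>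
  proof -
    have "emeasure ?M (?A \<phi>) = (\<Prod>i\<in>I. ennreal (2 * pi / real q))"
      using emeasure_round_angle_fibre[OF q mem[OF that]]
      by (subst emeasure_PiM[OF I]) (blast, intro prod.cong refl)
    also have "\<dots> = ennreal ((2 * pi / real q) ^ card I)" by (simp add: ennreal_power)
    finally show ?thesis by (simp add: measure_def)
  qed
  have s_eq: "s \<theta> = (\<Sum>\<phi>\<in>conf q I. ?f \<phi> * indicator (?A \<phi>) \<theta>)" if \<theta>: "\<theta> \<in> space ?M" for \<theta>
  proof -
    have \<theta>I: "0 \<le> \<theta> i" "\<theta> i \<le> 2 * pi" if "i \<in> I" for i
      using \<theta> that by (auto simp: space_PiM space_arc dest: PiE_mem)
    have \<theta>e: "\<theta> \<in> extensional I" using \<theta> by (auto simp: space_PiM PiE_def)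
    define \<phi>0 where "\<phi>0 = (\<lambda>i\<in>I. round_angle q (\<theta> i))"
    have \<phi>0: "\<phi>0 \<in> conf q I"
      unfolding conf_def \<phi>0_def using round_angle_range[OF q \<theta>I(1)] by auto
    have ind: "\<theta> \<in> ?A \<phi> \<longleftrightarrow> \<phi> = \<phi>0" if "\<phi> \<in> conf q I" for \<phi>
    proof
      assume "\<theta> \<in> ?A \<phi>"
      then have "\<phi> i = \<phi>0 i" if "i \<in> I" for i using that by (auto simp: \<phi>0_def dest: PiE_mem)
      then show "\<phi> = \<phi>0"
        using \<open>\<phi> \<in> conf q I\<close> \<phi>0 unfolding conf_def by (intro PiE_ext)
    next
      assume "\<phi> = \<phi>0"
      then show "\<theta> \<in> ?A \<phi>" using \<theta>I \<theta>e by (auto simp: \<phi>0_def PiE_def)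
    qed
    have "(\<Sum>\<phi>\<in>conf q I. ?f \<phi> * indicator (?A \<phi>) \<theta>) = (\<Sum>\<phi>\<in>conf q I. if \<phi> = \<phi>0 then ?f \<phi>0 else 0)"
    proof (intro sum.cong refl)
      fix \<phi> assume "\<phi> \<in> conf q I"
      then show "?f \<phi> * indicator (?A \<phi>) \<theta> = (if \<phi> = \<phi>0 then ?f \<phi>0 else 0)"
        by (simp only: indicator_def ind) simp
    qed
    also have "\<dots> = ?f \<phi>0" using I \<phi>0 by simp
    also have "\<dots> = s \<theta>" unfolding s_def by (rule loc) (simp add: \<phi>0_def)
    finally show ?thesis by simp
  qed
  have "(\<lambda>\<theta>. \<Sum>\<phi>\<in>conf q I. ?f \<phi> * indicator (?A \<phi>) \<theta>) \<in> borel_measurable ?M"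
    using setA by (intro borel_measurable_sum borel_measurable_times borel_measurable_indicator) auto
  then show "s \<in> borel_measurable ?M"
    using s_eq by (subst measurable_cong[where g = "\<lambda>\<theta>. \<Sum>\<phi>\<in>conf q I. ?f \<phi> * indicator (?A \<phi>) \<theta>"]) auto
  have "integral\<^sup>L ?M s = integral\<^sup>L ?M (\<lambda>\<theta>. \<Sum>\<phi>\<in>conf q I. ?f \<phi> * indicator (?A \<phi>) \<theta>)"
    using s_eq by (intro Bochner_Integration.integral_cong) auto
  also have "\<dots> = (\<Sum>\<phi>\<in>conf q I. integral\<^sup>L ?M (\<lambda>\<theta>. ?f \<phi> * indicator (?A \<phi>) \<theta>))"
    using setA
    by (intro Bochner_Integration.integral_sum integrable_mult_right integrable_real_indicator)
      (auto simp: fm.emeasure_finite less_top[symmetric])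
  also have "\<dots> = (\<Sum>\<phi>\<in>conf q I. ?f \<phi> * (2 * pi / real q) ^ card I)"
  proof (intro sum.cong refl)
    fix \<phi> assume \<phi>: "\<phi> \<in> conf q I"
    have "integral\<^sup>L ?M (\<lambda>\<theta>. ?f \<phi> * indicator (?A \<phi>) \<theta>) = ?f \<phi> * measure ?M (?A \<phi>)"
      using setA[OF \<phi>] by simp
    then show "integral\<^sup>L ?M (\<lambda>\<theta>. ?f \<phi> * indicator (?A \<phi>) \<theta>) = ?f \<phi> * (2 * pi / real q) ^ card I"
      by (simp only: measA[OF \<phi>])
  qed
  finally show "integral\<^sup>L ?M s = (2 * pi / real q) ^ card I * (\<Sum>\<phi>\<in>conf q I. ?f \<phi>)"
    by (simp add: sum_distrib_left mult.commute)
qed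

text \<open>Rounded angles converge in each coordinate of I, and continuity of F is assumed for just
  such sequences, which avoids a topology on the function space.\<close>

lemma Riemann_sum_tendsto:
  fixes F :: "(site \<Rightarrow> real) \<Rightarrow> real"
  assumes I: "finite I" and meas: "F \<in> borel_measurable (PiM I (\<lambda>_. arc))" and bd: "\<And>\<theta>. \<bar>F \<theta>\<bar> \<le> B"
    and loc: "\<And>\<theta> \<theta>'. (\<And>i. i \<in> I \<Longrightarrow> \<theta> i = \<theta>' i) \<Longrightarrow> F \<theta> = F \<theta>'"
    and cont: "\<And>\<theta>n \<theta>. (\<And>i. i \<in> I \<Longrightarrow> (\<lambda>n::nat. \<theta>n n i) \<longlonglongrightarrow> \<theta> i) \<Longrightarrow> (\<lambda>n. F (\<theta>n n)) \<longlonglongrightarrow> F \<theta>"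
    and q: "\<And>n. 0 < q n" "filterlim q at_top sequentially"
  shows "(\<lambda>n. (2 * pi / real (q n)) ^ card I * (\<Sum>\<phi>\<in>conf (q n) I. F (\<lambda>i. 2 * pi / real (q n) * real_of_int (\<phi> i))))
    \<longlonglongrightarrow> integral\<^sup>L (PiM I (\<lambda>_. arc)) F"
proof -
  let ?M = "PiM I (\<lambda>_. arc)"
  interpret fm: finite_measure ?M by (rule finite_measure_PiM_arc) fact
  let ?s = "\<lambda>n \<theta>. F (\<lambda>i. 2 * pi / real (q n) * real_of_int (round_angle (q n) (\<theta> i)))"
  have lim0: "(\<lambda>n. 2 * pi / real (q n)) \<longlonglongrightarrow> 0"
    by (intro tendsto_divide_0[OF tendsto_const] filterlim_at_top_imp_at_infinity
        filterlim_compose[OF filterlim_real_sequentially q(2)])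
  have "(\<lambda>n. integral\<^sup>L ?M (?s n)) \<longlonglongrightarrow> integral\<^sup>L ?M F"
  proof (rule integral_dominated_convergence[where w = "\<lambda>_. B"])
    show "?s n \<in> borel_measurable ?M" for n
      using I q(1) loc by (rule integral_round_angle(1))
    show "AE \<theta> in ?M. (\<lambda>n. ?s n \<theta>) \<longlonglongrightarrow> F \<theta>"
    proof (rule AE_I2, rule cont)
      fix \<theta> i assume "\<theta> \<in> space ?M" and i: "i \<in> I"
      then have t: "0 \<le> \<theta> i" "\<theta> i \<le> 2 * pi" by (auto simp: space_PiM space_arc dest: PiE_mem)
      show "(\<lambda>n. 2 * pi / real (q n) * real_of_int (round_angle (q n) (\<theta> i))) \<longlonglongrightarrow> \<theta> i"
        by (rule LIM_zero_cancel, rule Lim_null_comparison[OF _ lim0])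
          (use round_angle_error[OF q(1) t] in simp)
    qed
  qed (use meas bd in auto)
  moreover have "integral\<^sup>L ?M (?s n) = (2 * pi / real (q n)) ^ card I *
      (\<Sum>\<phi>\<in>conf (q n) I. F (\<lambda>i. 2 * pi / real (q n) * real_of_int (\<phi> i)))" for n
    using I q(1) loc by (rule integral_round_angle(2))
  ultimately show ?thesis by simp
qed

text \<open>What the Riemann-sum limit uses, in a form stable under the sums, products and
  exponentials that build exp (- \<beta> H) F.\<close>

definition regular_obs :: "nat \<Rightarrow> ((site \<Rightarrow> real) \<Rightarrow> real) \<Rightarrow> bool" where
  "regular_obs L F \<longleftrightarrow> F \<in> borel_measurable (angle_measure L) \<and> (\<exists>B. \<forall>\<theta>. \<bar>F \<theta>\<bar> \<le> B) \<and>
    (\<forall>\<theta> \<theta>'. (\<forall>i\<in>intr L. \<theta> i = \<theta>' i) \<longrightarrow> F \<theta> = F \<theta>') \<and>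
    (\<forall>\<theta>n \<theta>. (\<forall>i\<in>intr L. (\<lambda>n::nat. \<theta>n n i) \<longlonglongrightarrow> \<theta> i) \<longrightarrow> (\<lambda>n. F (\<theta>n n)) \<longlonglongrightarrow> F \<theta>)"

lemma regular_obsI:
  assumes "F \<in> borel_measurable (angle_measure L)" "\<And>\<theta>. \<bar>F \<theta>\<bar> \<le> B"
    "\<And>\<theta> \<theta>'. \<forall>i\<in>intr L. \<theta> i = \<theta>' i \<Longrightarrow> F \<theta> = F \<theta>'"
    "\<And>\<theta>n \<theta>. \<forall>i\<in>intr L. (\<lambda>n::nat. \<theta>n n i) \<longlonglongrightarrow> \<theta> i \<Longrightarrow> (\<lambda>n. F (\<theta>n n)) \<longlonglongrightarrow> F \<theta>"
  shows "regular_obs L F"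
  unfolding regular_obs_def
proof (intro conjI allI impI)
  show "\<exists>B. \<forall>\<theta>. \<bar>F \<theta>\<bar> \<le> B" using assms(2) by blast
qed (fact assms(1), erule assms(3), erule assms(4))

lemma regular_obsD:
  assumes "regular_obs L F"
  shows "F \<in> borel_measurable (angle_measure L)" "\<exists>B. \<forall>\<theta>. \<bar>F \<theta>\<bar> \<le> B"
    "\<forall>i\<in>intr L. \<theta> i = \<theta>' i \<Longrightarrow> F \<theta> = F \<theta>'"
    "\<forall>i\<in>intr L. (\<lambda>n::nat. \<theta>n n i) \<longlonglongrightarrow> \<theta> i \<Longrightarrow> (\<lambda>n. F (\<theta>n n)) \<longlonglongrightarrow> F \<theta>"
  using assms by (simp_all add: regular_obs_def)

lemma regular_obs_const: "regular_obs L (\<lambda>_. c)"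
  by (rule regular_obsI[where B = "\<bar>c\<bar>"]) auto

lemma regular_obs_add:
  assumes F: "regular_obs L F" and G: "regular_obs L G"
  shows "regular_obs L (\<lambda>\<theta>. F \<theta> + G \<theta>)"
proof -
  obtain B C where "\<And>\<theta>. \<bar>F \<theta>\<bar> \<le> B" "\<And>\<theta>. \<bar>G \<theta>\<bar> \<le> C"
    using regular_obsD(2)[OF F] regular_obsD(2)[OF G] by blast
  then have b: "\<bar>F \<theta> + G \<theta>\<bar> \<le> B + C" for \<theta> by (meson abs_triangle_ineq add_mono order_trans)
  show ?thesis
    by (rule regular_obsI[OF _ b])
      (auto intro!: borel_measurable_add tendsto_add arg_cong2[where f = "(+)"] regular_obsD[OF F] regular_obsD[OF G])
qed

lemma regular_obs_mult:
  assumes F: "regular_obs L F" and G: "regular_obs L G"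
  shows "regular_obs L (\<lambda>\<theta>. F \<theta> * G \<theta>)"
proof -
  obtain B C where "\<And>\<theta>. \<bar>F \<theta>\<bar> \<le> B" "\<And>\<theta>. \<bar>G \<theta>\<bar> \<le> C"
    using regular_obsD(2)[OF F] regular_obsD(2)[OF G] by blast
  then have b: "\<bar>F \<theta> * G \<theta>\<bar> \<le> B * C" for \<theta>
    unfolding abs_mult by (intro mult_mono) (auto intro: order_trans[OF abs_ge_zero])
  show ?thesis
    by (rule regular_obsI[OF _ b])
      (auto intro!: borel_measurable_times tendsto_mult arg_cong2[where f = "(*)"] regular_obsD[OF F] regular_obsD[OF G])
qed

lemma regular_obs_sum:
  assumes "finite A" "\<And>a. a \<in> A \<Longrightarrow> regular_obs L (F a)"
  shows "regular_obs L (\<lambda>\<theta>. \<Sum>a\<in>A. F a \<theta>)"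
  using assms by (induction A rule: finite_induct) (auto intro: regular_obs_const regular_obs_add)

lemma regular_obs_exp:
  assumes F: "regular_obs L F"
  shows "regular_obs L (\<lambda>\<theta>. exp (F \<theta>))"
proof -
  obtain B where B: "\<And>\<theta>. \<bar>F \<theta>\<bar> \<le> B" using regular_obsD(2)[OF F] by blast
  have b: "\<bar>exp (F \<theta>)\<bar> \<le> exp B" for \<theta> using abs_le_D1[OF B[of \<theta>]] by simp
  have "(\<lambda>\<theta>. exp (F \<theta>)) \<in> borel_measurable (angle_measure L)"
    using regular_obsD(1)[OF F] by simp
  then show ?thesis
    by (rule regular_obsI[OF _ b])
      (auto intro!: tendsto_exp arg_cong[where f = exp] regular_obsD[OF F])
qed

lemma measurable_angle:
  assumes "i \<in> intr L"
  shows "(\<lambda>\<theta>. \<theta> i) \<in> borel_measurable (angle_measure L)"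
proof -
  have "(\<lambda>\<theta>. \<theta> i) \<in> measurable (angle_measure L) arc"
    unfolding angle_measure_def using assms by (rule measurable_component_singleton)
  moreover have "(\<lambda>t. t) \<in> measurable arc borel"
    by (rule measurable_restrict_space1) simp
  ultimately show ?thesis by (rule measurable_compose)
qed

lemma regular_obs_cos:
  assumes i: "i \<in> intr L"
  shows "regular_obs L (\<lambda>\<theta>. cos (\<theta> i))"
proof (rule regular_obsI[where B = 1])
  show "(\<lambda>\<theta>. cos (\<theta> i)) \<in> borel_measurable (angle_measure L)"
    using measurable_angle[OF i] by simp
qed (use i in \<open>auto intro!: tendsto_cos\<close>)

lemma regular_obs_cos_diff:
  assumes ij: "i \<in> intr L" "j \<in> intr L"
  shows "regular_obs L (\<lambda>\<theta>. cos (\<theta> i - \<theta> j))"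
proof (rule regular_obsI[where B = 1])
  show "(\<lambda>\<theta>. cos (\<theta> i - \<theta> j)) \<in> borel_measurable (angle_measure L)"
    using measurable_angle[OF ij(1)] measurable_angle[OF ij(2)] by simp
qed (use ij in \<open>auto intro!: tendsto_cos tendsto_diff\<close>)

lemma regular_obs_hamiltonian: "regular_obs L (\<lambda>\<theta>. c * hamiltonian \<nu> L \<theta>)"
proof (cases \<nu>)
  case Free
  have "(\<lambda>\<theta>. c * hamiltonian \<nu> L \<theta>) = (\<lambda>\<theta>. (- c) * (\<Sum>k\<in>intr L. \<Sum>l\<in>intr L. coupling k l * cos (\<theta> k - \<theta> l)))"
    by (simp add: Free hamiltonian_Free fun_eq_iff)
  then show ?thesis
    by (simp only:) (intro regular_obs_mult regular_obs_sum regular_obs_const regular_obs_cos_diff finite_intr)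
next
  case Plus
  have "(\<lambda>\<theta>. c * hamiltonian \<nu> L \<theta>) = (\<lambda>\<theta>. (- c) * ((\<Sum>k\<in>intr L. \<Sum>l\<in>intr L. coupling k l * cos (\<theta> k - \<theta> l))
    + 2 * (\<Sum>k\<in>intr L. (\<Sum>l\<in>bdry L. coupling k l) * cos (\<theta> k)) + (\<Sum>k\<in>bdry L. \<Sum>l\<in>bdry L. coupling k l)))"
    unfolding Plus hamiltonian_Plus by (simp only: mult_minus_left mult_minus_right)
  then show ?thesis
    by (simp only:) (intro regular_obs_mult regular_obs_add regular_obs_sum regular_obs_const
        regular_obs_cos regular_obs_cos_diff finite_intr)
qed

lemma regular_obs_spin_corr:
  assumes "x \<in> intr L" "y \<in> intr L"
  shows "regular_obs L (spin_corr_obs x y)"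
proof -
  have "spin_corr_obs x y = (\<lambda>\<theta>. cos (\<theta> x - \<theta> y))"
    by (simp add: fun_eq_iff spin_corr_obs_def sdot_def cos_diff)
  then show ?thesis using regular_obs_cos_diff[OF assms] by simp
qed

text \<open>The number of states runs through 2 j + 1 because Ginibre's substitution requires q
  odd.\<close>

lemma clock_sum_tendsto:
  assumes F: "regular_obs L F"
  shows "(\<lambda>j. (2 * pi / real (2 * j + 1)) ^ card (intr L) * clock_sum \<beta> \<nu> L (2 * j + 1) F) \<longlonglongrightarrow> fv_expect \<beta> \<nu> L F"
proof -
  let ?G = "\<lambda>\<theta>. exp (- \<beta> * hamiltonian \<nu> L \<theta>) * F \<theta>"
  have G: "regular_obs L ?G"
    by (intro regular_obs_mult regular_obs_exp regular_obs_hamiltonian F)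
  then obtain B where B: "\<And>\<theta>. \<bar>?G \<theta>\<bar> \<le> B" unfolding regular_obs_def by blast
  have lim: "filterlim (\<lambda>j::nat. 2 * j + 1) at_top sequentially" by real_asymp
  have "(\<lambda>j. (2 * pi / real (2 * j + 1)) ^ card (intr L) * (\<Sum>\<phi>\<in>conf (2 * j + 1) (intr L).
      ?G (\<lambda>i. 2 * pi / real (2 * j + 1) * real_of_int (\<phi> i)))) \<longlonglongrightarrow> integral\<^sup>L (PiM (intr L) (\<lambda>_. arc)) ?G"
  proof (rule Riemann_sum_tendsto[OF finite_intr _ B _ _ _ lim])
    show "?G \<in> borel_measurable (PiM (intr L) (\<lambda>_. arc))"
      using G unfolding regular_obs_def angle_measure_def by blast
    show "?G \<theta> = ?G \<theta>'" if "\<And>i. i \<in> intr L \<Longrightarrow> \<theta> i = \<theta>' i" for \<theta> \<theta>'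
      using G that unfolding regular_obs_def by blast
    show "(\<lambda>n. ?G (\<theta>n n)) \<longlonglongrightarrow> ?G \<theta>" if "\<And>i. i \<in> intr L \<Longrightarrow> (\<lambda>n::nat. \<theta>n n i) \<longlonglongrightarrow> \<theta> i" for \<theta>n \<theta>
      using G that unfolding regular_obs_def by blast
  qed auto
  then show ?thesis unfolding clock_sum_def fv_expect_def angle_measure_def .
qed

lemma card_conf: "finite V \<Longrightarrow> card (conf q V) = q ^ card V"
  unfolding conf_def by (subst card_PiE) auto

text \<open>The Riemann sums have a positive lower bound independent of j, since the Hamiltonian is
  bounded, and it survives the limit.\<close>

lemma partition_fn_pos: "0 < partition_fn \<beta> \<nu> L"
proof -
  have "regular_obs L (\<lambda>\<theta>. - \<beta> * hamiltonian \<nu> L \<theta>)" by (rule regular_obs_hamiltonian)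
  then obtain B where B: "\<And>\<theta>. \<bar>- \<beta> * hamiltonian \<nu> L \<theta>\<bar> \<le> B" unfolding regular_obs_def by blast
  have "(2 * pi) ^ card (intr L) * exp (- B)
      \<le> (2 * pi / real (2 * j + 1)) ^ card (intr L) * clock_sum \<beta> \<nu> L (2 * j + 1) (\<lambda>_. 1)" for j
  proof -
    have "(\<Sum>\<phi>\<in>conf (2 * j + 1) (intr L). exp (- B)) \<le> clock_sum \<beta> \<nu> L (2 * j + 1) (\<lambda>_. 1)"
      unfolding clock_sum_def
    proof (rule sum_mono)
      fix \<phi>
      show "exp (- B) \<le> exp (- \<beta> * hamiltonian \<nu> L (\<lambda>x. 2 * pi / real (2 * j + 1) * real_of_int (\<phi> x))) * 1"
        using B[of "\<lambda>x. 2 * pi / real (2 * j + 1) * real_of_int (\<phi> x)"] by simp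
    qed
    then have "real (2 * j + 1) ^ card (intr L) * exp (- B) \<le> clock_sum \<beta> \<nu> L (2 * j + 1) (\<lambda>_. 1)"
      by (simp add: card_conf)
    then have le: "(2 * pi / real (2 * j + 1)) ^ card (intr L) * (real (2 * j + 1) ^ card (intr L) * exp (- B))
        \<le> (2 * pi / real (2 * j + 1)) ^ card (intr L) * clock_sum \<beta> \<nu> L (2 * j + 1) (\<lambda>_. 1)"
      by (intro mult_left_mono) auto
    have eq: "(2 * pi / real (2 * j + 1)) ^ card (intr L) * (real (2 * j + 1) ^ card (intr L) * exp (- B))
        = (2 * pi) ^ card (intr L) * exp (- B)"
      by (simp add: power_divide del: of_nat_add of_nat_Suc)
    from le show ?thesis unfolding eq .
  qed
  then have "(2 * pi) ^ card (intr L) * exp (- B) \<le> partition_fn \<beta> \<nu> L"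
    unfolding partition_fn_def
    by (intro LIMSEQ_le_const[OF clock_sum_tendsto[OF regular_obs_const]]) auto
  then show ?thesis by (rule less_le_trans[rotated]) simp
qed

lemma clock_ratio_tendsto:
  assumes "regular_obs L F"
  shows "(\<lambda>j. clock_sum \<beta> \<nu> L (2 * j + 1) F / clock_sum \<beta> \<nu> L (2 * j + 1) (\<lambda>_. 1))
    \<longlonglongrightarrow> fv_expect \<beta> \<nu> L F / partition_fn \<beta> \<nu> L"
proof -
  have "(\<lambda>j. ((2 * pi / real (2 * j + 1)) ^ card (intr L) * clock_sum \<beta> \<nu> L (2 * j + 1) F) /
      ((2 * pi / real (2 * j + 1)) ^ card (intr L) * clock_sum \<beta> \<nu> L (2 * j + 1) (\<lambda>_. 1)))
    \<longlonglongrightarrow> fv_expect \<beta> \<nu> L F / fv_expect \<beta> \<nu> L (\<lambda>_. 1)"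
    using partition_fn_pos[of \<beta> \<nu> L] unfolding partition_fn_def
    by (intro tendsto_divide clock_sum_tendsto assms regular_obs_const) auto
  then show ?thesis by (simp add: partition_fn_def)
qed

section \<open>Finite-volume XY correlations and their infinite-volume limits\<close>

definition free_fv :: "real \<Rightarrow> nat \<Rightarrow> site \<Rightarrow> site \<Rightarrow> real" where
  "free_fv \<beta> L x y = fv_expect \<beta> Free L (spin_corr_obs x y) / partition_fn \<beta> Free L"

definition plus_fv :: "real \<Rightarrow> nat \<Rightarrow> real" where
  "plus_fv \<beta> L = fv_expect \<beta> Plus L (\<lambda>\<theta>. cos (\<theta> (0, 0, 0))) / partition_fn \<beta> Plus L"

lemma free_clock_tendsto:
  "x \<in> intr L \<Longrightarrow> y \<in> intr L \<Longrightarrow> (\<lambda>j. free_clock \<beta> L (2 * j + 1) x y) \<longlonglongrightarrow> free_fv \<beta> L x y"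
  unfolding free_clock_def free_fv_def by (intro clock_ratio_tendsto regular_obs_spin_corr)

lemma plus_clock_tendsto:
  "1 \<le> L \<Longrightarrow> (\<lambda>j. plus_clock \<beta> L (2 * j + 1)) \<longlonglongrightarrow> plus_fv \<beta> L"
  unfolding plus_clock_def plus_fv_def
  by (intro clock_ratio_tendsto regular_obs_cos) (simp add: intr_iff)

lemma free_fv_mono:
  assumes "0 \<le> \<beta>" "x \<in> intr L" "y \<in> intr L"
  shows "free_fv \<beta> L x y \<le> free_fv \<beta> (Suc L) x y"
proof (rule LIMSEQ_le[OF free_clock_tendsto free_clock_tendsto])
  show "x \<in> intr (Suc L)" "y \<in> intr (Suc L)"
    using assms by (cases x; cases y; auto simp: intr_iff)+
qed (use assms free_clock_mono in auto)

lemma plus_fv_antimono: "0 \<le> \<beta> \<Longrightarrow> 1 \<le> L \<Longrightarrow> plus_fv \<beta> (Suc L) \<le> plus_fv \<beta> L"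
  by (rule LIMSEQ_le[OF plus_clock_tendsto plus_clock_tendsto]) (use plus_clock_antimono in auto)

lemma fv_ratio_bounded:
  assumes F: "regular_obs L F" and b: "\<And>\<theta>. \<bar>F \<theta>\<bar> \<le> 1"
  shows "\<bar>fv_expect \<beta> \<nu> L F / partition_fn \<beta> \<nu> L\<bar> \<le> 1"
proof (rule LIMSEQ_le_const2[OF tendsto_rabs[OF clock_ratio_tendsto[OF F]]], intro exI allI impI)
  fix j :: nat
  have "\<bar>clock_sum \<beta> \<nu> L (2 * j + 1) F\<bar> \<le> clock_sum \<beta> \<nu> L (2 * j + 1) (\<lambda>_. 1)"
    unfolding clock_sum_def using b by (intro sum_abs[THEN order_trans] sum_mono) (simp add: abs_mult)
  then show "\<bar>clock_sum \<beta> \<nu> L (2 * j + 1) F / clock_sum \<beta> \<nu> L (2 * j + 1) (\<lambda>_. 1)\<bar> \<le> 1"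
    \<comment> \<open>If the denominator vanishes, the quotient is 0 by convention.\<close>
    by (cases "clock_sum \<beta> \<nu> L (2 * j + 1) (\<lambda>_. 1) = 0") (auto simp: divide_le_eq_1 abs_divide)
qed

text \<open>\<open>gibbs\<close> is a \<open>lim\<close>, meaningful only once convergence is known;
  here it follows from monotonicity and the bound 1. The offset M is where both sites have become
  interior.\<close>

lemma free_fv_tendsto_gibbs:
  assumes "0 \<le> \<beta>"
  shows "(\<lambda>L. free_fv \<beta> L x y) \<longlonglongrightarrow> gibbs \<beta> Free (spin_corr_obs x y)"
proof -
  define M where "M = nat (max (supnorm x) (supnorm y)) + 1"
  have mem: "x \<in> intr L" "y \<in> intr L" if "M \<le> L" for L
    using that by (auto simp: M_def intr_def box_def bdry_def)
  let ?f = "\<lambda>L. free_fv \<beta> (L + M) x y"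
  have inc: "incseq ?f"
    by (rule incseq_SucI) (use free_fv_mono[OF assms mem] in auto)
  have bd: "\<forall>L. ?f L \<le> 1"
  proof
    fix L
    have "\<bar>spin_corr_obs x y \<theta>\<bar> \<le> 1" for \<theta>
      by (simp add: spin_corr_obs_def sdot_def cos_diff[symmetric])
    from abs_le_D1[OF fv_ratio_bounded[OF regular_obs_spin_corr[OF mem[of "L + M"]] this, of \<beta> Free]]
    show "?f L \<le> 1" unfolding free_fv_def by simp
  qed
  have "convergent ?f"
    using incseq_convergent[OF inc bd] unfolding convergent_def by metis
  then have "convergent (\<lambda>L. free_fv \<beta> L x y)"
    using convergent_ignore_initial_segment[where f = "\<lambda>L. free_fv \<beta> L x y"] by blast
  then show ?thesis unfolding gibbs_def free_fv_def by (simp add: convergent_LIMSEQ_iff)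
qed

lemma plus_fv_tendsto_magnetization:
  assumes "0 \<le> \<beta>"
  shows "(\<lambda>L. plus_fv \<beta> L) \<longlonglongrightarrow> magnetization \<beta>"
proof -
  \<comment> \<open>The offset skips L = 0, where the interior is empty.\<close>
  let ?f = "\<lambda>L. plus_fv \<beta> (L + 1)"
  have dec: "decseq ?f"
    by (rule decseq_SucI) (use plus_fv_antimono[OF assms] in auto)
  have bd: "\<forall>L. - 1 \<le> ?f L"
  proof
    fix L
    have "regular_obs (L + 1) (\<lambda>\<theta>. cos (\<theta> (0, 0, 0)))" by (rule regular_obs_cos) (simp add: intr_iff)
    from abs_le_D2[OF fv_ratio_bounded[OF this, of \<beta> Plus]] show "- 1 \<le> ?f L"
      unfolding plus_fv_def by (simp only: minus_le_iff abs_cos_le_one)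
  qed
  have "convergent ?f"
    using decseq_convergent[OF dec bd] unfolding convergent_def by metis
  then have "convergent (\<lambda>L. plus_fv \<beta> L)" by (simp only: convergent_ignore_initial_segment)
  then show ?thesis unfolding magnetization_def gibbs_def plus_fv_def by (simp add: convergent_LIMSEQ_iff)
qed

section \<open>Removing the auxiliary parameters and reaching the critical point\<close>

lemma box_subset_intr: "n < L \<Longrightarrow> box n \<subseteq> intr L"
  by (auto simp: box_iff intr_iff)

text \<open>With n and L fixed, q goes to infinity, then the torus side, which removes card (intr l)
  / N^3, then the wired box l, which removes the plus magnetization. The order matters: l must stay
  fixed while the torus grows.\<close>

lemma free_fv_average_bound:
  assumes \<beta>: "0 < \<beta>" and nL: "n < L" and m: "magnetization \<beta> = 0"
  shows "(1 / real (card (box n)) ^ 2) * (\<Sum>x\<in>box n. \<Sum>y\<in>box n. free_fv \<beta> L x y) \<le> 432 / (\<beta> * real (2 * n + 1))"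
proof -
  let ?A = "(1 / real (card (box n)) ^ 2) * (\<Sum>x\<in>box n. \<Sum>y\<in>box n. free_fv \<beta> L x y)"
  let ?c = "432 / (\<beta> * real (2 * n + 1))"
  have bl: "?A \<le> ?c + 2 * \<bar>plus_fv \<beta> l\<bar>" if l: "1 \<le> l" for l
  proof -
    let ?N = "\<lambda>K. (2 * int n + 1) * 2 ^ K"
    have bK: "?A \<le> ?c + 2 * (real (card (intr l)) / real_of_int (?N K) ^ 3 + \<bar>plus_fv \<beta> l\<bar>)"
      if K: "2 * l + 2 * L + 2 \<le> K" for K
    proof (rule LIMSEQ_le)
      show "(\<lambda>j. (1 / real (card (box n)) ^ 2) * (\<Sum>x\<in>box n. \<Sum>y\<in>box n. free_clock \<beta> L (2 * j + 1) x y)) \<longlonglongrightarrow> ?A"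
        using box_subset_intr[OF nL] by (intro tendsto_intros free_clock_tendsto) auto
      show "(\<lambda>j. ?c + 2 * (real (card (intr l)) / real_of_int (?N K) ^ 3 + \<bar>plus_clock \<beta> l (2 * j + 1)\<bar>))
          \<longlonglongrightarrow> ?c + 2 * (real (card (intr l)) / real_of_int (?N K) ^ 3 + \<bar>plus_fv \<beta> l\<bar>)"
        by (intro tendsto_add tendsto_const tendsto_mult tendsto_rabs plus_clock_tendsto l)
      \<comment> \<open>2 ^ K > K turns the lower bound on K into room for both boxes in the
        torus.\<close>
      have "K < 2 ^ K" by (rule less_exp)
      then have "int K < 2 ^ K" by (metis of_nat_less_iff of_nat_numeral of_nat_power)
      also have "(2 :: int) ^ K \<le> ?N K" using mult_right_mono[of 1 "2 * int n + 1" "2 ^ K"] by simp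
      finally have "int K \<le> ?N K" by simp
      then have "2 * int l + 2 \<le> ?N K" "2 * int L + 2 \<le> ?N K" "1 \<le> K" using K by linarith+
      then show "\<exists>j0. \<forall>j\<ge>j0. (1 / real (card (box n)) ^ 2) * (\<Sum>x\<in>box n. \<Sum>y\<in>box n. free_clock \<beta> L (2 * j + 1) x y)
          \<le> ?c + 2 * (real (card (intr l)) / real_of_int (?N K) ^ 3 + \<bar>plus_clock \<beta> l (2 * j + 1)\<bar>)"
        using free_average_bound[OF _ \<beta> _ refl nL l] by simp
    qed
    have "real (card (intr l)) / real_of_int (?N K) ^ 3 = real (card (intr l)) / real (2 * n + 1) ^ 3 * (1 / 8) ^ K" for K
    proof -
      have "((2 :: real) ^ K) ^ 3 = 8 ^ K" by (simp add: power_mult[symmetric] mult.commute[of K] power_mult)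
      then show ?thesis by (simp add: power_mult_distrib power_divide add.commute)
    qed
    moreover have "(\<lambda>K. real (card (intr l)) / real (2 * n + 1) ^ 3 * (1 / 8) ^ K)
        \<longlonglongrightarrow> real (card (intr l)) / real (2 * n + 1) ^ 3 * 0"
      by (intro tendsto_mult tendsto_const LIMSEQ_power_zero) simp
    ultimately have "(\<lambda>K. real (card (intr l)) / real_of_int (?N K) ^ 3) \<longlonglongrightarrow> 0" by simp
    then have "(\<lambda>K. ?c + 2 * (real (card (intr l)) / real_of_int (?N K) ^ 3 + \<bar>plus_fv \<beta> l\<bar>))
        \<longlonglongrightarrow> ?c + 2 * (0 + \<bar>plus_fv \<beta> l\<bar>)"
      by (intro tendsto_add tendsto_const tendsto_mult)
    from LIMSEQ_le_const[OF this] bK show ?thesis by auto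
  qed
  have "(\<lambda>l. ?c + 2 * \<bar>plus_fv \<beta> l\<bar>) \<longlonglongrightarrow> ?c + 2 * \<bar>0\<bar>"
    using plus_fv_tendsto_magnetization[of \<beta>] \<beta> m
    by (intro tendsto_add tendsto_const tendsto_mult tendsto_rabs) auto
  from LIMSEQ_le_const[OF this] bl show ?thesis by auto
qed

text \<open>Bounded inverse temperatures give the common majorant exp (M H) B. The statement is
  confined to finite volume, so \<beta> has to reach \<beta>c before L grows.\<close>

lemma fv_expect_continuous:
  assumes F: "regular_obs L F" and b: "b \<longlonglongrightarrow> b0" and M: "\<And>j. \<bar>b j\<bar> \<le> M"
  shows "(\<lambda>j. fv_expect (b j) \<nu> L F) \<longlonglongrightarrow> fv_expect b0 \<nu> L F"
proof -
  interpret fm: finite_measure "angle_measure L"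
    unfolding angle_measure_def by (rule finite_measure_PiM_arc) simp
  from regular_obs_hamiltonian[of L 1 \<nu>] obtain H where H: "\<And>\<theta>. \<bar>hamiltonian \<nu> L \<theta>\<bar> \<le> H"
    unfolding regular_obs_def by auto
  from F obtain B where B: "\<And>\<theta>. \<bar>F \<theta>\<bar> \<le> B" unfolding regular_obs_def by blast
  have meas: "(\<lambda>\<theta>. exp (- a * hamiltonian \<nu> L \<theta>) * F \<theta>) \<in> borel_measurable (angle_measure L)" for a
    using regular_obs_mult[OF regular_obs_exp[OF regular_obs_hamiltonian[of L "- a" \<nu>]] F]
    unfolding regular_obs_def by blast
  show ?thesis
    unfolding fv_expect_def
  proof (rule integral_dominated_convergence[where w = "\<lambda>_. exp (M * H) * B"])
    show "AE \<theta> in angle_measure L. (\<lambda>j. exp (- b j * hamiltonian \<nu> L \<theta>) * F \<theta>) \<longlonglongrightarrow> exp (- b0 * hamiltonian \<nu> L \<theta>) * F \<theta>"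
      by (intro AE_I2 tendsto_intros b)
    show "AE \<theta> in angle_measure L. norm (exp (- b j * hamiltonian \<nu> L \<theta>) * F \<theta>) \<le> exp (M * H) * B" for j
    proof (rule AE_I2)
      fix \<theta>
      have "- b j * hamiltonian \<nu> L \<theta> \<le> \<bar>b j\<bar> * \<bar>hamiltonian \<nu> L \<theta>\<bar>" by (metis abs_ge_self abs_minus_cancel abs_mult)
      also have "\<dots> \<le> M * H" by (intro mult_mono M H) (use M[of j] in auto)
      finally show "norm (exp (- b j * hamiltonian \<nu> L \<theta>) * F \<theta>) \<le> exp (M * H) * B"
        unfolding real_norm_def abs_mult by (intro mult_mono) (auto simp: B)
    qed
  qed (use meas in auto)
qed

text \<open>The bound for \<open>\<beta> < \<beta>c\<close> is uniform up to \<open>\<beta>c\<close>, hence survives at \<open>\<beta>c\<close> in finite volume; there the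
  magnetization itself need not be known to vanish.\<close>

lemma free_fv_average_bound_critical:
  assumes c: "is_critical_beta \<beta>c" and nL: "n < L"
  shows "(1 / real (card (box n)) ^ 2) * (\<Sum>x\<in>box n. \<Sum>y\<in>box n. free_fv \<beta>c L x y) \<le> 432 / (\<beta>c * real (2 * n + 1))"
proof -
  have pos: "0 < \<beta>c" and m: "\<And>\<beta>. 0 < \<beta> \<Longrightarrow> \<beta> < \<beta>c \<Longrightarrow> magnetization \<beta> = 0"
    using c by (auto simp: is_critical_beta_def)
  \<comment> \<open>An approach to \<beta>c from below; j + 2 keeps the first member
    positive.\<close>
  define b where "b j = \<beta>c * (1 - 1 / real (j + 2))" for j :: nat
  have "0 < 1 - 1 / real (j + 2)" "1 - 1 / real (j + 2) < 1" for j by (auto simp: field_simps)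
  then have b: "0 < b j" "b j < \<beta>c" for j
    using pos mult_strict_left_mono[of "1 - 1 / real (j + 2)" 1 \<beta>c] unfolding b_def by auto
  have "(\<lambda>j::nat. 1 - 1 / real (j + 2)) \<longlonglongrightarrow> 1" by real_asymp
  from tendsto_mult[OF tendsto_const this, of \<beta>c] have lim: "b \<longlonglongrightarrow> \<beta>c" by (simp add: b_def[abs_def])
  have M: "\<bar>b j\<bar> \<le> \<beta>c" for j using b[of j] by simp
  have "(\<lambda>j. free_fv (b j) L x y) \<longlonglongrightarrow> free_fv \<beta>c L x y" if "x \<in> box n" "y \<in> box n" for x y
    unfolding free_fv_def partition_fn_def
    using that box_subset_intr[OF nL] partition_fn_pos[of \<beta>c Free L, unfolded partition_fn_def]
    by (intro tendsto_divide fv_expect_continuous[OF _ lim M] regular_obs_spin_corr regular_obs_const) auto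
  then have "(\<lambda>j. (1 / real (card (box n)) ^ 2) * (\<Sum>x\<in>box n. \<Sum>y\<in>box n. free_fv (b j) L x y))
      \<longlonglongrightarrow> (1 / real (card (box n)) ^ 2) * (\<Sum>x\<in>box n. \<Sum>y\<in>box n. free_fv \<beta>c L x y)"
    by (intro tendsto_mult tendsto_const tendsto_sum)
  moreover have "(\<lambda>j. 432 / (b j * real (2 * n + 1))) \<longlonglongrightarrow> 432 / (\<beta>c * real (2 * n + 1))"
    using pos by (intro tendsto_divide tendsto_const tendsto_mult lim) auto
  ultimately show ?thesis
    by (rule LIMSEQ_le) (use free_fv_average_bound[OF b(1) nL m[OF b]] in auto)
qed

theorem theorem2p1:
  fixes \<beta>c :: real
  assumes "is_critical_beta \<beta>c"
  shows "(\<lambda>n. (1 / real (card (box n))^2) *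
            (\<Sum>x\<in>box n. \<Sum>y\<in>box n. gibbs \<beta>c Free (spin_corr_obs x y)))
         \<longlonglongrightarrow> 0"
proof (rule tendsto_sandwich)
  let ?g = "\<lambda>n. (1 / real (card (box n))^2) * (\<Sum>x\<in>box n. \<Sum>y\<in>box n. gibbs \<beta>c Free (spin_corr_obs x y))"
  have pos: "0 < \<beta>c" using assms by (simp add: is_critical_beta_def)
  have lim: "(\<lambda>L. (1 / real (card (box n)) ^ 2) * (\<Sum>x\<in>box n. \<Sum>y\<in>box n. free_fv \<beta>c L x y)) \<longlonglongrightarrow> ?g n" for n
    using pos by (intro tendsto_mult tendsto_const tendsto_sum free_fv_tendsto_gibbs) simp
  have "?g n \<le> 432 / (\<beta>c * real (2 * n + 1))" for n
    by (rule LIMSEQ_le_const2[OF lim])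
      (use free_fv_average_bound_critical[OF assms, of n] in \<open>auto intro!: exI[of _ "Suc n"] simp: Suc_le_eq\<close>)
  then show "\<forall>\<^sub>F n in sequentially. ?g n \<le> 432 / (\<beta>c * real (2 * n + 1))" by simp
  \<comment> \<open>The lower bound is pulled back through L and q to the clock model, where the
    double sum is the expectation of a square.\<close>
  have "0 \<le> (1 / real (card (box n)) ^ 2) * (\<Sum>x\<in>box n. \<Sum>y\<in>box n. free_fv \<beta>c L x y)" if nL: "n < L" for n L
  proof (rule LIMSEQ_le_const)
    show "(\<lambda>j. (1 / real (card (box n)) ^ 2) * (\<Sum>x\<in>box n. \<Sum>y\<in>box n. free_clock \<beta>c L (2 * j + 1) x y))
      \<longlonglongrightarrow> (1 / real (card (box n)) ^ 2) * (\<Sum>x\<in>box n. \<Sum>y\<in>box n. free_fv \<beta>c L x y)"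
      using box_subset_intr[OF nL] by (intro tendsto_intros free_clock_tendsto) auto
    have "0 \<le> (\<Sum>x\<in>box n. \<Sum>y\<in>box n. free_clock \<beta>c L (2 * j + 1) x y)" for j
      unfolding free_clock_eq_wcorr[where g = "(0, 0, 0)"]
      by (rule sum_sum_wcorr_nonneg) (use nL in \<open>auto simp: intr_iff\<close>)
    then show "\<exists>j0. \<forall>j\<ge>j0. 0 \<le> (1 / real (card (box n)) ^ 2) * (\<Sum>x\<in>box n. \<Sum>y\<in>box n. free_clock \<beta>c L (2 * j + 1) x y)"
      by simp
  qed
  then have "0 \<le> ?g n" for n
    by (intro LIMSEQ_le_const[OF lim] exI[of _ "Suc n"]) (auto simp: Suc_le_eq)
  then show "\<forall>\<^sub>F n in sequentially. 0 \<le> ?g n" by simp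
  show "(\<lambda>n. 432 / (\<beta>c * real (2 * n + 1))) \<longlonglongrightarrow> 0"
    using pos by real_asymp
qed simp

end
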